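(* Let $\tau_E:E\to Q$ be a real vector bundle over a manifold $Q$ with an algebroid structure $(B_E,\rho^l_E,\rho^r_E)$, let $E^*$ be the dual bundle with projection $\tau_{E^*}:E^*\to Q$, and let $\tau_{\mathcal{T}_l^EE^*}:\mathcal{T}_l^EE^*\to E^*$ be the left $E$-tangent bundle to $E^*$. Then the vector bundle $\tau_{\mathcal{T}_l^EE^*}:\mathcal{T}_l^EE^*\to E^*$ admits an exact symplectic algebroid structure, i.e. there exist an algebroid structure on $\mathcal{T}_l^EE^*\to E^*$ and a section of the dual bundle $(\mathcal{T}_l^EE^* )^*\to E^*$ making it an exact symplectic algebroid.
   Context: All objects are smooth; $\Gamma(\tau)$ denotes the space of smooth sections of a vector bundle $\tau$; vector bundle morphisms into a tangent bundle cover the identity of the base. Algebroid structure: on a real vector bundle $\tau_{\bar E}:\bar E\to\bar Q$, an algebroid structure $(B_{\bar E},\rho^l_{\bar E},\rho^r_{\bar E})$ consists of an $\mathbb{R}$-bilinear bracket $B_{\bar E}:\Gamma(\tau_{\bar E})\times\Gamma(\tau_{\bar E})\to\Gamma(\tau_{\bar E})$ and two vector bundle morphisms $\rho^l_{\bar E},\rho^r_{\bar E}:\bar E\to T\bar Q$ (left and right anchors) such that $$B_{\bar E}(f\sigma,f'\sigma')=f\rho^l_{\bar E}(\sigma)(f')\,\sigma'-f'\rho^r_{\bar E}(\sigma')(f)\,\sigma+ff'B_{\bar E}(\sigma,\sigma')$$ for all $f,f'\in C^\infty(\bar Q)$, $\sigma,\sigma'\in\Gamma(\tau_{\bar E})$.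 No skew-symmetry or Jacobi identity is required. Differential of a section: for $\kappa\in\Gamma(\tau_{\bar E^*})$, $d^{lr}_{\bar E}\kappa$ is the tensor of type $(0,2)$ on $\bar E$ given by $$(d^{lr}_{\bar E}\kappa)(\sigma,\sigma')=\rho^l_{\bar E}(\sigma)(\kappa(\sigma'))-\rho^r_{\bar E}(\sigma')(\kappa(\sigma))-\kappa(B_{\bar E}(\sigma,\sigma')).$$ Exact symplectic algebroid: $\bar E\to\bar Q$ with an algebroid structure is exact symplectic if there exists $\lambda_{\bar E}\in\Gamma(\tau_{\bar E^*})$ such that the $(0,2)$-tensor $\Omega_{\bar E}=-d^{lr}_{\bar E}\lambda_{\bar E}$ is skew-symmetric and nondegenerate. Left $E$-tangent bundle to $E^*$: the vector bundle $\mathcal{T}_l^EE^*\to E^*$ whose fiber at $\kappa_q\in E^*_q$ is $$(\mathcal{T}_l^EE^* )_{\kappa_q}=\{(\sigma_q,\tilde X_{\kappa_q})\in E_q\times T_{\kappa_q}E^*\;:\;\rho^l_E(\sigma_q)=(T_{\kappa_q}\tau_{E^*})(\tilde X_{\kappa_q})\}.$$ *)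

theory Defs
  imports "HOL-Analysis.Analysis" "HOL-Library.Function_Algebras"
begin

section \<open>Linear algebra\<close>

text \<open>
  Model spaces are finite-dimensional inner product spaces. Unlike \<^class>\<open>euclidean_space\<close>,
  this class admits the zero space, so manifolds of dimension 0 and bundles of rank 0 are included.
\<close>

class fin_dim_inner = real_inner +
  assumes finite_spanning: "\<exists>B. finite B \<and> (\<forall>x. \<exists>c. x = (\<Sum>b\<in>B. c b *\<^sub>R b))"

lemma finite_spanningI:
  fixes B :: "'a::real_vector set"
  assumes "finite B" "span B = UNIV"
  shows "\<exists>B::'a set. finite B \<and> (\<forall>x. \<exists>c. x = (\<Sum>b\<in>B. c b *\<^sub>R b))"
proof -
  have "\<exists>c. x = (\<Sum>b\<in>B. c b *\<^sub>R b)" for x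
    using assms span_finite[of B] by (metis (no_types, lifting) UNIV_I imageE)
  with assms show ?thesis by blast
qed

instance euclidean_space \<subseteq> fin_dim_inner
  by standard (rule finite_spanningI[OF finite_Basis span_Basis])

instance prod :: (fin_dim_inner, fin_dim_inner) fin_dim_inner
proof
  obtain B :: "'a set" where B: "finite B" "\<And>x. \<exists>c. x = (\<Sum>b\<in>B. c b *\<^sub>R b)"
    using finite_spanning by blast
  obtain C :: "'b set" where C: "finite C" "\<And>y. \<exists>d. y = (\<Sum>b\<in>C. d b *\<^sub>R b)"
    using finite_spanning by blast
  let ?BC = "(\<lambda>x. (x, 0)) ` B \<union> (\<lambda>y. (0, y)) ` C :: ('a \<times> 'b) set"
  have "z \<in> span ?BC" for z
  proof -
    obtain c where c: "fst z = (\<Sum>b\<in>B. c b *\<^sub>R b)" using B(2) by blast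
    obtain d where d: "snd z = (\<Sum>b\<in>C. d b *\<^sub>R b)" using C(2) by blast
    have z: "z = (\<Sum>b\<in>B. c b *\<^sub>R (b, 0)) + (\<Sum>b\<in>C. d b *\<^sub>R (0, b))"
      by (rule prod_eqI) (simp_all add: c d fst_sum snd_sum)
    show ?thesis
      unfolding z by (intro span_add span_sum span_scale span_base) auto
  qed
  moreover have "finite ?BC" using B(1) C(1) by simp
  ultimately show "\<exists>B::('a \<times> 'b) set. finite B \<and> (\<forall>z. \<exists>c. z = (\<Sum>b\<in>B. c b *\<^sub>R b))"
    by (intro finite_spanningI) blast+
qed

instantiation "fun" :: (type, real_vector) real_vector
begin

definition scaleR_fun :: "real \<Rightarrow> ('a \<Rightarrow> 'b) \<Rightarrow> 'a \<Rightarrow> 'b"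
  where "scaleR_fun a f = (\<lambda>x. a *\<^sub>R f x)"

instance
  by standard (auto simp: scaleR_fun_def fun_eq_iff scaleR_add_left scaleR_add_right)

end

definition linear_on :: "'a::real_vector set \<Rightarrow> ('a \<Rightarrow> 'b::real_vector) \<Rightarrow> bool"
  where "linear_on S f \<longleftrightarrow>
    (\<forall>x\<in>S. \<forall>y\<in>S. \<forall>a b. f (a *\<^sub>R x + b *\<^sub>R y) = a *\<^sub>R f x + b *\<^sub>R f y)"


section \<open>Smooth manifolds\<close>

text \<open>Both notions are meant for open sets \<open>S\<close> only.\<close>

primrec Ck_on :: "nat \<Rightarrow> 'a::real_normed_vector set \<Rightarrow> ('a \<Rightarrow> 'b::real_normed_vector) \<Rightarrow> bool"
  where
    "Ck_on 0 S f \<longleftrightarrow> continuous_on S f"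
  | "Ck_on (Suc k) S f \<longleftrightarrow>
      (\<forall>x\<in>S. f differentiable (at x)) \<and> (\<forall>v. Ck_on k S (\<lambda>x. frechet_derivative f (at x) v))"

definition smooth_on :: "'a::real_normed_vector set \<Rightarrow> ('a \<Rightarrow> 'b::real_normed_vector) \<Rightarrow> bool"
  where "smooth_on S f \<longleftrightarrow> (\<forall>k. Ck_on k S f)"

text \<open>
  A manifold is given by an atlas alone: a chart is a pair of a domain and a coordinate map (whose
  values outside the domain are irrelevant), the underlying set is the union of the domains, and
  the topology is the one for which all charts are homeomorphisms onto open sets.
\<close>

type_synonym ('p, 'm) chart = "'p set \<times> ('p \<Rightarrow> 'm)"
type_synonym ('p, 'm) atlas = "('p, 'm) chart set"

definition carrier :: "('p, 'm) atlas \<Rightarrow> 'p set"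
  where "carrier A = (\<Union>(D, \<phi>)\<in>A. D)"

definition atlas_topology :: "('p, 'm::real_normed_vector) atlas \<Rightarrow> 'p topology"
  where "atlas_topology A =
    topology (\<lambda>W. W \<subseteq> carrier A \<and> (\<forall>(D, \<phi>)\<in>A. open (\<phi> ` (W \<inter> D))))"

definition smooth_manifold :: "('p, 'm::fin_dim_inner) atlas \<Rightarrow> bool"
  where "smooth_manifold A \<longleftrightarrow>
    (\<forall>(D, \<phi>)\<in>A. inj_on \<phi> D \<and> open (\<phi> ` D)) \<and>
    (\<forall>(D, \<phi>)\<in>A. \<forall>(D', \<phi>')\<in>A.
        open (\<phi> ` (D \<inter> D')) \<and> smooth_on (\<phi> ` (D \<inter> D')) (\<lambda>x. \<phi>' (inv_into D \<phi> x))) \<and>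
    Hausdorff_space (atlas_topology A) \<and> second_countable (atlas_topology A)"

definition smooth_map ::
  "('p, 'm::real_normed_vector) atlas \<Rightarrow> ('r, 'n::real_normed_vector) atlas \<Rightarrow> ('p \<Rightarrow> 'r) \<Rightarrow> bool"
  where "smooth_map A A' F \<longleftrightarrow>
    F ` carrier A \<subseteq> carrier A' \<and>
    (\<forall>(D, \<phi>)\<in>A. \<forall>(D', \<phi>')\<in>A'.
        open (\<phi> ` (D \<inter> F -` D')) \<and>
        smooth_on (\<phi> ` (D \<inter> F -` D')) (\<lambda>x. \<phi>' (F (inv_into D \<phi> x))))"

definition smooth_fun_on ::
  "('p, 'm::real_normed_vector) atlas \<Rightarrow> 'p set \<Rightarrow> ('p \<Rightarrow> 'b::real_normed_vector) \<Rightarrow> bool"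
  where "smooth_fun_on A W f \<longleftrightarrow>
    (\<forall>(D, \<phi>)\<in>A. smooth_on (\<phi> ` (W \<inter> D)) (\<lambda>x. f (inv_into D \<phi> x)))"

definition C_inf :: "('p, 'm::real_normed_vector) atlas \<Rightarrow> ('p \<Rightarrow> real) set"
  where "C_inf A = {f. smooth_fun_on A (carrier A) f}"

text \<open>
  The tangent vector at \<open>p\<close> with component vector \<open>v\<close> in a chart is identified with the
  directional derivative it induces on globally defined smooth functions (as an operator, it is
  extended by 0 to arguments that are not smooth).
\<close>

definition chart_vector ::
  "('p, 'm::real_normed_vector) atlas \<Rightarrow> ('p, 'm) chart \<Rightarrow> 'p \<Rightarrow> 'm \<Rightarrow> ('p \<Rightarrow> real) \<Rightarrow> real"
  where "chart_vector A c p v = (\<lambda>f. case c of (D, \<phi>) \<Rightarrow>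
    if f \<in> C_inf A then frechet_derivative (\<lambda>x. f (inv_into D \<phi> x)) (at (\<phi> p)) v else 0)"

definition tangent_space ::
  "('p, 'm::real_normed_vector) atlas \<Rightarrow> 'p \<Rightarrow> (('p \<Rightarrow> real) \<Rightarrow> real) set"
  where "tangent_space A p = {chart_vector A c p v |c v. c \<in> A \<and> p \<in> fst c}"

definition components ::
  "('p, 'm::real_normed_vector) atlas \<Rightarrow> ('p, 'm) chart \<Rightarrow> 'p \<Rightarrow> (('p \<Rightarrow> real) \<Rightarrow> real) \<Rightarrow> 'm"
  where "components A c p X = (THE v. X = chart_vector A c p v)"

text \<open>The tangent map of a smooth map \<open>F\<close> into the manifold \<open>A'\<close>.\<close>

definition tangent_map ::
  "('r, 'n::real_normed_vector) atlas \<Rightarrow> ('p \<Rightarrow> 'r) \<Rightarrow> (('p \<Rightarrow> real) \<Rightarrow> real) \<Rightarrow> ('r \<Rightarrow> real) \<Rightarrow> real"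
  where "tangent_map A' F X = (\<lambda>f. if f \<in> C_inf A' then X (\<lambda>p. f (F p)) else 0)"


section \<open>Vector bundles\<close>

text \<open>
  The fibres are linear subspaces of a real vector space type \<open>'v\<close>, which carries no topology and
  may be infinite-dimensional; fibres over distinct points need not be disjoint or otherwise
  related inside \<open>'v\<close>, and the total space consists of the pairs \<open>(q, v)\<close> with \<open>v\<close> in the fibre
  over \<open>q\<close>. A local trivialisation \<open>(U, \<psi>)\<close> maps the fibre over \<open>q \<in> U\<close> to the model space \<open>'k\<close>
  by \<open>\<psi> q\<close>.
\<close>

record ('q, 'm, 'v, 'k) vbundle =
  base :: "('q, 'm) atlas"
  fiber :: "'q \<Rightarrow> 'v set"
  trivs :: "('q set \<times> ('q \<Rightarrow> 'v \<Rightarrow> 'k)) set"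

definition vector_bundle ::
  "('q, 'm::fin_dim_inner, 'v::real_vector, 'k::fin_dim_inner) vbundle \<Rightarrow> bool"
  where "vector_bundle V \<longleftrightarrow>
    smooth_manifold (base V) \<and>
    (\<forall>q\<in>carrier (base V). subspace (fiber V q)) \<and>
    (\<Union>(U, \<psi>)\<in>trivs V. U) = carrier (base V) \<and>
    (\<forall>(U, \<psi>)\<in>trivs V. openin (atlas_topology (base V)) U \<and>
        (\<forall>q\<in>U. linear_on (fiber V q) (\<psi> q) \<and> bij_betw (\<psi> q) (fiber V q) UNIV)) \<and>
    (\<forall>(U, \<psi>)\<in>trivs V. \<forall>(U', \<psi>')\<in>trivs V. \<forall>v.
        smooth_fun_on (base V) (U \<inter> U') (\<lambda>q. \<psi>' q (inv_into (fiber V q) (\<psi> q) v)))"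

definition bundle_chart ::
  "('q \<Rightarrow> 'v set) \<Rightarrow> ('q, 'm) chart \<Rightarrow> 'q set \<times> ('q \<Rightarrow> 'v \<Rightarrow> 'k) \<Rightarrow> ('q \<times> 'v, 'm \<times> 'k) chart"
  where "bundle_chart F c t = (case (c, t) of ((D, \<phi>), (U, \<psi>)) \<Rightarrow>
    ({(q, v). q \<in> D \<inter> U \<and> v \<in> F q}, \<lambda>(q, v). (\<phi> q, \<psi> q v)))"

definition total_atlas :: "('q, 'm, 'v, 'k) vbundle \<Rightarrow> ('q \<times> 'v, 'm \<times> 'k) atlas"
  where "total_atlas V = {bundle_chart (fiber V) c t |c t. c \<in> base V \<and> t \<in> trivs V}"

text \<open>Sections are extended by 0 outside the base, so that they form a linear subspace.\<close>

definition sections ::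
  "('q, 'm::real_normed_vector, 'v::real_vector, 'k::real_normed_vector) vbundle \<Rightarrow> ('q \<Rightarrow> 'v) set"
  where "sections V = {\<sigma>.
    (\<forall>q\<in>carrier (base V). \<sigma> q \<in> fiber V q) \<and> (\<forall>q. q \<notin> carrier (base V) \<longrightarrow> \<sigma> q = 0) \<and>
    smooth_map (base V) (total_atlas V) (\<lambda>q. (q, \<sigma> q))}"

text \<open>Vector bundle morphisms covering the identity of a common base.\<close>

definition vb_morphism ::
  "('q, 'm::real_normed_vector, 'v::real_vector, 'k::real_normed_vector) vbundle \<Rightarrow>
   ('q, 'm, 'w::real_vector, 'l::real_normed_vector) vbundle \<Rightarrow> ('q \<Rightarrow> 'v \<Rightarrow> 'w) \<Rightarrow> bool"
  where "vb_morphism V W h \<longleftrightarrow>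
    base V = base W \<and>
    (\<forall>q\<in>carrier (base V). linear_on (fiber V q) (h q) \<and> h q ` fiber V q \<subseteq> fiber W q) \<and>
    smooth_map (total_atlas V) (total_atlas W) (\<lambda>(q, v). (q, h q v))"

definition tangent_bundle ::
  "('q, 'm::real_normed_vector) atlas \<Rightarrow> ('q, 'm, ('q \<Rightarrow> real) \<Rightarrow> real, 'm) vbundle"
  where "tangent_bundle A =
    \<lparr>base = A, fiber = tangent_space A, trivs = {(fst c, components A c) |c. c \<in> A}\<rparr>"

text \<open>
  Linear functionals on a fibre are extended by 0 to all of \<open>'v\<close>, which makes them unique as
  functions. Over the domain of a trivialisation \<open>\<psi>\<close> a functional is represented by its Riesz
  vector in the model space.
\<close>

definition dual_triv ::
  "('q \<Rightarrow> 'v set) \<Rightarrow> ('q \<Rightarrow> 'v \<Rightarrow> 'k::real_inner) \<Rightarrow> 'q \<Rightarrow> ('v \<Rightarrow> real) \<Rightarrow> 'k"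
  where "dual_triv F \<psi> = (\<lambda>q \<kappa>. THE w. \<forall>v\<in>F q. \<kappa> v = inner w (\<psi> q v))"

definition dual_bundle ::
  "('q, 'm, 'v::real_vector, 'k::real_inner) vbundle \<Rightarrow> ('q, 'm, 'v \<Rightarrow> real, 'k) vbundle"
  where "dual_bundle V =
    \<lparr>base = base V,
     fiber = (\<lambda>q. {\<kappa>. linear_on (fiber V q) \<kappa> \<and> (\<forall>v. v \<notin> fiber V q \<longrightarrow> \<kappa> v = 0)}),
     trivs = {(U, dual_triv (fiber V) \<psi>) |U \<psi>. (U, \<psi>) \<in> trivs V}\<rparr>"


section \<open>Algebroids\<close>

definition smult :: "('q \<Rightarrow> real) \<Rightarrow> ('q \<Rightarrow> 'v::real_vector) \<Rightarrow> 'q \<Rightarrow> 'v"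
  where "smult f \<sigma> = (\<lambda>q. f q *\<^sub>R \<sigma> q)"

text \<open>For an anchor \<open>\<rho>\<close>, a section \<open>\<sigma>\<close> and a smooth function \<open>f\<close>: the function \<open>\<rho>(\<sigma>)(f)\<close>.\<close>

definition anchor_deriv ::
  "('q \<Rightarrow> 'v \<Rightarrow> ('q \<Rightarrow> real) \<Rightarrow> real) \<Rightarrow> ('q \<Rightarrow> 'v) \<Rightarrow> ('q \<Rightarrow> real) \<Rightarrow> 'q \<Rightarrow> real"
  where "anchor_deriv \<rho> \<sigma> f = (\<lambda>q. \<rho> q (\<sigma> q) f)"

definition algebroid ::
  "('q, 'm::fin_dim_inner, 'v::real_vector, 'k::fin_dim_inner) vbundle \<Rightarrow>
   (('q \<Rightarrow> 'v) \<Rightarrow> ('q \<Rightarrow> 'v) \<Rightarrow> 'q \<Rightarrow> 'v) \<Rightarrow>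
   ('q \<Rightarrow> 'v \<Rightarrow> ('q \<Rightarrow> real) \<Rightarrow> real) \<Rightarrow> ('q \<Rightarrow> 'v \<Rightarrow> ('q \<Rightarrow> real) \<Rightarrow> real) \<Rightarrow> bool"
  where "algebroid V B \<rho>l \<rho>r \<longleftrightarrow>
    vector_bundle V \<and>
    (\<forall>\<sigma>\<in>sections V. \<forall>\<sigma>'\<in>sections V. B \<sigma> \<sigma>' \<in> sections V) \<and>
    (\<forall>\<sigma>\<in>sections V. linear_on (sections V) (\<lambda>\<sigma>'. B \<sigma> \<sigma>')) \<and>
    (\<forall>\<sigma>'\<in>sections V. linear_on (sections V) (\<lambda>\<sigma>. B \<sigma> \<sigma>')) \<and>
    vb_morphism V (tangent_bundle (base V)) \<rho>l \<and>
    vb_morphism V (tangent_bundle (base V)) \<rho>r \<and>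
    (\<forall>f\<in>C_inf (base V). \<forall>f'\<in>C_inf (base V). \<forall>\<sigma>\<in>sections V. \<forall>\<sigma>'\<in>sections V.
        B (smult f \<sigma>) (smult f' \<sigma>') =
          smult (f * anchor_deriv \<rho>l \<sigma> f') \<sigma>' - smult (f' * anchor_deriv \<rho>r \<sigma>' f) \<sigma>
          + smult (f * f') (B \<sigma> \<sigma>'))"

definition pairing :: "('q \<Rightarrow> 'v \<Rightarrow> real) \<Rightarrow> ('q \<Rightarrow> 'v) \<Rightarrow> 'q \<Rightarrow> real"
  where "pairing \<kappa> \<sigma> = (\<lambda>q. \<kappa> q (\<sigma> q))"

definition d_lr ::
  "(('q \<Rightarrow> 'v) \<Rightarrow> ('q \<Rightarrow> 'v) \<Rightarrow> 'q \<Rightarrow> 'v) \<Rightarrow>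
   ('q \<Rightarrow> 'v \<Rightarrow> ('q \<Rightarrow> real) \<Rightarrow> real) \<Rightarrow> ('q \<Rightarrow> 'v \<Rightarrow> ('q \<Rightarrow> real) \<Rightarrow> real) \<Rightarrow>
   ('q \<Rightarrow> 'v \<Rightarrow> real) \<Rightarrow> ('q \<Rightarrow> 'v) \<Rightarrow> ('q \<Rightarrow> 'v) \<Rightarrow> 'q \<Rightarrow> real"
  where "d_lr B \<rho>l \<rho>r \<kappa> \<sigma> \<sigma>' =
    anchor_deriv \<rho>l \<sigma> (pairing \<kappa> \<sigma>') - anchor_deriv \<rho>r \<sigma>' (pairing \<kappa> \<sigma>) - pairing \<kappa> (B \<sigma> \<sigma>')"

definition tensor02 ::
  "('q, 'm::real_normed_vector, 'v::real_vector, 'k::real_normed_vector) vbundle \<Rightarrow>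
   ('q \<Rightarrow> 'v \<Rightarrow> 'v \<Rightarrow> real) \<Rightarrow> bool"
  where "tensor02 V \<Omega> \<longleftrightarrow>
    (\<forall>q\<in>carrier (base V). \<forall>v\<in>fiber V q.
        linear_on (fiber V q) (\<lambda>w. \<Omega> q v w) \<and> linear_on (fiber V q) (\<lambda>w. \<Omega> q w v)) \<and>
    (\<forall>\<sigma>\<in>sections V. \<forall>\<sigma>'\<in>sections V. (\<lambda>q. \<Omega> q (\<sigma> q) (\<sigma>' q)) \<in> C_inf (base V))"

definition skew_symmetric ::
  "('q, 'm, 'v, 'k) vbundle \<Rightarrow> ('q \<Rightarrow> 'v \<Rightarrow> 'v \<Rightarrow> real) \<Rightarrow> bool"
  where "skew_symmetric V \<Omega> \<longleftrightarrow>
    (\<forall>q\<in>carrier (base V). \<forall>v\<in>fiber V q. \<forall>w\<in>fiber V q. \<Omega> q v w = - \<Omega> q w v)"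

definition nondegenerate ::
  "('q, 'm, 'v::zero, 'k) vbundle \<Rightarrow> ('q \<Rightarrow> 'v \<Rightarrow> 'v \<Rightarrow> real) \<Rightarrow> bool"
  where "nondegenerate V \<Omega> \<longleftrightarrow>
    (\<forall>q\<in>carrier (base V). \<forall>v\<in>fiber V q. (\<forall>w\<in>fiber V q. \<Omega> q v w = 0) \<longrightarrow> v = 0)"

text \<open>
  \<open>d_lr\<close> is defined on sections; \<open>\<Omega>\<close> is the tensor field with the same values, which is unique
  because every vector in a fibre is the value of some section.
\<close>

definition exact_symplectic_algebroid ::
  "('q, 'm::fin_dim_inner, 'v::real_vector, 'k::fin_dim_inner) vbundle \<Rightarrow>
   (('q \<Rightarrow> 'v) \<Rightarrow> ('q \<Rightarrow> 'v) \<Rightarrow> 'q \<Rightarrow> 'v) \<Rightarrow>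
   ('q \<Rightarrow> 'v \<Rightarrow> ('q \<Rightarrow> real) \<Rightarrow> real) \<Rightarrow> ('q \<Rightarrow> 'v \<Rightarrow> ('q \<Rightarrow> real) \<Rightarrow> real) \<Rightarrow> bool"
  where "exact_symplectic_algebroid V B \<rho>l \<rho>r \<longleftrightarrow>
    algebroid V B \<rho>l \<rho>r \<and>
    (\<exists>\<kappa>\<in>sections (dual_bundle V). \<exists>\<Omega>.
        tensor02 V \<Omega> \<and>
        (\<forall>\<sigma>\<in>sections V. \<forall>\<sigma>'\<in>sections V. \<forall>q\<in>carrier (base V).
            \<Omega> q (\<sigma> q) (\<sigma>' q) = - d_lr B \<rho>l \<rho>r \<kappa> \<sigma> \<sigma>' q) \<and>
        skew_symmetric V \<Omega> \<and> nondegenerate V \<Omega>)"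


section \<open>The left E-tangent bundle to the dual bundle\<close>

text \<open>
  The arguments are the bundle \<open>E\<close> and its left anchor. The smooth structure is that of a subbundle
  of the sum of the pullback of \<open>E\<close> and the tangent bundle of \<open>E\<^sup>*\<close>: over a chart of \<open>E\<^sup>*\<close> obtained
  from a chart \<open>c\<close> of the base and a trivialisation \<open>\<psi>\<close>, an element \<open>(\<sigma>, X)\<close> is determined by the
  coordinates of \<open>\<sigma>\<close> and the vertical (fibre direction) components of \<open>X\<close>, since its base
  components are those of \<open>\<rho>l(\<sigma>)\<close>.
\<close>

definition left_tangent ::
  "('q, 'm::real_inner, 'v::real_vector, 'k::real_inner) vbundle \<Rightarrow>
   ('q \<Rightarrow> 'v \<Rightarrow> ('q \<Rightarrow> real) \<Rightarrow> real) \<Rightarrow>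
   ('q \<times> ('v \<Rightarrow> real), 'm \<times> 'k, 'v \<times> (('q \<times> ('v \<Rightarrow> real) \<Rightarrow> real) \<Rightarrow> real), 'k \<times> 'k) vbundle"
  where "left_tangent E \<rho>l =
    (let A = total_atlas (dual_bundle E) in
    \<lparr>base = A,
     fiber = (\<lambda>(q, \<kappa>). {(\<sigma>, X). \<sigma> \<in> fiber E q \<and> X \<in> tangent_space A (q, \<kappa>) \<and>
                              \<rho>l q \<sigma> = tangent_map (base E) fst X}),
     trivs = {(fst C, \<lambda>(q, \<kappa>) (\<sigma>, X). (\<psi> q \<sigma>, snd (components A C (q, \<kappa>) X))) |C c U \<psi>.
                c \<in> base E \<and> (U, \<psi>) \<in> trivs E \<and>
                C = bundle_chart (fiber (dual_bundle E)) c (U, dual_triv (fiber E) \<psi>)}\<rparr>)"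

end

theory Submission
  imports Defs
begin

text \<open>
  Neither the bracket of \<open>E\<close> nor the right anchor enters the construction. A partition of unity on
  \<open>E\<^sup>*\<close> glues chartwise vertical components to a projection \<open>K\<close> of the left tangent bundle onto
  its vertical part, which is the pullback of \<open>E\<^sup>*\<close>; hence \<open>(\<sigma>, X) \<mapsto> (\<sigma>, K (\<sigma>, X))\<close> identifies
  the bundle with the sum of the pullbacks of \<open>E\<close> and \<open>E\<^sup>*\<close>, and sections of this sum can be
  differentiated along the fibres of \<open>E\<^sup>*\<close> without further choices. Let both anchors be the
  vertical lift of \<open>K\<close>, and let \<open>B'(s, s')\<close> be the derivative of \<open>s'\<close> in direction \<open>K s\<close> minus that
  of \<open>s\<close> in direction \<open>K s'\<close>. The Liouville section \<open>\<lambda>(\<sigma>, X) = \<kappa>(\<sigma>)\<close> at \<open>\<kappa>\<close> is linear along the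
  fibres, so its differential on \<open>((\<sigma>, \<alpha>), (\<sigma>', \<alpha>'))\<close> is \<open>\<alpha>(\<sigma>') - \<alpha>'(\<sigma>)\<close>, the canonical
  symplectic form.
\<close>


section \<open>Finite-dimensional inner product spaces\<close>

text \<open>Two obstacles shape the construction. A bracket taken componentwise from the bracket of
  \<open>E\<close> and the Lie bracket of vector fields stays in the left tangent bundle only if the
  left anchor preserves brackets, which an algebroid does not guarantee. Differentiating components
  of sections avoids this, but needs frames that can be compared at different points. Under a change
  of bundle charts a vertical component \<open>w\<close> becomes \<open>G w + dG(a) y\<close>, where
  \<open>G\<close> is the transition matrix of the dual bundle, \<open>a\<close> the base component
  and \<open>y\<close> the fibre coordinate. This depends on \<open>y\<close>, so fibre derivatives
  of such components have no invariant meaning. Replacing \<open>w\<close> by the value of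
  \<open>K\<close> absorbs the second term, and the remaining transition depends on the base point
  alone. Vertical directions suffice for nondegeneracy: in the differential of the Liouville section
  the derivatives of the two sections cancel against the bracket, and the derivative of the base
  point of the fibre, a covector itself, is what remains.\<close>

lemma finite_orthonormal_of_finite:
  fixes B :: "'a::real_inner set"
  assumes "finite B"
  shows "\<exists>C. finite C \<and> B \<subseteq> span C \<and> (\<forall>x\<in>C. \<forall>y\<in>C. inner x y = (if x = y then 1 else 0))"
  using assms
proof induction
  case empty
  show ?case by (rule exI[of _ "{}"]) auto
next
  case (insert a B)
  then obtain C where C: "finite C" "B \<subseteq> span C"
    "\<And>x y. x \<in> C \<Longrightarrow> y \<in> C \<Longrightarrow> inner x y = (if x = y then 1 else 0)" by blast
  \<comment> \<open>Gram-Schmidt step: \<open>d\<close> is the part of \<open>a\<close> orthogonal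
    to \<open>C\<close>. If it vanishes, \<open>C\<close> already spans \<open>a\<close>; otherwise
    its normalisation is added.\<close>
  define d where "d = a - (\<Sum>c\<in>C. inner a c *\<^sub>R c)"
  have sum_in: "(\<Sum>c\<in>C. inner a c *\<^sub>R c) \<in> span C"
    by (intro span_sum span_scale span_base)
  have orth: "inner d c = 0" if "c \<in> C" for c
  proof -
    have "(\<Sum>x\<in>C. inner a x * inner x c) = (\<Sum>x\<in>C. if x = c then inner a c else 0)"
      using that by (intro sum.cong) (auto simp: C(3))
    then show ?thesis
      using that C(1) by (simp add: d_def inner_diff_left inner_sum_left)
  qed
  show ?case
  proof (cases "d = 0")
    case True
    then have "a \<in> span C" using sum_in by (simp add: d_def)
    then show ?thesis using C by (intro exI[of _ C]) auto
  next
    case False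
    define e where "e = d /\<^sub>R norm d"
    have e: "inner e e = 1"
      using False by (simp add: e_def flip: power2_norm_eq_inner)
    have ec: "inner e c = 0" "inner c e = 0" if "c \<in> C" for c
      using orth[OF that] by (simp_all add: e_def inner_commute)
    have "e \<notin> C" using e ec by force
    have "d = norm d *\<^sub>R e" using False by (simp add: e_def)
    then have "a = norm d *\<^sub>R e + (\<Sum>c\<in>C. inner a c *\<^sub>R c)" by (simp add: d_def)
    moreover have "norm d *\<^sub>R e + (\<Sum>c\<in>C. inner a c *\<^sub>R c) \<in> span (insert e C)"
      by (intro span_add span_sum span_scale span_base) auto
    ultimately have "a \<in> span (insert e C)" by simp
    moreover have "B \<subseteq> span (insert e C)"
      using C(2) span_mono[of C "insert e C"] by blast
    ultimately show ?thesis
      using C(1,3) e ec \<open>e \<notin> C\<close> by (intro exI[of _ "insert e C"]) auto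
  qed
qed

text \<open>Specified by the expansion identity, the form in which all coordinate computations use
  it; an orthonormal basis witnesses that such a set exists.\<close>

definition onb :: "'a::fin_dim_inner set"
  where "onb = (SOME B. finite B \<and> (\<forall>x. x = (\<Sum>b\<in>B. inner x b *\<^sub>R b)))"

lemma onb: "finite (onb :: 'a::fin_dim_inner set)" "(\<Sum>b\<in>onb. inner x b *\<^sub>R b) = (x::'a)"
proof -
  obtain B :: "'a set" where B: "finite B" "\<And>x. \<exists>c. x = (\<Sum>b\<in>B. c b *\<^sub>R b)"
    using finite_spanning by blast
  obtain C where C: "finite C" "B \<subseteq> span C"
    "\<And>x y. x \<in> C \<Longrightarrow> y \<in> C \<Longrightarrow> inner x y = (if x = y then 1 else 0)"
    using finite_orthonormal_of_finite[OF B(1)] by blast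
  have "x = (\<Sum>b\<in>C. inner x b *\<^sub>R b)" for x
  proof -
    obtain c where "x = (\<Sum>b\<in>B. c b *\<^sub>R b)" using B(2) by blast
    then have "x \<in> span C"
      using C(2) by (auto intro!: span_sum span_scale)
    then obtain u where u: "x = (\<Sum>b\<in>C. u b *\<^sub>R b)"
      using span_finite[OF C(1)] by auto
    have "inner x b = u b" if "b \<in> C" for b
    proof -
      have "inner x b = (\<Sum>c\<in>C. if c = b then u b else 0)"
        unfolding u inner_sum_left using that by (intro sum.cong) (auto simp: C(3))
      then show ?thesis using C(1) that by simp
    qed
    then show ?thesis using u by (metis (mono_tags, lifting) sum.cong)
  qed
  then have "\<exists>B::'a set. finite B \<and> (\<forall>x. x = (\<Sum>b\<in>B. inner x b *\<^sub>R b))" using C(1) by blast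
  from someI_ex[OF this] show "finite (onb :: 'a set)" "(\<Sum>b\<in>onb. inner x b *\<^sub>R b) = x"
    unfolding onb_def[symmetric] by auto
qed

text \<open>Reduces smooth dependence of a fibrewise linear map on its parameters to that of its
  values on finitely many fixed vectors. Most smoothness proofs below rest on this.\<close>

lemma linear_onb_expand:
  fixes f :: "'a::fin_dim_inner \<Rightarrow> 'b::real_vector"
  assumes "linear f"
  shows "f x = (\<Sum>b\<in>onb. inner x b *\<^sub>R f b)"
proof -
  have "f x = f (\<Sum>b\<in>onb. inner x b *\<^sub>R b)" by (simp add: onb)
  also have "\<dots> = (\<Sum>b\<in>onb. inner x b *\<^sub>R f b)"
    by (simp add: linear_sum[OF assms] linear_cmul[OF assms])
  finally show ?thesis .
qed

lemma linear_imp_bounded_linear: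
  fixes f :: "'a::fin_dim_inner \<Rightarrow> 'b::real_normed_vector"
  assumes "linear f"
  shows "bounded_linear f"
proof -
  have "f = (\<lambda>x. \<Sum>b\<in>onb. inner x b *\<^sub>R f b)"
    using linear_onb_expand[OF assms] by blast
  moreover have "bounded_linear (\<lambda>x::'a. \<Sum>b\<in>onb. inner x b *\<^sub>R f b)"
    by (intro bounded_linear_sum bounded_linear_scaleR_const bounded_linear_inner_left)
  ultimately show ?thesis by simp
qed

lemma riesz_vector:
  fixes f :: "'a::fin_dim_inner \<Rightarrow> real"
  assumes "linear f"
  shows "f x = inner (\<Sum>b\<in>onb. f b *\<^sub>R b) x"
  using linear_onb_expand[OF assms, of x]
  by (simp add: inner_sum_left inner_commute[of x] mult.commute)

text \<open>The coefficients of points of the ball are bounded, so the ball is a closed subset of a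
  finite Minkowski sum of compact segments. It provides the compact supports of bump
  functions.\<close>

lemma compact_cball_fin_dim: "compact (cball (a::'a::fin_dim_inner) r)"
proof -
  let ?seg = "\<lambda>b R. (\<lambda>t. t *\<^sub>R b) ` {-R..R::real}"
  have seg: "compact (?seg b R)" for b :: 'a and R
    by (intro compact_continuous_image continuous_intros) auto
  have sums: "finite B \<Longrightarrow> compact {(\<Sum>b\<in>B. c b *\<^sub>R b) |c. \<forall>b\<in>B. \<bar>c b\<bar> \<le> R b}" for B :: "'a set" and R
  proof (induction rule: finite_induct)
    case empty
    show ?case by simp
  next
    case (insert x B)
    have "{(\<Sum>b\<in>insert x B. c b *\<^sub>R b) |c. \<forall>b\<in>insert x B. \<bar>c b\<bar> \<le> R b}
      = {y + z |y z. y \<in> ?seg x (R x) \<and> z \<in> {(\<Sum>b\<in>B. c b *\<^sub>R b) |c. \<forall>b\<in>B. \<bar>c b\<bar> \<le> R b}}" (is "?L = ?R")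
    proof
      show "?L \<subseteq> ?R"
        using insert by (force simp: abs_le_iff)
      show "?R \<subseteq> ?L"
      proof clarify
        fix t c assume t: "t \<in> {- R x..R x}" and c: "\<forall>b\<in>B. \<bar>c b\<bar> \<le> R b"
        have "(\<Sum>b\<in>B. (c(x := t)) b *\<^sub>R b) = (\<Sum>b\<in>B. c b *\<^sub>R b)"
          using insert by (intro sum.cong) auto
        then show "\<exists>d. t *\<^sub>R x + (\<Sum>b\<in>B. c b *\<^sub>R b) = (\<Sum>b\<in>insert x B. d b *\<^sub>R b) \<and>
            (\<forall>b\<in>insert x B. \<bar>d b\<bar> \<le> R b)"
          using insert t c by (intro exI[of _ "c(x := t)"]) auto
      qed
    qed
    then show ?case
      using compact_sums[OF seg insert.IH] by simp
  qed
  \<comment> \<open>By Cauchy-Schwarz a coefficient is at most \<open>norm x * norm b\<close>, and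
    \<open>norm x\<close> is at most \<open>norm a + \<bar>r\<bar>\<close> on the ball.\<close>
  let ?K = "{(\<Sum>b\<in>onb. c b *\<^sub>R b) |c. \<forall>b\<in>(onb::'a set). \<bar>c b\<bar> \<le> (norm a + \<bar>r\<bar>) * norm b}"
  have "cball a r \<subseteq> ?K"
  proof
    fix x assume x: "x \<in> cball a r"
    have "norm x \<le> norm a + \<bar>r\<bar>"
      using x norm_triangle_sub[of x a] by (simp add: dist_norm norm_minus_commute)
    then have "\<bar>inner x b\<bar> \<le> (norm a + \<bar>r\<bar>) * norm b" for b
      by (meson Cauchy_Schwarz_ineq2 mult_right_mono norm_ge_zero order_trans)
    then show "x \<in> ?K" using onb(2)[of x, symmetric] by blast
  qed
  then have "cball a r = ?K \<inter> cball a r" by auto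
  also have "compact \<dots>" by (intro compact_Int_closed sums onb) auto
  finally show ?thesis .
qed

text \<open>Linear combinations of \<open>onb\<close> with rational coefficients are dense, and the
  balls of radius \<open>1 / (n + 1)\<close> around them form a countable basis.\<close>

lemma countable_basis_fin_dim:
  obtains \<B> :: "'a::fin_dim_inner set set" where "countable \<B>" "\<And>W. W \<in> \<B> \<Longrightarrow> open W"
    "\<And>U x. open U \<Longrightarrow> x \<in> U \<Longrightarrow> \<exists>W\<in>\<B>. x \<in> W \<and> W \<subseteq> U"
proof -
  define D :: "'a set" where "D = (\<lambda>c. \<Sum>b\<in>onb. c b *\<^sub>R b) ` (onb \<rightarrow>\<^sub>E \<rat>)"
  have D: "countable D"
    unfolding D_def by (intro countable_image countable_PiE onb countable_rat)
  have dense: "\<exists>d\<in>D. dist d x < e" if "e > 0" for x :: 'a and e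
  proof -
    \<comment> \<open>The summand 1 keeps \<open>S\<close> positive even for an empty basis and
      makes the final estimate \<open>e / S * (S - 1) < e\<close> strict.\<close>
    define S where "S = (\<Sum>b\<in>(onb::'a set). norm b) + 1"
    have S: "S > 0" unfolding S_def by (intro add_nonneg_pos sum_nonneg) auto
    have "\<exists>q\<in>\<rat>. \<bar>q - inner x b\<bar> < e / S" for b
    proof -
      obtain q where "q \<in> \<rat>" "inner x b < q" "q < inner x b + e / S"
        using Rats_dense_in_real[of "inner x b" "inner x b + e / S"] divide_pos_pos[OF \<open>e > 0\<close> S] by auto
      then show ?thesis by (intro bexI[of _ q]) auto
    qed
    then obtain c where c: "\<And>b. c b \<in> \<rat>" "\<And>b. \<bar>c b - inner x b\<bar> < e / S" by metis
    \<comment> \<open>Elements of \<open>D\<close> come from functions that are undefined outside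
      \<open>onb\<close>, so the witness is a restriction; the sum does not notice it.\<close>
    have eq: "(\<Sum>b\<in>onb. restrict c onb b *\<^sub>R b) = (\<Sum>b\<in>onb. c b *\<^sub>R b)" by simp
    have "(\<Sum>b\<in>onb. c b *\<^sub>R b) - x = (\<Sum>b\<in>onb. (c b - inner x b) *\<^sub>R b)"
      using onb(2)[of x] by (simp add: scaleR_diff_left sum_subtractf)
    then have "dist (\<Sum>b\<in>onb. c b *\<^sub>R b) x \<le> (\<Sum>b\<in>(onb::'a set). norm ((c b - inner x b) *\<^sub>R b))"
      by (simp only: dist_norm norm_sum)
    also have "\<dots> \<le> (\<Sum>b\<in>(onb::'a set). e / S * norm b)"
      using c(2) by (intro sum_mono) (simp add: mult_right_mono less_imp_le del: times_divide_eq_left)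
    also have "\<dots> = e / S * (S - 1)" by (simp add: S_def sum_distrib_left)
    also have "\<dots> < e" using S that by (simp add: field_simps)
    finally show ?thesis using c(1)
      by (intro bexI[of _ "\<Sum>b\<in>onb. restrict c onb b *\<^sub>R b"]) (auto simp: eq D_def intro!: image_eqI[of _ _ "restrict c onb"])
  qed
  define \<B> where "\<B> = (\<lambda>(d, n). ball d (1 / real (Suc n))) ` (D \<times> UNIV)"
  show thesis
  proof (rule that)
    show "countable \<B>" unfolding \<B>_def using D by (intro countable_image countable_SIGMA) auto
    show "open W" if "W \<in> \<B>" for W
      using that unfolding \<B>_def by (elim imageE) (simp add: case_prod_unfold)
    show "\<exists>W\<in>\<B>. x \<in> W \<and> W \<subseteq> U" if U: "open U" "x \<in> U" for U x
    proof -
      obtain e where e: "e > 0" "ball x e \<subseteq> U" using U openE by blast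
      obtain n where n: "1 / real (Suc n) < e / 2"
        using e(1) by (metis half_gt_zero nat_approx_posE)
      obtain d where d: "d \<in> D" "dist d x < 1 / real (Suc n)"
        using dense[of "1 / real (Suc n)" x] by auto
      have "ball d (1 / real (Suc n)) \<subseteq> ball x e"
      proof
        fix y assume "y \<in> ball d (1 / real (Suc n))"
        then have "dist x y < e" using d(2) n dist_triangle[of x y d]
          by (simp add: dist_commute)
        then show "y \<in> ball x e" by simp
      qed
      moreover have "ball d (1 / real (Suc n)) \<in> \<B>"
        unfolding \<B>_def using d(1) by (intro image_eqI[of _ _ "(d, n)"]) simp_all
      moreover have "x \<in> ball d (1 / real (Suc n))" using d(2) by (simp only: mem_ball)
      ultimately show ?thesis using e(2) by blast
    qed
  qed
qed


section \<open>Smooth maps between open sets\<close>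

lemma Ck_on_subset: "Ck_on k S f \<Longrightarrow> T \<subseteq> S \<Longrightarrow> Ck_on k T f"
proof (induction k arbitrary: f)
  case 0
  then show ?case by (auto intro: continuous_on_subset)
next
  case (Suc k)
  have "Ck_on k T (\<lambda>x. frechet_derivative f (at x) v)" for v
    using Suc.prems by (intro Suc.IH) auto
  then show ?case using Suc.prems by auto
qed

lemma frechet_derivative_cong_open:
  assumes "open S" "x \<in> S" "\<And>y. y \<in> S \<Longrightarrow> f y = g y"
  shows "frechet_derivative f (at x) = frechet_derivative g (at x)"
proof -
  have "(f has_derivative D) (at x) \<longleftrightarrow> (g has_derivative D) (at x)" for D
    using has_derivative_transform_within_open[of f D x UNIV S g]
      has_derivative_transform_within_open[of g D x UNIV S f] assms by auto
  then show ?thesis unfolding frechet_derivative_def by simp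
qed

lemma Ck_on_cong:
  "open S \<Longrightarrow> (\<And>x. x \<in> S \<Longrightarrow> f x = g x) \<Longrightarrow> Ck_on k S f \<longleftrightarrow> Ck_on k S g"
proof (induction k arbitrary: f g)
  case 0
  then show ?case using continuous_on_cong[of S S f g] by simp
next
  case (Suc k)
  have d: "f differentiable at x \<longleftrightarrow> g differentiable at x" if "x \<in> S" for x
  proof -
    have "(f has_derivative D) (at x) \<longleftrightarrow> (g has_derivative D) (at x)" for D
      using has_derivative_transform_within_open[of f D x UNIV S g]
        has_derivative_transform_within_open[of g D x UNIV S f] Suc.prems that by auto
    then show ?thesis by (simp add: differentiable_def)
  qed
  have "Ck_on k S (\<lambda>x. frechet_derivative f (at x) v) \<longleftrightarrow>
        Ck_on k S (\<lambda>x. frechet_derivative g (at x) v)" for v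
    using Suc.prems by (intro Suc.IH) (simp_all add: frechet_derivative_cong_open[of S _ f g])
  then show ?case using d by auto
qed

text \<open>Allows the derivative to be given by a formula instead of
  \<open>frechet_derivative\<close>, so that a differentiation rule can be fed into the induction on
  the order.\<close>

lemma Ck_on_SucI:
  assumes "open S" "\<And>x. x \<in> S \<Longrightarrow> (f has_derivative f' x) (at x)" "\<And>v. Ck_on k S (\<lambda>x. f' x v)"
  shows "Ck_on (Suc k) S f"
proof -
  have "frechet_derivative f (at x) = f' x" if "x \<in> S" for x
    using frechet_derivative_at[OF assms(2)[OF that]] by simp
  then have "Ck_on k S (\<lambda>x. frechet_derivative f (at x) v)" for v
    using Ck_on_cong[OF assms(1), of "\<lambda>x. frechet_derivative f (at x) v" "\<lambda>x. f' x v"] assms(3) by simp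
  then show ?thesis using assms(2) by (auto simp: differentiable_def)
qed

lemma Ck_on_SucD:
  assumes "Ck_on (Suc k) S f"
  shows "x \<in> S \<Longrightarrow> (f has_derivative frechet_derivative f (at x)) (at x)"
    and "Ck_on k S (\<lambda>x. frechet_derivative f (at x) v)"
  using assms by (auto simp: frechet_derivative_works)

lemma Ck_on_continuous: "Ck_on k S f \<Longrightarrow> continuous_on S f"
  by (cases k) (auto intro!: continuous_at_imp_continuous_on differentiable_imp_continuous_within)

lemma Ck_on_Suc_imp: "Ck_on (Suc k) S f \<Longrightarrow> Ck_on k S f"
proof (induction k arbitrary: f)
  case 0
  then show ?case using Ck_on_continuous[OF 0] by simp
next
  case (Suc k)
  have "Ck_on (Suc k) S (\<lambda>x. frechet_derivative f (at x) v)" for v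
    using Ck_on_SucD(2)[OF Suc.prems] .
  then have "Ck_on k S (\<lambda>x. frechet_derivative f (at x) v)" for v
    by (rule Suc.IH)
  then show ?case using Suc.prems by simp
qed

lemma Ck_on_local:
  assumes "\<And>x. x \<in> S \<Longrightarrow> \<exists>T. open T \<and> x \<in> T \<and> Ck_on k T f"
  shows "Ck_on k S f"
  using assms
proof (induction k arbitrary: f)
  case 0
  have "isCont f x" if "x \<in> S" for x
    using 0[OF that] by (auto simp: continuous_on_eq_continuous_at)
  then show ?case by (auto intro: continuous_at_imp_continuous_on)
next
  case (Suc k)
  have "f differentiable at x" if "x \<in> S" for x
    using Suc.prems[OF that] by auto
  moreover have "Ck_on k S (\<lambda>x. frechet_derivative f (at x) v)" for v
  proof (rule Suc.IH)
    fix x assume "x \<in> S"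
    then obtain T where "open T" "x \<in> T" "Ck_on (Suc k) T f" using Suc.prems by blast
    then show "\<exists>T. open T \<and> x \<in> T \<and> Ck_on k T (\<lambda>x. frechet_derivative f (at x) v)"
      using Ck_on_SucD(2) by blast
  qed
  ultimately show ?case by simp
qed

lemma Ck_on_const: "Ck_on k S (\<lambda>x. c)"
proof (induction k arbitrary: c)
  case 0
  show ?case by simp
next
  case (Suc k)
  show ?case using Suc by simp
qed

lemma Ck_on_bounded_linear:
  assumes "bounded_linear f"
  shows "Ck_on k S f"
proof (cases k)
  case 0
  then show ?thesis using assms by (simp add: linear_continuous_on)
next
  case (Suc j)
  have D: "frechet_derivative f (at x) = f" for x
    using frechet_derivative_at[OF bounded_linear_imp_has_derivative[OF assms, of "at x"]] by simp
  show ?thesis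
    unfolding Suc using assms by (auto simp: D Ck_on_const bounded_linear_imp_differentiable)
qed

lemma Ck_on_add:
  "open S \<Longrightarrow> Ck_on k S f \<Longrightarrow> Ck_on k S g \<Longrightarrow> Ck_on k S (\<lambda>x. f x + g x)"
proof (induction k arbitrary: f g)
  case 0
  then show ?case by (auto intro: continuous_on_add)
next
  case (Suc k)
  show ?case
  proof (rule Ck_on_SucI[OF Suc.prems(1)])
    show "((\<lambda>x. f x + g x) has_derivative
        (\<lambda>v. frechet_derivative f (at x) v + frechet_derivative g (at x) v)) (at x)" if "x \<in> S" for x
      using that Suc.prems by (intro has_derivative_add Ck_on_SucD(1))
    show "Ck_on k S (\<lambda>x. frechet_derivative f (at x) v + frechet_derivative g (at x) v)" for v
      using Suc.prems by (intro Suc.IH Ck_on_SucD(2))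
  qed
qed

text \<open>The product rule yields two terms of the same bilinear shape, each with one factor
  differentiated; generalising over both factors therefore closes the induction.\<close>

lemma Ck_on_bilinear:
  assumes "bounded_bilinear pr"
  shows "open S \<Longrightarrow> Ck_on k S f \<Longrightarrow> Ck_on k S g \<Longrightarrow> Ck_on k S (\<lambda>x. pr (f x) (g x))"
proof (induction k arbitrary: f g)
  case 0
  then show ?case using bounded_bilinear.continuous_on[OF assms] by auto
next
  case (Suc k)
  show ?case
  proof (rule Ck_on_SucI[OF Suc.prems(1)])
    fix x assume "x \<in> S"
    then show "((\<lambda>x. pr (f x) (g x)) has_derivative
      (\<lambda>v. pr (f x) (frechet_derivative g (at x) v) + pr (frechet_derivative f (at x) v) (g x))) (at x)"
      using Suc.prems by (intro bounded_bilinear.FDERIV[OF assms] Ck_on_SucD)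
  next
    fix v
    show "Ck_on k S (\<lambda>x. pr (f x) (frechet_derivative g (at x) v)
        + pr (frechet_derivative f (at x) v) (g x))"
      using Suc.prems by (intro Ck_on_add Suc.IH Ck_on_SucD(2) Ck_on_Suc_imp[OF Suc.prems(2)]
          Ck_on_Suc_imp[OF Suc.prems(3)])
  qed
qed

lemma Ck_on_sum:
  assumes "open S" "\<And>i. i \<in> I \<Longrightarrow> Ck_on k S (f i)"
  shows "Ck_on k S (\<lambda>x. \<Sum>i\<in>I. f i x)"
  using assms(2)
  by (induction I rule: infinite_finite_induct) (auto intro!: Ck_on_add assms(1) Ck_on_const)

text \<open>The chain rule evaluates the derivative of \<open>g\<close> in a direction that varies
  with the point, whereas \<open>Ck_on\<close> only controls fixed directions. Expanding the
  direction in \<open>onb\<close> repairs this, which is why the intermediate space is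
  finite-dimensional.\<close>

lemma Ck_on_compose:
  fixes f :: "'a::real_normed_vector \<Rightarrow> 'b::fin_dim_inner" and g :: "'b \<Rightarrow> 'c::real_normed_vector"
  assumes "open S" "f ` S \<subseteq> T"
  shows "Ck_on k T g \<Longrightarrow> Ck_on k S f \<Longrightarrow> Ck_on k S (\<lambda>x. g (f x))"
proof (induction k arbitrary: g)
  case 0
  then show ?case using assms(2) continuous_on_compose2[of T g S f] by auto
next
  case (Suc k)
  let ?D = "\<lambda>x v. frechet_derivative g (at (f x)) (frechet_derivative f (at x) v)"
  have lin: "?D x v = (\<Sum>b\<in>onb. inner (frechet_derivative f (at x) v) b *\<^sub>R frechet_derivative g (at (f x)) b)"
    if "x \<in> S" for x v
    using Ck_on_SucD(1)[OF Suc.prems(1), of "f x"] that assms(2)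
    by (blast intro: linear_onb_expand has_derivative_linear)
  show ?case
  proof (rule Ck_on_SucI[OF assms(1)])
    fix x assume "x \<in> S"
    then have "f x \<in> T" using assms(2) by blast
    with \<open>x \<in> S\<close> show "((\<lambda>x. g (f x)) has_derivative ?D x) (at x)"
      by (intro has_derivative_compose[OF Ck_on_SucD(1)[OF Suc.prems(2)] Ck_on_SucD(1)[OF Suc.prems(1)]])
  next
    fix v
    have "Ck_on k S (\<lambda>x. \<Sum>b\<in>onb. inner (frechet_derivative f (at x) v) b *\<^sub>R frechet_derivative g (at (f x)) b)"
      by (intro Ck_on_sum Ck_on_bilinear[OF bounded_bilinear_scaleR] Ck_on_bilinear[OF bounded_bilinear_inner]
          Ck_on_const Suc.IH Ck_on_SucD(2)[OF Suc.prems(1)] Ck_on_SucD(2)[OF Suc.prems(2)]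
          Ck_on_Suc_imp[OF Suc.prems(2)] assms(1))
    then show "Ck_on k S (\<lambda>x. ?D x v)"
      by (rule Ck_on_cong[OF assms(1), THEN iffD1, rotated]) (simp add: lin)
  qed
qed

text \<open>The derivative is a product built from \<open>inverse\<close> itself, so the induction
  hypothesis applies to it.\<close>

lemma Ck_on_inverse: "Ck_on k {x::real. x \<noteq> 0} inverse"
proof (induction k)
  case 0
  then show ?case by (auto intro!: continuous_intros)
next
  case (Suc k)
  have o: "open {x::real. x \<noteq> 0}" using open_delete[of UNIV 0] by (simp add: Collect_neg_eq Compl_eq_Diff_UNIV)
  show ?case
  proof (rule Ck_on_SucI[OF o])
    show "(inverse has_derivative (\<lambda>v. - (inverse x * v * inverse x))) (at x)" if "x \<in> {x. x \<noteq> 0}" for x :: real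
      using that by (intro has_derivative_inverse') auto
    have "Ck_on k {x. x \<noteq> 0} (\<lambda>x. - 1 * (inverse x * v * inverse x))" for v :: real
      by (intro Ck_on_bilinear[OF bounded_bilinear_mult] Ck_on_const Suc o)
    then show "Ck_on k {x. x \<noteq> 0} (\<lambda>x. - (inverse x * v * inverse x))" for v :: real
      by simp
  qed
qed

lemma smooth_on_subset: "smooth_on S f \<Longrightarrow> T \<subseteq> S \<Longrightarrow> smooth_on T f"
  by (auto simp: smooth_on_def intro: Ck_on_subset)

lemma smooth_on_cong: "open S \<Longrightarrow> (\<And>x. x \<in> S \<Longrightarrow> f x = g x) \<Longrightarrow> smooth_on S f \<longleftrightarrow> smooth_on S g"
  unfolding smooth_on_def using Ck_on_cong[of S f g] by simp

lemma smooth_on_local: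
  assumes "\<And>x. x \<in> S \<Longrightarrow> \<exists>T. open T \<and> x \<in> T \<and> smooth_on T f"
  shows "smooth_on S f"
  unfolding smooth_on_def
proof
  fix k show "Ck_on k S f"
    by (rule Ck_on_local) (meson assms smooth_on_def)
qed

lemma smooth_on_continuous: "smooth_on S f \<Longrightarrow> continuous_on S f"
  using Ck_on_continuous smooth_on_def by blast

lemma smooth_on_const: "smooth_on S (\<lambda>x. c)"
  by (simp add: smooth_on_def Ck_on_const)

lemma smooth_on_bounded_linear: "bounded_linear f \<Longrightarrow> smooth_on S f"
  by (simp add: smooth_on_def Ck_on_bounded_linear)

lemma smooth_on_ident: "smooth_on S (\<lambda>x. x)"
  by (rule smooth_on_bounded_linear[OF bounded_linear_ident])

lemma smooth_on_bilinear:
  "bounded_bilinear pr \<Longrightarrow> open S \<Longrightarrow> smooth_on S f \<Longrightarrow> smooth_on S g \<Longrightarrow>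
    smooth_on S (\<lambda>x. pr (f x) (g x))"
  by (simp add: smooth_on_def Ck_on_bilinear)

lemmas smooth_on_scaleR = smooth_on_bilinear[OF bounded_bilinear_scaleR]
lemmas smooth_on_mult = smooth_on_bilinear[OF bounded_bilinear_mult]
lemmas smooth_on_inner = smooth_on_bilinear[OF bounded_bilinear_inner]

lemma smooth_on_add:
  "open S \<Longrightarrow> smooth_on S f \<Longrightarrow> smooth_on S g \<Longrightarrow> smooth_on S (\<lambda>x. f x + g x)"
  by (simp add: smooth_on_def Ck_on_add)

lemma smooth_on_minus: "open S \<Longrightarrow> smooth_on S f \<Longrightarrow> smooth_on S (\<lambda>x. - f x)"
  using smooth_on_scaleR[of S "\<lambda>_. -1" f] by (simp add: smooth_on_const)

lemma smooth_on_diff: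
  "open S \<Longrightarrow> smooth_on S f \<Longrightarrow> smooth_on S g \<Longrightarrow> smooth_on S (\<lambda>x. f x - g x)"
  using smooth_on_add[of S f "\<lambda>x. - g x"] smooth_on_minus[of S g] by simp

lemma smooth_on_sum:
  "open S \<Longrightarrow> (\<And>i. i \<in> I \<Longrightarrow> smooth_on S (f i)) \<Longrightarrow> smooth_on S (\<lambda>x. \<Sum>i\<in>I. f i x)"
  by (simp add: smooth_on_def Ck_on_sum)

lemma smooth_on_compose:
  fixes f :: "'a::real_normed_vector \<Rightarrow> 'b::fin_dim_inner" and g :: "'b \<Rightarrow> 'c::real_normed_vector"
  shows "smooth_on T g \<Longrightarrow> smooth_on S f \<Longrightarrow> open S \<Longrightarrow> f ` S \<subseteq> T \<Longrightarrow> smooth_on S (\<lambda>x. g (f x))"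
  by (simp add: smooth_on_def Ck_on_compose)

lemma smooth_on_linear_compose:
  fixes f :: "'a::real_normed_vector \<Rightarrow> 'b::fin_dim_inner" and g :: "'b \<Rightarrow> 'c::real_normed_vector"
  shows "linear g \<Longrightarrow> open S \<Longrightarrow> smooth_on S f \<Longrightarrow> smooth_on S (\<lambda>x. g (f x))"
  using smooth_on_compose[of UNIV g S f] smooth_on_bounded_linear[OF linear_imp_bounded_linear, of g UNIV] by auto

lemma smooth_on_Pair:
  fixes f :: "'a::real_normed_vector \<Rightarrow> 'b::real_normed_vector" and g :: "'a \<Rightarrow> 'c::real_normed_vector"
  assumes "open S" "smooth_on S f" "smooth_on S g"
  shows "smooth_on S (\<lambda>x. (f x, g x))"
proof -
  have Ck: "Ck_on k S f \<Longrightarrow> Ck_on k S g \<Longrightarrow> Ck_on k S (\<lambda>x. (f x, g x))" for k and f :: "'a \<Rightarrow> 'b" and g :: "'a \<Rightarrow> 'c"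
  proof (induction k arbitrary: f g)
    case 0
    then show ?case by (auto intro: continuous_on_Pair)
  next
    case (Suc k)
    show ?case
    proof (rule Ck_on_SucI[OF assms(1)])
      show "((\<lambda>x. (f x, g x)) has_derivative
          (\<lambda>v. (frechet_derivative f (at x) v, frechet_derivative g (at x) v))) (at x)" if "x \<in> S" for x
        using that Suc.prems by (intro has_derivative_Pair Ck_on_SucD(1))
      show "Ck_on k S (\<lambda>x. (frechet_derivative f (at x) v, frechet_derivative g (at x) v))" for v
        using Suc.prems by (intro Suc.IH Ck_on_SucD(2))
    qed
  qed
  show ?thesis using assms Ck by (simp add: smooth_on_def)
qed

lemma smooth_on_snd:
  fixes f :: "'a::real_normed_vector \<Rightarrow> 'b::fin_dim_inner \<times> 'c::fin_dim_inner"
  shows "open S \<Longrightarrow> smooth_on S f \<Longrightarrow> smooth_on S (\<lambda>x. snd (f x))"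
  by (rule smooth_on_linear_compose[OF bounded_linear.linear[OF bounded_linear_snd]])

lemma smooth_on_has_derivative:
  "smooth_on S f \<Longrightarrow> x \<in> S \<Longrightarrow> (f has_derivative frechet_derivative f (at x)) (at x)"
  unfolding smooth_on_def using Ck_on_SucD(1)[of 0 S f x] by blast

text \<open>Both the point and the direction may vary. Once the direction is expanded in
  \<open>onb\<close>, only derivatives in fixed directions remain, composed with \<open>u\<close>.
  This gives smoothness of coordinate changes of tangent vectors.\<close>

lemma smooth_on_frechet_derivative:
  fixes f :: "'b::fin_dim_inner \<Rightarrow> 'c::real_normed_vector" and u :: "'a::real_normed_vector \<Rightarrow> 'b"
  assumes f: "smooth_on T f" and S: "open S" and u: "smooth_on S u" "u ` S \<subseteq> T" and v: "smooth_on S v"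
  shows "smooth_on S (\<lambda>x. frechet_derivative f (at (u x)) (v x))"
proof -
  have D: "smooth_on T (\<lambda>x. frechet_derivative f (at x) b)" for b
    using f Ck_on_SucD(2)[of _ T f b] unfolding smooth_on_def by blast
  have *: "smooth_on S (\<lambda>x. \<Sum>b\<in>onb. inner (v x) b *\<^sub>R frechet_derivative f (at (u x)) b)"
    using D by (intro smooth_on_sum smooth_on_scaleR smooth_on_inner smooth_on_const S v
        smooth_on_compose[OF _ u(1) S u(2)])
  have "frechet_derivative f (at (u x)) (v x) =
      (\<Sum>b\<in>onb. inner (v x) b *\<^sub>R frechet_derivative f (at (u x)) b)" if "x \<in> S" for x
    using smooth_on_has_derivative[OF f, of "u x"] that u(2)
    by (blast intro: linear_onb_expand has_derivative_linear)
  then show ?thesis using * by (rule smooth_on_cong[OF S, THEN iffD2])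
qed


section \<open>Bump functions\<close>

text \<open>The factor \<open>inverse t ^ n\<close> makes the family closed under differentiation up
  to linear combinations: the derivative of member \<open>n\<close> involves members
  \<open>n + 1\<close> and \<open>n + 2\<close> only.\<close>

definition flat_exp :: "nat \<Rightarrow> real \<Rightarrow> real"
  where "flat_exp n t = (if t \<le> 0 then 0 else inverse t ^ n * exp (- inverse t))"

text \<open>From the right, substitute the reciprocal: exponential growth beats every power. From
  the left the function is constantly 0.\<close>

lemma flat_exp_tendsto: "(flat_exp n \<longlongrightarrow> 0) (at 0)"
proof -
  have "((\<lambda>t. inverse t ^ n / exp (inverse t)) \<longlongrightarrow> 0) (at_right (0::real))"
    by (rule filterlim_compose[OF tendsto_power_div_exp_0 filterlim_inverse_at_top_right])
  then have "(flat_exp n \<longlongrightarrow> 0) (at_right 0)"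
    by (rule tendsto_cong[THEN iffD1, rotated])
      (auto simp: eventually_at_right_field flat_exp_def exp_minus field_simps intro!: exI[of _ 1])
  moreover have "(flat_exp n \<longlongrightarrow> 0) (at_left 0)"
    by (rule tendsto_eventually) (auto simp: eventually_at_left_field flat_exp_def intro!: exI[of _ "-1"])
  ultimately show ?thesis by (simp add: filterlim_split_at)
qed

lemma flat_exp_has_derivative:
  "(flat_exp n has_real_derivative (flat_exp (n + 2) t - real n * flat_exp (Suc n) t)) (at t)"
proof -
  consider "t > 0" | "t = 0" | "t < 0" by linarith
  then show ?thesis
  proof cases
    case 1
    let ?x = "inverse t"
    have d: "(inverse has_real_derivative - (?x * ?x)) (at t)"
      using DERIV_inverse[of t] 1 by (simp add: power2_eq_square)
    have "((\<lambda>t. inverse t ^ n * exp (- inverse t)) has_real_derivative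
        real n * (- (?x * ?x) * ?x ^ (n - Suc 0)) * exp (- ?x) + exp (- ?x) * - (- (?x * ?x)) * ?x ^ n) (at t)"
      by (intro DERIV_mult DERIV_power DERIV_fun_exp DERIV_minus d)
    moreover have "real n * (- (?x * ?x) * ?x ^ (n - Suc 0)) * exp (- ?x) + exp (- ?x) * - (- (?x * ?x)) * ?x ^ n
        = flat_exp (n + 2) t - real n * flat_exp (Suc n) t"
      using 1 by (cases n) (simp_all add: flat_exp_def algebra_simps)
    ultimately have "((\<lambda>t. inverse t ^ n * exp (- inverse t)) has_real_derivative
        (flat_exp (n + 2) t - real n * flat_exp (Suc n) t)) (at t)" by simp
    then show ?thesis
      by (rule has_field_derivative_transform_within_open[where S = "{0<..}"])
        (use 1 in \<open>auto simp: flat_exp_def\<close>)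
  next
    case 2
    \<comment> \<open>The difference quotient at 0 is the next member of the family, whose limit at
      0 is known; at \<open>h = 0\<close> both sides are 0 because division by 0 gives 0.\<close>
    have "(\<lambda>h. flat_exp n h / h) = flat_exp (Suc n)"
      by (auto simp: flat_exp_def field_simps)
    then show ?thesis
      using 2 flat_exp_tendsto[of "Suc n"] by (simp add: DERIV_def flat_exp_def[of _ 0])
  next
    case 3
    have "((\<lambda>t. 0) has_real_derivative (flat_exp (n + 2) t - real n * flat_exp (Suc n) t)) (at t)"
      using 3 by (simp add: flat_exp_def)
    then show ?thesis
      by (rule has_field_derivative_transform_within_open[where S = "{..<0}"])
        (use 3 in \<open>auto simp: flat_exp_def\<close>)
  qed
qed

text \<open>Induction on the order for all \<open>n\<close> simultaneously, since differentiating
  raises \<open>n\<close>.\<close>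

lemma smooth_on_flat_exp: "smooth_on UNIV (flat_exp n)"
proof -
  have "Ck_on k UNIV (flat_exp n)" for k
  proof (induction k arbitrary: n)
    case 0
    show ?case
      unfolding Ck_on.simps
      by (intro continuous_at_imp_continuous_on ballI DERIV_isCont[OF flat_exp_has_derivative])
  next
    case (Suc k)
    show ?case
    proof (rule Ck_on_SucI)
      show "(flat_exp n has_derivative (\<lambda>v. (flat_exp (n + 2) t - real n * flat_exp (Suc n) t) * v)) (at t)" for t
        using flat_exp_has_derivative[of n t] by (simp add: has_field_derivative_def)
      have "Ck_on k UNIV (\<lambda>t. (flat_exp (n + 2) t + (- real n) * flat_exp (Suc n) t) * v)" for v
        by (intro Ck_on_bilinear[OF bounded_bilinear_mult] Ck_on_add Ck_on_const Suc open_UNIV)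
      then show "Ck_on k UNIV (\<lambda>t. (flat_exp (n + 2) t - real n * flat_exp (Suc n) t) * v)" for v
        by simp
    qed simp
  qed
  then show ?thesis by (simp add: smooth_on_def)
qed

text \<open>The denominator is positive everywhere because \<open>t\<close> and \<open>1 - t\<close>
  are never both nonpositive.\<close>

definition smooth_step :: "real \<Rightarrow> real"
  where "smooth_step t = flat_exp 0 t * inverse (flat_exp 0 t + flat_exp 0 (1 - t))"

lemma flat_exp_pos: "t > 0 \<Longrightarrow> flat_exp n t > 0" and flat_exp_nonneg: "flat_exp n t \<ge> 0"
  by (auto simp: flat_exp_def)

lemma smooth_step: "t \<le> 0 \<Longrightarrow> smooth_step t = 0" "t \<ge> 1 \<Longrightarrow> smooth_step t = 1"
  using flat_exp_pos[of t 0] by (auto simp: smooth_step_def flat_exp_def[of _ "1 - t"]) (auto simp: flat_exp_def)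

lemma smooth_on_smooth_step: "smooth_on UNIV smooth_step"
proof -
  have pos: "flat_exp 0 t + flat_exp 0 (1 - t) \<noteq> 0" for t
    using flat_exp_pos[of t 0] flat_exp_pos[of "1 - t" 0] flat_exp_nonneg[of 0 t] flat_exp_nonneg[of 0 "1 - t"]
    by (cases "t > 0") linarith+
  have 1: "smooth_on UNIV (\<lambda>t. flat_exp 0 (1 - t))"
    by (rule smooth_on_compose[OF smooth_on_flat_exp])
      (simp_all add: smooth_on_diff smooth_on_const smooth_on_ident)
  have "smooth_on {x::real. x \<noteq> 0} inverse" by (simp add: smooth_on_def Ck_on_inverse)
  then have "smooth_on UNIV (\<lambda>t. inverse (flat_exp 0 t + flat_exp 0 (1 - t)))"
    by (rule smooth_on_compose) (use pos in \<open>auto intro!: smooth_on_add smooth_on_flat_exp 1\<close>)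
  then show ?thesis
    unfolding smooth_step_def by (intro smooth_on_mult smooth_on_flat_exp) auto
qed

lemma bump_function:
  fixes a :: "'a::fin_dim_inner"
  assumes "open S" "a \<in> S"
  obtains h :: "'a \<Rightarrow> real" and T K where "smooth_on UNIV h" "open T" "a \<in> T"
    "\<And>x. x \<in> T \<Longrightarrow> h x = 1" "compact K" "K \<subseteq> S" "\<And>x. x \<notin> K \<Longrightarrow> h x = 0"
proof -
  obtain r where r: "r > 0" "cball a r \<subseteq> S" using assms open_contains_cball by blast
  \<comment> \<open>With \<open>d\<close> the distance to \<open>a\<close>, the argument
    \<open>2 - 2 d^2 / r^2\<close> is at least 1 for \<open>d < r / 2\<close> and at most 0 for
    \<open>d > r\<close>. The squared distance keeps the function smooth at the centre.\<close>
  let ?h = "\<lambda>x. smooth_step (2 - 2 / r\<^sup>2 * inner (x - a) (x - a))"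
  show thesis
  proof (rule that[of ?h "ball a (r / 2)" "cball a r"])
    have "smooth_on UNIV (\<lambda>x. 2 - 2 / r\<^sup>2 * inner (x - a) (x - a))"
      by (intro smooth_on_diff smooth_on_mult smooth_on_inner smooth_on_const smooth_on_ident open_UNIV)
    then show "smooth_on UNIV ?h"
      by (rule smooth_on_compose[OF smooth_on_smooth_step]) auto
    show "open (ball a (r / 2))" "a \<in> ball a (r / 2)" "compact (cball a r)" "cball a r \<subseteq> S"
      using r by (auto simp: compact_cball_fin_dim)
    fix x
    have n: "inner (x - a) (x - a) = (dist a x)\<^sup>2"
      by (metis dist_commute dist_norm power2_norm_eq_inner)
    show "?h x = 1" if "x \<in> ball a (r / 2)"
    proof -
      have "(dist a x)\<^sup>2 \<le> (r / 2)\<^sup>2" using that by (intro power_mono) auto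
      then have "(dist a x)\<^sup>2 \<le> r\<^sup>2 / 4" by (simp add: power_divide)
      then have "2 * (dist a x)\<^sup>2 \<le> r\<^sup>2"
        using zero_le_power2[of "dist a x"] by linarith
      then show ?thesis unfolding n using r by (intro smooth_step) (simp add: field_simps)
    qed
    show "?h x = 0" if "x \<notin> cball a r"
    proof -
      have "r\<^sup>2 \<le> (dist a x)\<^sup>2" using that r by (intro power_mono) auto
      then show ?thesis unfolding n using r by (intro smooth_step) (simp add: field_simps)
    qed
  qed
qed


section \<open>Topology and smooth functions of a manifold\<close>

text \<open>
  Many facts are needed for an atlas before it is known that the induced topology is Hausdorff and
  second countable.
\<close>

definition pre_manifold :: "('p, 'm::fin_dim_inner) atlas \<Rightarrow> bool"
  where "pre_manifold A \<longleftrightarrow>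
    (\<forall>(D, \<phi>)\<in>A. inj_on \<phi> D \<and> open (\<phi> ` D)) \<and>
    (\<forall>(D, \<phi>)\<in>A. \<forall>(D', \<phi>')\<in>A.
        open (\<phi> ` (D \<inter> D')) \<and> smooth_on (\<phi> ` (D \<inter> D')) (\<lambda>x. \<phi>' (inv_into D \<phi> x)))"

lemma smooth_manifold_iff:
  "smooth_manifold A \<longleftrightarrow> pre_manifold A \<and>
    Hausdorff_space (atlas_topology A) \<and> second_countable (atlas_topology A)"
  by (simp add: smooth_manifold_def pre_manifold_def)

lemma smooth_manifold_imp_pre [simp]: "smooth_manifold A \<Longrightarrow> pre_manifold A"
  by (simp add: smooth_manifold_iff)

lemma pre_manifold_chart:
  assumes "pre_manifold A" "(D, \<phi>) \<in> A"
  shows "inj_on \<phi> D" "open (\<phi> ` D)"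
  using assms by (auto simp: pre_manifold_def)

lemma pre_manifold_transition:
  assumes "pre_manifold A" "(D, \<phi>) \<in> A" "(D', \<phi>') \<in> A"
  shows "open (\<phi> ` (D \<inter> D'))" "smooth_on (\<phi> ` (D \<inter> D')) (\<lambda>x. \<phi>' (inv_into D \<phi> x))"
  using assms unfolding pre_manifold_def by blast+

lemma chart_domain_carrier: "(D, \<phi>) \<in> A \<Longrightarrow> D \<subseteq> carrier A"
  by (auto simp: carrier_def)

lemma chart_inv [simp]:
  assumes "pre_manifold A" "(D, \<phi>) \<in> A" "p \<in> D"
  shows "inv_into D \<phi> (\<phi> p) = p"
  using pre_manifold_chart(1)[OF assms(1,2)] assms(3) by simp

text \<open>The definition by \<open>topology\<close> is only informative once the axioms are
  checked. Closure under intersection is where injectivity of charts enters, since images must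
  commute with intersections.\<close>

lemma openin_atlas_topology:
  assumes "pre_manifold A"
  shows "openin (atlas_topology A) W \<longleftrightarrow>
    W \<subseteq> carrier A \<and> (\<forall>D \<phi>. (D, \<phi>) \<in> A \<longrightarrow> open (\<phi> ` (W \<inter> D)))"
proof -
  have "istopology (\<lambda>W. W \<subseteq> carrier A \<and> (\<forall>(D, \<phi>)\<in>A. open (\<phi> ` (W \<inter> D))))"
    unfolding istopology_def
  proof (intro conjI allI impI)
    fix S T
    assume S: "S \<subseteq> carrier A \<and> (\<forall>(D, \<phi>)\<in>A. open (\<phi> ` (S \<inter> D)))"
      and T: "T \<subseteq> carrier A \<and> (\<forall>(D, \<phi>)\<in>A. open (\<phi> ` (T \<inter> D)))"
    show "S \<inter> T \<subseteq> carrier A" using S by blast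
    show "\<forall>(D, \<phi>)\<in>A. open (\<phi> ` (S \<inter> T \<inter> D))"
    proof clarify
      fix D \<phi> assume c: "(D, \<phi>) \<in> A"
      have "\<phi> ` (S \<inter> T \<inter> D) = \<phi> ` ((S \<inter> D) \<inter> (T \<inter> D))" by (rule arg_cong[of _ _ "image \<phi>"]) blast
      also have "\<dots> = \<phi> ` (S \<inter> D) \<inter> \<phi> ` (T \<inter> D)"
        by (rule inj_on_image_Int[OF pre_manifold_chart(1)[OF assms c]]) auto
      finally show "open (\<phi> ` (S \<inter> T \<inter> D))" using S T c by auto
    qed
  next
    fix \<K>
    assume K: "\<forall>K\<in>\<K>. K \<subseteq> carrier A \<and> (\<forall>(D, \<phi>)\<in>A. open (\<phi> ` (K \<inter> D)))"
    show "\<Union>\<K> \<subseteq> carrier A" using K by blast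
    show "\<forall>(D, \<phi>)\<in>A. open (\<phi> ` (\<Union>\<K> \<inter> D))"
    proof clarify
      fix D \<phi> assume c: "(D, \<phi>) \<in> A"
      have "\<phi> ` (\<Union>\<K> \<inter> D) = (\<Union>K\<in>\<K>. \<phi> ` (K \<inter> D))" by blast
      moreover have "open (\<phi> ` (K \<inter> D))" if "K \<in> \<K>" for K
        using bspec[OF conjunct2[OF bspec[OF K that]] c] by simp
      ultimately show "open (\<phi> ` (\<Union>\<K> \<inter> D))" by auto
    qed
  qed
  then show ?thesis unfolding atlas_topology_def by auto
qed

lemma topspace_atlas_topology:
  assumes "pre_manifold A"
  shows "topspace (atlas_topology A) = carrier A"
proof
  show "topspace (atlas_topology A) \<subseteq> carrier A"
    using openin_atlas_topology[OF assms] openin_topspace by blast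
  have "carrier A \<inter> D = D" if "(D, \<phi>) \<in> A" for D \<phi>
    using chart_domain_carrier[OF that] by blast
  then have "openin (atlas_topology A) (carrier A)"
    unfolding openin_atlas_topology[OF assms] using pre_manifold_chart(2)[OF assms] by simp
  then show "carrier A \<subseteq> topspace (atlas_topology A)" by (rule openin_subset)
qed

lemma openin_carrier:
  "pre_manifold A \<Longrightarrow> openin (atlas_topology A) (carrier A)"
  using topspace_atlas_topology openin_topspace by metis

lemma open_chart_image:
  assumes "pre_manifold A" "(D, \<phi>) \<in> A" "openin (atlas_topology A) W"
  shows "open (\<phi> ` (W \<inter> D))"
  using assms openin_atlas_topology by blast

text \<open>Seen in another chart the set is the preimage of \<open>O'\<close> under a transition
  map, which is continuous on an open set.\<close>

lemma openin_chart_vimage: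
  assumes A: "pre_manifold A" and c: "(D, \<phi>) \<in> A" and "open O'"
  shows "openin (atlas_topology A) (D \<inter> \<phi> -` O')"
  unfolding openin_atlas_topology[OF A]
proof (intro conjI allI impI)
  show "D \<inter> \<phi> -` O' \<subseteq> carrier A" using chart_domain_carrier[OF c] by blast
  fix D' \<phi>' assume c': "(D', \<phi>') \<in> A"
  have "\<phi>' ` (D \<inter> \<phi> -` O' \<inter> D') = \<phi>' ` (D' \<inter> D) \<inter> (\<lambda>x. \<phi> (inv_into D' \<phi>' x)) -` O'"
    using chart_inv[OF A c'] by auto
  also have "open \<dots>"
    using pre_manifold_transition[OF A c' c] assms(3)
    by (intro continuous_open_preimage smooth_on_continuous)
  finally show "open (\<phi>' ` (D \<inter> \<phi> -` O' \<inter> D'))" .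
qed

lemma openin_chart_domain:
  assumes "pre_manifold A" "(D, \<phi>) \<in> A"
  shows "openin (atlas_topology A) D"
  using openin_chart_vimage[OF assms open_UNIV] by simp

lemma in_carrierE:
  assumes "p \<in> carrier A"
  obtains D \<phi> where "(D, \<phi>) \<in> A" "p \<in> D"
  using assms by (auto simp: carrier_def)

text \<open>A countable basis of the model space pulled back along countably many charts that cover
  is again countable, and it is a basis because each chart is injective.\<close>

lemma second_countable_atlas_topology:
  assumes A: "pre_manifold A" and C: "C \<subseteq> A" "countable C" "carrier A \<subseteq> (\<Union>(D, \<phi>)\<in>C. D)"
  shows "second_countable (atlas_topology A)"
proof -
  obtain \<B> :: "'b set set" where \<B>: "countable \<B>" "\<And>W. W \<in> \<B> \<Longrightarrow> open W"
    "\<And>U x. open U \<Longrightarrow> x \<in> U \<Longrightarrow> \<exists>W\<in>\<B>. x \<in> W \<and> W \<subseteq> U"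
    using countable_basis_fin_dim by metis
  define \<V> where "\<V> = (\<lambda>((D, \<phi>), W). D \<inter> \<phi> -` W) ` (C \<times> \<B>)"
  show ?thesis
    unfolding second_countable_def
  proof (intro exI[of _ \<V>] conjI allI impI ballI)
    show "countable \<V>" unfolding \<V>_def using \<B>(1) C(2) by (intro countable_image countable_SIGMA)
    show "openin (atlas_topology A) V" if "V \<in> \<V>" for V
      using that C(1) \<B>(2) unfolding \<V>_def by (auto intro!: openin_chart_vimage[OF A])
    fix U p assume U: "openin (atlas_topology A) U \<and> p \<in> U"
    then have "p \<in> carrier A" using openin_atlas_topology[OF A] by blast
    then obtain D \<phi> where c: "(D, \<phi>) \<in> C" "p \<in> D" using C(3) by auto
    then have cA: "(D, \<phi>) \<in> A" using C(1) by blast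
    have "open (\<phi> ` (U \<inter> D))" using open_chart_image[OF A cA] U by blast
    moreover have "\<phi> p \<in> \<phi> ` (U \<inter> D)" using U c by blast
    ultimately obtain W where W: "W \<in> \<B>" "\<phi> p \<in> W" "W \<subseteq> \<phi> ` (U \<inter> D)"
      using \<B>(3) by blast
    have "D \<inter> \<phi> -` W \<subseteq> U"
    proof
      fix q assume q: "q \<in> D \<inter> \<phi> -` W"
      then obtain r where "r \<in> U \<inter> D" "\<phi> q = \<phi> r" using W(3) by blast
      then show "q \<in> U" using inj_onD[OF pre_manifold_chart(1)[OF A cA], of q r] q by simp
    qed
    moreover have "D \<inter> \<phi> -` W \<in> \<V>"
      unfolding \<V>_def using c(1) W(1) by (intro image_eqI[of _ _ "((D, \<phi>), W)"]) simp_all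
    ultimately show "\<exists>V\<in>\<V>. p \<in> V \<and> V \<subseteq> U"
      using c(2) W(2) by (intro bexI[of _ "D \<inter> \<phi> -` W"] conjI) simp_all
  qed
qed

section \<open>Smooth functions on open subsets of a manifold\<close>

lemma smooth_fun_onD:
  "smooth_fun_on A W f \<Longrightarrow> (D, \<phi>) \<in> A \<Longrightarrow> smooth_on (\<phi> ` (W \<inter> D)) (\<lambda>x. f (inv_into D \<phi> x))"
  by (auto simp: smooth_fun_on_def)

lemma smooth_fun_onI:
  "(\<And>D \<phi>. (D, \<phi>) \<in> A \<Longrightarrow> smooth_on (\<phi> ` (W \<inter> D)) (\<lambda>x. f (inv_into D \<phi> x))) \<Longrightarrow> smooth_fun_on A W f"
  by (auto simp: smooth_fun_on_def)

lemma smooth_fun_on_subset: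
  assumes "smooth_fun_on A W f" "W' \<subseteq> W"
  shows "smooth_fun_on A W' f"
  by (rule smooth_fun_onI) (rule smooth_on_subset[OF smooth_fun_onD[OF assms(1)]], use assms(2) in auto)

lemma smooth_fun_on_cong:
  assumes A: "pre_manifold A" and W: "openin (atlas_topology A) W" and "\<And>p. p \<in> W \<Longrightarrow> f p = g p"
  shows "smooth_fun_on A W f \<longleftrightarrow> smooth_fun_on A W g"
proof -
  have "smooth_on (\<phi> ` (W \<inter> D)) (\<lambda>x. f (inv_into D \<phi> x)) \<longleftrightarrow>
      smooth_on (\<phi> ` (W \<inter> D)) (\<lambda>x. g (inv_into D \<phi> x))" if c: "(D, \<phi>) \<in> A" for D \<phi>
    using chart_inv[OF A c] assms(3)
    by (intro smooth_on_cong open_chart_image[OF A c W]) auto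
  then show ?thesis by (auto simp: smooth_fun_on_def)
qed

lemma smooth_fun_on_local:
  assumes A: "pre_manifold A"
    and "\<And>p. p \<in> W \<Longrightarrow> \<exists>W'. openin (atlas_topology A) W' \<and> p \<in> W' \<and> smooth_fun_on A W' f"
  shows "smooth_fun_on A W f"
proof (rule smooth_fun_onI)
  fix D \<phi> assume c: "(D, \<phi>) \<in> A"
  show "smooth_on (\<phi> ` (W \<inter> D)) (\<lambda>x. f (inv_into D \<phi> x))"
  proof (rule smooth_on_local)
    fix x assume "x \<in> \<phi> ` (W \<inter> D)"
    then obtain p where p: "x = \<phi> p" "p \<in> W" "p \<in> D" by blast
    then obtain W' where W': "openin (atlas_topology A) W'" "p \<in> W'" "smooth_fun_on A W' f"
      using assms(2) by blast
    show "\<exists>T. open T \<and> x \<in> T \<and> smooth_on T (\<lambda>x. f (inv_into D \<phi> x))"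
      using open_chart_image[OF A c W'(1)] smooth_fun_onD[OF W'(3) c] p W'(2) by blast
  qed
qed

text \<open>One chart containing \<open>W\<close> is enough: in any other chart the function differs
  by a smooth transition map.\<close>

lemma smooth_fun_on_chartI:
  assumes A: "pre_manifold A" and c: "(D, \<phi>) \<in> A" and W: "openin (atlas_topology A) W" "W \<subseteq> D"
    and f: "smooth_on (\<phi> ` W) (\<lambda>x. f (inv_into D \<phi> x))"
  shows "smooth_fun_on A W f"
proof (rule smooth_fun_onI)
  fix D' \<phi>' assume c': "(D', \<phi>') \<in> A"
  have o: "open (\<phi>' ` (W \<inter> D'))" by (rule open_chart_image[OF A c' W(1)])
  have tr: "smooth_on (\<phi>' ` (W \<inter> D')) (\<lambda>x. \<phi> (inv_into D' \<phi>' x))"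
    by (rule smooth_on_subset[OF pre_manifold_transition(2)[OF A c' c]]) (use W(2) in auto)
  have "smooth_on (\<phi>' ` (W \<inter> D')) (\<lambda>x. f (inv_into D \<phi> (\<phi> (inv_into D' \<phi>' x))))"
    by (rule smooth_on_compose[OF f tr o]) (use chart_inv[OF A c'] in auto)
  then show "smooth_on (\<phi>' ` (W \<inter> D')) (\<lambda>x. f (inv_into D' \<phi>' x))"
    by (rule smooth_on_cong[OF o, THEN iffD1, rotated])
      (use chart_inv[OF A c'] chart_inv[OF A c] W(2) in auto)
qed

lemma smooth_fun_on_const: "smooth_fun_on A W (\<lambda>p. c)"
  by (simp add: smooth_fun_on_def smooth_on_const case_prod_unfold)

lemma smooth_fun_on_chart:
  assumes A: "pre_manifold A" and c: "(D, \<phi>) \<in> A"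
  shows "smooth_fun_on A D \<phi>"
proof (rule smooth_fun_onI)
  fix D' \<phi>' assume c': "(D', \<phi>') \<in> A"
  show "smooth_on (\<phi>' ` (D \<inter> D')) (\<lambda>x. \<phi> (inv_into D' \<phi>' x))"
    using pre_manifold_transition(2)[OF A c' c] by (simp add: Int_commute)
qed

context
  fixes A :: "('p, 'm::fin_dim_inner) atlas" and W :: "'p set"
  assumes A: "pre_manifold A" and W: "openin (atlas_topology A) W"
begin

lemma smooth_fun_on_add:
  "smooth_fun_on A W f \<Longrightarrow> smooth_fun_on A W g \<Longrightarrow> smooth_fun_on A W (\<lambda>p. f p + g p)"
  by (rule smooth_fun_onI) (intro smooth_on_add open_chart_image[OF A _ W] smooth_fun_onD)

lemma smooth_fun_on_diff:
  "smooth_fun_on A W f \<Longrightarrow> smooth_fun_on A W g \<Longrightarrow> smooth_fun_on A W (\<lambda>p. f p - g p)"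
  by (rule smooth_fun_onI) (intro smooth_on_diff open_chart_image[OF A _ W] smooth_fun_onD)

lemma smooth_fun_on_scaleR:
  "smooth_fun_on A W f \<Longrightarrow> smooth_fun_on A W g \<Longrightarrow> smooth_fun_on A W (\<lambda>p. f p *\<^sub>R g p)"
  by (rule smooth_fun_onI) (intro smooth_on_scaleR open_chart_image[OF A _ W] smooth_fun_onD)

lemma smooth_fun_on_mult:
  fixes f g :: "'p \<Rightarrow> real"
  shows "smooth_fun_on A W f \<Longrightarrow> smooth_fun_on A W g \<Longrightarrow> smooth_fun_on A W (\<lambda>p. f p * g p)"
  by (rule smooth_fun_onI) (intro smooth_on_mult open_chart_image[OF A _ W] smooth_fun_onD)

lemma smooth_fun_on_inner:
  "smooth_fun_on A W f \<Longrightarrow> smooth_fun_on A W g \<Longrightarrow> smooth_fun_on A W (\<lambda>p. inner (f p) (g p))"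
  by (rule smooth_fun_onI) (intro smooth_on_inner open_chart_image[OF A _ W] smooth_fun_onD)

lemma smooth_fun_on_sum:
  "(\<And>i. i \<in> I \<Longrightarrow> smooth_fun_on A W (f i)) \<Longrightarrow> smooth_fun_on A W (\<lambda>p. \<Sum>i\<in>I. f i p)"
  by (rule smooth_fun_onI) (intro smooth_on_sum open_chart_image[OF A _ W] smooth_fun_onD)

lemma smooth_fun_on_prod:
  fixes f :: "'i \<Rightarrow> 'p \<Rightarrow> real"
  shows "(\<And>i. i \<in> I \<Longrightarrow> smooth_fun_on A W (f i)) \<Longrightarrow> smooth_fun_on A W (\<lambda>p. \<Prod>i\<in>I. f i p)"
  by (induction I rule: infinite_finite_induct) (auto intro: smooth_fun_on_mult smooth_fun_on_const)

lemma smooth_fun_on_Pair: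
  "smooth_fun_on A W f \<Longrightarrow> smooth_fun_on A W g \<Longrightarrow> smooth_fun_on A W (\<lambda>p. (f p, g p))"
  by (rule smooth_fun_onI) (intro smooth_on_Pair open_chart_image[OF A _ W] smooth_fun_onD)

lemma smooth_fun_on_compose:
  fixes f :: "'p \<Rightarrow> 'b::fin_dim_inner"
  assumes g: "smooth_on T g" and f: "smooth_fun_on A W f" "f ` W \<subseteq> T"
  shows "smooth_fun_on A W (\<lambda>p. g (f p))"
proof (rule smooth_fun_onI)
  fix D \<phi> assume c: "(D, \<phi>) \<in> A"
  show "smooth_on (\<phi> ` (W \<inter> D)) (\<lambda>x. g (f (inv_into D \<phi> x)))"
    by (rule smooth_on_compose[OF g smooth_fun_onD[OF f(1) c] open_chart_image[OF A c W]])
      (use f(2) chart_inv[OF A c] in auto)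
qed

lemma smooth_fun_on_linear:
  fixes f :: "'p \<Rightarrow> 'b::fin_dim_inner" and g :: "'b \<Rightarrow> 'c::real_normed_vector"
  shows "linear g \<Longrightarrow> smooth_fun_on A W f \<Longrightarrow> smooth_fun_on A W (\<lambda>p. g (f p))"
  by (rule smooth_fun_on_compose[of UNIV])
    (auto intro: smooth_on_bounded_linear linear_imp_bounded_linear)

lemma smooth_fun_on_fst:
  fixes f :: "'p \<Rightarrow> 'b::fin_dim_inner \<times> 'c::fin_dim_inner"
  shows "smooth_fun_on A W f \<Longrightarrow> smooth_fun_on A W (\<lambda>p. fst (f p))"
  by (rule smooth_fun_on_linear[OF bounded_linear.linear[OF bounded_linear_fst]])

lemma smooth_fun_on_snd:
  fixes f :: "'p \<Rightarrow> 'b::fin_dim_inner \<times> 'c::fin_dim_inner"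
  shows "smooth_fun_on A W f \<Longrightarrow> smooth_fun_on A W (\<lambda>p. snd (f p))"
  by (rule smooth_fun_on_linear[OF bounded_linear.linear[OF bounded_linear_snd]])

text \<open>The derivative is taken in one fixed chart, but the result is smooth as a function on
  the manifold; other charts only reparametrise the point of evaluation.\<close>

lemma smooth_fun_on_chart_derivative:
  assumes c: "(D, \<phi>) \<in> A" and WD: "W \<subseteq> D" and f: "smooth_fun_on A W f" and v: "smooth_fun_on A W v"
  shows "smooth_fun_on A W (\<lambda>p. frechet_derivative (\<lambda>x. f (inv_into D \<phi> x)) (at (\<phi> p)) (v p))"
proof (rule smooth_fun_onI)
  fix D' \<phi>' assume c': "(D', \<phi>') \<in> A"
  have u: "smooth_on (\<phi>' ` (W \<inter> D')) (\<lambda>x. \<phi> (inv_into D' \<phi>' x))"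
    by (rule smooth_fun_onD[OF smooth_fun_on_subset[OF smooth_fun_on_chart[OF A c] WD] c'])
  show "smooth_on (\<phi>' ` (W \<inter> D')) (\<lambda>x. frechet_derivative (\<lambda>x. f (inv_into D \<phi> x))
      (at (\<phi> (inv_into D' \<phi>' x))) (v (inv_into D' \<phi>' x)))"
    by (rule smooth_on_frechet_derivative[OF smooth_fun_onD[OF f c] open_chart_image[OF A c' W] u _
          smooth_fun_onD[OF v c']]) (use chart_inv[OF A c'] WD in auto)
qed

end

text \<open>Lets \<open>f\<close> be controlled on \<open>V\<close> only. A point of
  \<open>W\<close> outside \<open>V\<close> lies outside the closed set \<open>Z\<close>, and the
  product vanishes on the open set \<open>W - Z\<close> around it.\<close>

lemma smooth_fun_on_cutoff:
  fixes f :: "'p \<Rightarrow> 'b::real_normed_vector"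
  assumes A: "pre_manifold A" and "openin (atlas_topology A) W" "openin (atlas_topology A) V"
    and h: "smooth_fun_on A W h" "closedin (atlas_topology A) Z" "Z \<subseteq> V" "\<And>q. q \<notin> Z \<Longrightarrow> h q = 0"
    and f: "smooth_fun_on A (W \<inter> V) f"
  shows "smooth_fun_on A W (\<lambda>q. h q *\<^sub>R f q)"
proof (rule smooth_fun_on_local[OF A])
  fix p assume p: "p \<in> W"
  show "\<exists>W'. openin (atlas_topology A) W' \<and> p \<in> W' \<and> smooth_fun_on A W' (\<lambda>q. h q *\<^sub>R f q)"
  proof (cases "p \<in> V")
    case True
    then show ?thesis
      using p assms(2,3) f smooth_fun_on_subset[OF h(1), of "W \<inter> V"]
      by (intro exI[of _ "W \<inter> V"]) (auto intro!: smooth_fun_on_scaleR[OF A])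
  next
    case False
    have o: "openin (atlas_topology A) (W - Z)" using assms(2) h(2) by (rule openin_diff)
    have "smooth_fun_on A (W - Z) (\<lambda>q. h q *\<^sub>R f q) \<longleftrightarrow> smooth_fun_on A (W - Z) (\<lambda>q. 0::'b)"
      using h(4) by (intro smooth_fun_on_cong[OF A o]) auto
    then show ?thesis using False p o h(3) smooth_fun_on_const by blast
  qed
qed

text \<open>The inverse chart is continuous, so it carries \<open>K\<close> to a compact set, and
  compact sets are closed because the manifold is Hausdorff. Without closedness, extension by 0
  beyond a chart could fail to be smooth.\<close>

lemma closedin_chart_compact:
  assumes A: "smooth_manifold A" and c: "(D, \<phi>) \<in> A" and K: "compact K" "K \<subseteq> \<phi> ` D"
  shows "closedin (atlas_topology A) (D \<inter> \<phi> -` K)"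
proof -
  have pre: "pre_manifold A" using A by simp
  have "continuous_map (top_of_set (\<phi> ` D)) (atlas_topology A) (inv_into D \<phi>)"
    unfolding continuous_map
  proof (intro conjI allI impI)
    show "inv_into D \<phi> ` topspace (top_of_set (\<phi> ` D)) \<subseteq> topspace (atlas_topology A)"
      using chart_inv[OF pre c] chart_domain_carrier[OF c] by (auto simp: topspace_atlas_topology[OF pre])
    fix U assume "openin (atlas_topology A) U"
    then have "open (\<phi> ` (U \<inter> D))" by (rule open_chart_image[OF pre c])
    moreover have "{x \<in> topspace (top_of_set (\<phi> ` D)). inv_into D \<phi> x \<in> U} = \<phi> ` (U \<inter> D)"
      using chart_inv[OF pre c] by auto
    ultimately show "openin (top_of_set (\<phi> ` D)) {x \<in> topspace (top_of_set (\<phi> ` D)). inv_into D \<phi> x \<in> U}"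
      by (metis (lifting) open_subset image_mono inf_le2)
  qed
  moreover have "compactin (top_of_set (\<phi> ` D)) K"
    using K by (simp add: compactin_subtopology)
  ultimately have "compactin (atlas_topology A) (inv_into D \<phi> ` K)"
    by (rule image_compactin[rotated])
  moreover have "inv_into D \<phi> ` K = D \<inter> \<phi> -` K"
    using K(2) chart_inv[OF pre c] by force
  ultimately show ?thesis
    using A compactin_imp_closedin by (metis smooth_manifold_iff)
qed

text \<open>A Euclidean bump function is transported by the chart and extended by 0. It is smooth on
  the chart domain and on the complement of its closed support \<open>Z\<close>, and these two open
  sets cover the manifold.\<close>

lemma bump_function_manifold:
  assumes A: "smooth_manifold A" and c: "(D, \<phi>) \<in> A" and W: "openin (atlas_topology A) W"
    and p: "p \<in> D" "p \<in> W"
  obtains h V Z where "h \<in> C_inf A" "openin (atlas_topology A) V" "p \<in> V" "\<And>q. q \<in> V \<Longrightarrow> h q = 1"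
    "closedin (atlas_topology A) Z" "Z \<subseteq> W \<inter> D" "\<And>q. q \<notin> Z \<Longrightarrow> h q = 0"
proof -
  have pre: "pre_manifold A" using A by simp
  have oD: "openin (atlas_topology A) D" by (rule openin_chart_domain[OF pre c])
  obtain g :: "'b \<Rightarrow> real" and T K where g: "smooth_on UNIV g" "open T" "\<phi> p \<in> T" "\<And>x. x \<in> T \<Longrightarrow> g x = 1"
    "compact K" "K \<subseteq> \<phi> ` (W \<inter> D)" "\<And>x. x \<notin> K \<Longrightarrow> g x = 0"
    by (rule bump_function[OF open_chart_image[OF pre c W], of "\<phi> p"]) (use p in auto)
  define Z where "Z = D \<inter> \<phi> -` K"
  define h where "h q = (if q \<in> D then g (\<phi> q) else 0)" for q
  have Z: "closedin (atlas_topology A) Z"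
    unfolding Z_def by (rule closedin_chart_compact[OF A c g(5)]) (use g(6) in auto)
  have h0: "h q = 0" if "q \<notin> Z" for q using that g(7) by (auto simp: h_def Z_def)
  show thesis
  proof (rule that[of h "D \<inter> \<phi> -` T" Z])
    have D: "smooth_fun_on A D h"
      by (rule smooth_fun_on_cong[OF pre oD, THEN iffD1, rotated,
            OF smooth_fun_on_compose[OF pre oD g(1) smooth_fun_on_chart[OF pre c]]]) (auto simp: h_def)
    have oZ: "openin (atlas_topology A) (carrier A - Z)"
      using Z openin_diff[OF openin_carrier[OF pre]] by blast
    have nZ: "smooth_fun_on A (carrier A - Z) h"
      by (rule smooth_fun_on_cong[OF pre oZ, THEN iffD1, rotated, OF smooth_fun_on_const[of _ _ 0]])
        (auto simp: h0)
    have "smooth_fun_on A (carrier A) h"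
    proof (rule smooth_fun_on_local[OF pre])
      fix q assume "q \<in> carrier A"
      then show "\<exists>W'. openin (atlas_topology A) W' \<and> q \<in> W' \<and> smooth_fun_on A W' h"
        using D nZ oD oZ by (cases "q \<in> D") (auto simp: Z_def)
    qed
    then show "h \<in> C_inf A" by (simp add: C_inf_def)
    show "openin (atlas_topology A) (D \<inter> \<phi> -` T)" by (rule openin_chart_vimage[OF pre c g(2)])
    show "p \<in> D \<inter> \<phi> -` T" using p g by auto
    show "\<And>q. q \<in> D \<inter> \<phi> -` T \<Longrightarrow> h q = 1" using g(4) by (auto simp: h_def)
    show "Z \<subseteq> W \<inter> D"
    proof
      fix q assume q: "q \<in> Z"
      then obtain r where "r \<in> W \<inter> D" "\<phi> q = \<phi> r" using g(6) by (auto simp: Z_def)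
      then show "q \<in> W \<inter> D"
        using inj_onD[OF pre_manifold_chart(1)[OF pre c], of q r] q by (simp add: Z_def)
    qed
  qed (fact Z h0)+
qed

text \<open>
  If \<open>f n\<close> is a sequence of bump functions such that every point has a neighbourhood on which some
  \<open>f n\<close> is 1, then the functions \<open>f n * (\<Prod>i<n. 1 - f i)\<close> are locally finite and sum up to 1; no
  exhaustion by compact sets is needed.
\<close>

lemma partition_of_unity:
  assumes A: "smooth_manifold A" and ne: "A \<noteq> {}"
  obtains c :: "nat \<Rightarrow> ('p, 'm::fin_dim_inner) chart" and g :: "nat \<Rightarrow> 'p \<Rightarrow> real" and Z
  where "\<And>n. c n \<in> A" "\<And>n. g n \<in> C_inf A" "\<And>n. closedin (atlas_topology A) (Z n)"
    "\<And>n. Z n \<subseteq> fst (c n)" "\<And>n q. q \<notin> Z n \<Longrightarrow> g n q = 0"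
    "\<And>p. p \<in> carrier A \<Longrightarrow> \<exists>W N. openin (atlas_topology A) W \<and> p \<in> W \<and>
        (\<forall>q\<in>W. (\<forall>n\<ge>N. g n q = 0) \<and> (\<Sum>n<N. g n q) = 1)"
proof (cases "carrier A = {}")
  case True
  obtain c where "c \<in> A" using ne by blast
  then show ?thesis
    using True by (intro that[of "\<lambda>_. c" "\<lambda>_ _. 0" "\<lambda>_. {}"]) (auto simp: C_inf_def smooth_fun_on_const)
next
  case False
  have pre: "pre_manifold A" using A by simp
  have "\<exists>h V Z c. c \<in> A \<and> h \<in> C_inf A \<and> openin (atlas_topology A) V \<and> p \<in> V \<and> (\<forall>q\<in>V. h q = 1) \<and>
      closedin (atlas_topology A) Z \<and> Z \<subseteq> fst c \<and> (\<forall>q. q \<notin> Z \<longrightarrow> h q = 0)" if p: "p \<in> carrier A" for p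
  proof -
    obtain D \<phi> where c: "(D, \<phi>) \<in> A" "p \<in> D" using p by (rule in_carrierE)
    obtain h V Z where "h \<in> C_inf A" "openin (atlas_topology A) V" "p \<in> V" "\<And>q. q \<in> V \<Longrightarrow> h q = 1"
      "closedin (atlas_topology A) Z" "Z \<subseteq> carrier A \<inter> D" "\<And>q. q \<notin> Z \<Longrightarrow> h q = 0"
      by (rule bump_function_manifold[OF A c(1) openin_carrier[OF pre] c(2) p]) blast
    then show ?thesis using c(1)
      by (intro exI[of _ h] exI[of _ V] exI[of _ Z] exI[of _ "(D, \<phi>)"]) auto
  qed
  then obtain h V Z c where hV: "\<And>p. p \<in> carrier A \<Longrightarrow> c p \<in> A \<and> h p \<in> C_inf A \<and>
      openin (atlas_topology A) (V p) \<and> p \<in> V p \<and> (\<forall>q\<in>V p. h p q = 1) \<and>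
      closedin (atlas_topology A) (Z p) \<and> Z p \<subseteq> fst (c p) \<and> (\<forall>q. q \<notin> Z p \<longrightarrow> h p q = 0)"
    by metis
  have V: "openin (atlas_topology A) (V p)" "p \<in> V p" if "p \<in> carrier A" for p
    using hV[OF that] by blast+
  \<comment> \<open>Second countability is used here, to select countably many of the neighbourhoods
    on which some bump function is 1.\<close>
  have "Lindelof_space (atlas_topology A)"
    using A by (simp add: smooth_manifold_iff second_countable_imp_Lindelof_space)
  moreover have "\<Union> (V ` carrier A) = carrier A"
    using V openin_subset[of "atlas_topology A"] unfolding topspace_atlas_topology[OF pre] by blast
  moreover have "\<forall>U\<in>V ` carrier A. openin (atlas_topology A) U" using V(1) by blast
  ultimately obtain \<V> where \<V>: "countable \<V>" "\<V> \<subseteq> V ` carrier A" "\<Union>\<V> = carrier A"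
    unfolding Lindelof_space_def topspace_atlas_topology[OF pre] by meson
  obtain P where P: "countable P" "P \<subseteq> carrier A" "\<V> = V ` P"
    using \<V>(1,2) by (metis countable_subset_image)
  have "P \<noteq> {}" using False \<V>(3) P(3) by auto
  \<comment> \<open>The enumeration may repeat points, for instance when \<open>P\<close> is finite.
    This is harmless because the telescoping identity holds for every sequence of functions.\<close>
  define p where "p = from_nat_into P"
  have rp: "range p = P" unfolding p_def by (rule range_from_nat_into[OF \<open>P \<noteq> {}\<close> P(1)])
  then have p: "p n \<in> carrier A" for n using P(2) by blast
  define f where "f n = h (p n)" for n
  define g where "g n q = f n q * (\<Prod>i<n. 1 - f i q)" for n q
  have f: "smooth_fun_on A (carrier A) (f n)" for n
    using hV[OF p] by (simp add: f_def C_inf_def)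
  have telescope: "(\<Sum>n<N. g n q) = 1 - (\<Prod>i<N. 1 - f i q)" for N q
    by (induction N) (simp_all add: g_def algebra_simps)
  show ?thesis
  proof (rule that[of "\<lambda>n. c (p n)" g "\<lambda>n. Z (p n)"])
    show "g n \<in> C_inf A" for n
      unfolding g_def C_inf_def mem_Collect_eq
      by (intro smooth_fun_on_mult smooth_fun_on_prod smooth_fun_on_diff smooth_fun_on_const f pre
          openin_carrier)
    show "g n q = 0" if "q \<notin> Z (p n)" for n q
      using hV[OF p] that by (simp add: g_def f_def)
    show "\<exists>W N. openin (atlas_topology A) W \<and> r \<in> W \<and>
        (\<forall>q\<in>W. (\<forall>n\<ge>N. g n q = 0) \<and> (\<Sum>n<N. g n q) = 1)" if r: "r \<in> carrier A" for r
    proof -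
      obtain m where m: "r \<in> V (p m)" using r \<V>(3) P(3) rp by blast
      have "f m q = 1" if "q \<in> V (p m)" for q using hV[OF p] that by (simp add: f_def)
      \<comment> \<open>The factor with index \<open>m\<close> vanishes on \<open>V (p m)\<close>.
        It occurs in the product once \<open>n\<close> is at least \<open>Suc m\<close>, so all
        later members are 0 there and the sum up to \<open>Suc m\<close> has reached 1.\<close>
      then have 0: "(\<Prod>i<n. 1 - f i q) = 0" if "q \<in> V (p m)" "n \<ge> Suc m" for n q
        using that by (intro prod_zero bexI[of _ m]) auto
      have "\<forall>q\<in>V (p m). (\<forall>n\<ge>Suc m. g n q = 0) \<and> (\<Sum>n<Suc m. g n q) = 1"
        unfolding telescope by (simp add: g_def 0 del: prod.lessThan_Suc prod_zero_iff)
      then show ?thesis using m hV[OF p] by blast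
    qed
  qed (use hV[OF p] in auto)
qed


section \<open>Tangent vectors\<close>

lemma smooth_fun_on_has_derivative:
  assumes A: "pre_manifold A" and c: "(D, \<phi>) \<in> A" and p: "p \<in> D" "p \<in> W"
    and f: "smooth_fun_on A W f"
  shows "((\<lambda>x. f (inv_into D \<phi> x)) has_derivative
      frechet_derivative (\<lambda>x. f (inv_into D \<phi> x)) (at (\<phi> p))) (at (\<phi> p))"
  by (rule smooth_on_has_derivative[OF smooth_fun_onD[OF f c]]) (use p in auto)

text \<open>Turns identities between tangent vectors into computations of derivatives: by uniqueness
  it is enough to exhibit a derivative of the chart representation of each test function.\<close>

lemma C_inf_has_derivative:
  assumes A: "pre_manifold A" and c: "(D, \<phi>) \<in> A" and p: "p \<in> D" and f: "f \<in> C_inf A"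
  shows "((\<lambda>x. f (inv_into D \<phi> x)) has_derivative L) (at (\<phi> p)) \<longleftrightarrow>
    L = (\<lambda>v. chart_vector A (D, \<phi>) p v f)"
proof -
  have *: "((\<lambda>x. f (inv_into D \<phi> x)) has_derivative (\<lambda>v. chart_vector A (D, \<phi>) p v f)) (at (\<phi> p))"
    using smooth_fun_on_has_derivative[OF A c p _ f[unfolded C_inf_def mem_Collect_eq]]
      chart_domain_carrier[OF c] p f by (auto simp: chart_vector_def)
  then show ?thesis using has_derivative_unique by blast
qed

lemma linear_chart_vector:
  assumes A: "pre_manifold A" and c: "(D, \<phi>) \<in> A" and p: "p \<in> D"
  shows "linear (chart_vector A (D, \<phi>) p)"
proof -
  have lin: "linear (\<lambda>v. chart_vector A (D, \<phi>) p v f)" for f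
  proof (cases "f \<in> C_inf A")
    case True
    then show ?thesis using C_inf_has_derivative[OF A c p True] has_derivative_linear by blast
  next
    case False
    then show ?thesis by (auto simp: chart_vector_def intro: linearI)
  qed
  show ?thesis
  proof (rule linearI)
    show "chart_vector A (D, \<phi>) p (v + w) = chart_vector A (D, \<phi>) p v + chart_vector A (D, \<phi>) p w" for v w
      by (rule ext) (simp add: linear_add[OF lin])
    show "chart_vector A (D, \<phi>) p (r *\<^sub>R v) = r *\<^sub>R chart_vector A (D, \<phi>) p v" for r v
      by (rule ext) (simp add: linear_cmul[OF lin] scaleR_fun_def)
  qed
qed

text \<open>Tangent vectors act on global functions, so separating them needs a global test
  function: the linear coordinate in direction \<open>v - w\<close>, cut off by a bump function.
  Applied to it, the two vectors differ by the square of the norm of \<open>v - w\<close>.\<close>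

lemma inj_chart_vector:
  assumes A: "smooth_manifold A" and c: "(D, \<phi>) \<in> A" and p: "p \<in> D"
  shows "inj (chart_vector A (D, \<phi>) p)"
proof (rule injI)
  fix v w assume eq: "chart_vector A (D, \<phi>) p v = chart_vector A (D, \<phi>) p w"
  have pre: "pre_manifold A" using A by simp
  have pc: "p \<in> carrier A" using p chart_domain_carrier[OF c] by blast
  have oD: "openin (atlas_topology A) D" by (rule openin_chart_domain[OF pre c])
  obtain h V Z where h: "h \<in> C_inf A" "openin (atlas_topology A) V" "p \<in> V" "\<And>q. q \<in> V \<Longrightarrow> h q = 1"
    "closedin (atlas_topology A) Z" "Z \<subseteq> carrier A \<inter> D" "\<And>q. q \<notin> Z \<Longrightarrow> h q = 0"
    by (rule bump_function_manifold[OF A c openin_carrier[OF pre] p pc]) blast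
  let ?u = "v - w"
  define f where "f q = h q *\<^sub>R inner (\<phi> q) ?u" for q
  have sm: "smooth_fun_on A (carrier A \<inter> D) (\<lambda>q. inner (\<phi> q) ?u)"
    by (rule smooth_fun_on_subset[of _ D])
      (auto intro!: smooth_fun_on_inner[OF pre oD] smooth_fun_on_chart[OF pre c] smooth_fun_on_const)
  have "smooth_fun_on A (carrier A) f"
    unfolding f_def
    by (rule smooth_fun_on_cutoff[OF pre openin_carrier[OF pre] oD _ h(5) _ h(7) sm])
      (use h(1,6) in \<open>auto simp: C_inf_def\<close>)
  then have f: "f \<in> C_inf A" by (simp add: C_inf_def)
  have o: "open (\<phi> ` (V \<inter> D))" by (rule open_chart_image[OF pre c h(2)])
  have "((\<lambda>x. inner x ?u) has_derivative (\<lambda>x. inner x ?u)) (at (\<phi> p))"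
    by (auto intro!: derivative_eq_intros)
  then have "((\<lambda>x. f (inv_into D \<phi> x)) has_derivative (\<lambda>x. inner x ?u)) (at (\<phi> p))"
    by (rule has_derivative_transform_within_open[OF _ o])
      (use p h(3,4) chart_inv[OF pre c] in \<open>auto simp: f_def\<close>)
  then have "chart_vector A (D, \<phi>) p x f = inner x ?u" for x
    using C_inf_has_derivative[OF pre c p f] by metis
  then have "inner v ?u = inner w ?u" using eq by metis
  then have "inner ?u ?u = 0" by (simp add: inner_diff_left)
  then show "v = w" by simp
qed

section \<open>Coordinate changes of tangent vectors\<close>

definition coord_change ::
  "('p, 'm::real_normed_vector) chart \<Rightarrow> ('p, 'm) chart \<Rightarrow> 'p \<Rightarrow> 'm \<Rightarrow> 'm"
  where "coord_change c c' p =
    frechet_derivative (\<lambda>x. snd c' (inv_into (fst c) (snd c) x)) (at (snd c p))"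

text \<open>Chain rule for a test function written in the second chart and composed with the
  transition map, whose Jacobian is \<open>coord_change\<close>.\<close>

lemma chart_vector_change:
  assumes A: "pre_manifold A" and c: "(D, \<phi>) \<in> A" "p \<in> D" and c': "(D', \<phi>') \<in> A" "p \<in> D'"
  shows "chart_vector A (D, \<phi>) p v = chart_vector A (D', \<phi>') p (coord_change (D, \<phi>) (D', \<phi>') p v)"
proof
  fix f
  show "chart_vector A (D, \<phi>) p v f = chart_vector A (D', \<phi>') p (coord_change (D, \<phi>) (D', \<phi>') p v) f"
  proof (cases "f \<in> C_inf A")
    case True
    have 1: "((\<lambda>x. \<phi>' (inv_into D \<phi> x)) has_derivative coord_change (D, \<phi>) (D', \<phi>') p) (at (\<phi> p))"
      using smooth_on_has_derivative[OF pre_manifold_transition(2)[OF A c(1) c'(1)], of "\<phi> p"] c(2) c'(2)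
      by (simp add: coord_change_def)
    have "((\<lambda>y. f (inv_into D' \<phi>' y)) has_derivative (\<lambda>v. chart_vector A (D', \<phi>') p v f))
        (at (\<phi>' (inv_into D \<phi> (\<phi> p))))"
      using C_inf_has_derivative[OF A c' True] chart_inv[OF A c] by simp
    then have "((\<lambda>x. f (inv_into D' \<phi>' (\<phi>' (inv_into D \<phi> x)))) has_derivative
        (\<lambda>v. chart_vector A (D', \<phi>') p (coord_change (D, \<phi>) (D', \<phi>') p v) f)) (at (\<phi> p))"
      by (rule has_derivative_compose[OF 1])
    then have "((\<lambda>x. f (inv_into D \<phi> x)) has_derivative
        (\<lambda>v. chart_vector A (D', \<phi>') p (coord_change (D, \<phi>) (D', \<phi>') p v) f)) (at (\<phi> p))"
      by (rule has_derivative_transform_within_open[OF _ pre_manifold_transition(1)[OF A c(1) c'(1)]])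
        (use c c' chart_inv[OF A c(1)] chart_inv[OF A c'(1)] in auto)
    then show ?thesis using C_inf_has_derivative[OF A c True] by metis
  qed (simp add: chart_vector_def)
qed

lemma tangent_space_eq:
  assumes A: "pre_manifold A" and c: "(D, \<phi>) \<in> A" "p \<in> D"
  shows "tangent_space A p = range (chart_vector A (D, \<phi>) p)"
proof
  show "range (chart_vector A (D, \<phi>) p) \<subseteq> tangent_space A p"
    using c by (force simp: tangent_space_def)
  show "tangent_space A p \<subseteq> range (chart_vector A (D, \<phi>) p)"
  proof
    fix X assume "X \<in> tangent_space A p"
    then obtain D' \<phi>' v where "(D', \<phi>') \<in> A" "p \<in> D'" "X = chart_vector A (D', \<phi>') p v"
      by (auto simp: tangent_space_def)
    then show "X \<in> range (chart_vector A (D, \<phi>) p)"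
      using chart_vector_change[OF A _ _ c] by blast
  qed
qed

context
  fixes A :: "('p, 'm::fin_dim_inner) atlas" and D \<phi> p
  assumes A: "smooth_manifold A" and c: "(D, \<phi>) \<in> A" "p \<in> D"
begin

lemma components_chart_vector: "components A (D, \<phi>) p (chart_vector A (D, \<phi>) p v) = v"
  unfolding components_def using inj_chart_vector[OF A c] by (auto dest: injD)

lemma chart_vector_in_tangent_space: "chart_vector A (D, \<phi>) p v \<in> tangent_space A p"
  using tangent_space_eq[OF _ c] A by simp

lemma chart_vector_components:
  "X \<in> tangent_space A p \<Longrightarrow> chart_vector A (D, \<phi>) p (components A (D, \<phi>) p X) = X"
  using tangent_space_eq[OF _ c] A components_chart_vector by fastforce

lemma bij_components: "bij_betw (components A (D, \<phi>) p) (tangent_space A p) UNIV"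
  by (rule bij_betw_byWitness[where f' = "chart_vector A (D, \<phi>) p"])
    (auto simp: components_chart_vector chart_vector_components chart_vector_in_tangent_space)

lemma subspace_tangent_space: "subspace (tangent_space A p)"
  using tangent_space_eq[OF _ c] linear_subspace_image[OF linear_chart_vector[OF _ c] subspace_UNIV] A
  by simp

lemma linear_on_components: "linear_on (tangent_space A p) (components A (D, \<phi>) p)"
  unfolding linear_on_def
proof (intro ballI allI)
  fix X Y a b assume "X \<in> tangent_space A p" "Y \<in> tangent_space A p"
  then obtain v w where "X = chart_vector A (D, \<phi>) p v" "Y = chart_vector A (D, \<phi>) p w"
    using tangent_space_eq[OF _ c] A by auto
  moreover have "linear (chart_vector A (D, \<phi>) p)" using linear_chart_vector[OF _ c] A by simp
  ultimately have "a *\<^sub>R X + b *\<^sub>R Y = chart_vector A (D, \<phi>) p (a *\<^sub>R v + b *\<^sub>R w)"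
    by (simp add: linear_add linear_cmul)
  with \<open>X = _\<close> \<open>Y = _\<close> show "components A (D, \<phi>) p (a *\<^sub>R X + b *\<^sub>R Y) =
      a *\<^sub>R components A (D, \<phi>) p X + b *\<^sub>R components A (D, \<phi>) p Y"
    by (simp add: components_chart_vector)
qed

lemma inv_into_components:
  "inv_into (tangent_space A p) (components A (D, \<phi>) p) v = chart_vector A (D, \<phi>) p v"
  by (intro inv_into_f_eq bij_betw_imp_inj_on[OF bij_components] chart_vector_in_tangent_space
        components_chart_vector)

end

lemma components_change:
  assumes A: "smooth_manifold A" and c: "(D, \<phi>) \<in> A" "p \<in> D" and c': "(D', \<phi>') \<in> A" "p \<in> D'"
  shows "components A (D', \<phi>') p (chart_vector A (D, \<phi>) p v) = coord_change (D, \<phi>) (D', \<phi>') p v"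
  using chart_vector_change[OF _ c c'] components_chart_vector[OF A c'] A by simp

lemma smooth_coord_change:
  assumes A: "pre_manifold A" and c: "(D, \<phi>) \<in> A" and c': "(D', \<phi>') \<in> A"
    and W: "openin (atlas_topology A) W" "W \<subseteq> D \<inter> D'" and v: "smooth_fun_on A W v"
  shows "smooth_fun_on A W (\<lambda>p. coord_change (D, \<phi>) (D', \<phi>') p (v p))"
  unfolding coord_change_def fst_conv snd_conv
  by (rule smooth_fun_on_chart_derivative[OF A W(1) c _ smooth_fun_on_subset[OF smooth_fun_on_chart[OF A c']] v])
    (use W(2) in auto)

lemma vector_bundle_tangent_bundle:
  assumes A: "smooth_manifold A"
  shows "vector_bundle (tangent_bundle A)"
  unfolding vector_bundle_def
proof (intro conjI)
  have pre: "pre_manifold A" using A by simp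
  show "smooth_manifold (base (tangent_bundle A))" using A by (simp add: tangent_bundle_def)
  show "\<forall>q\<in>carrier (base (tangent_bundle A)). subspace (fiber (tangent_bundle A) q)"
    by (auto simp: tangent_bundle_def elim!: in_carrierE intro: subspace_tangent_space[OF A])
  show "(\<Union>(U, \<psi>)\<in>trivs (tangent_bundle A). U) = carrier (base (tangent_bundle A))"
    by (auto simp: tangent_bundle_def carrier_def)
  show "\<forall>(U, \<psi>)\<in>trivs (tangent_bundle A). openin (atlas_topology (base (tangent_bundle A))) U \<and>
      (\<forall>q\<in>U. linear_on (fiber (tangent_bundle A) q) (\<psi> q) \<and>
        bij_betw (\<psi> q) (fiber (tangent_bundle A) q) UNIV)"
    by (auto simp: tangent_bundle_def openin_chart_domain[OF pre] linear_on_components[OF A] bij_components[OF A])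
  show "\<forall>(U, \<psi>)\<in>trivs (tangent_bundle A). \<forall>(U', \<psi>')\<in>trivs (tangent_bundle A). \<forall>v.
      smooth_fun_on (base (tangent_bundle A)) (U \<inter> U')
        (\<lambda>q. \<psi>' q (inv_into (fiber (tangent_bundle A) q) (\<psi> q) v))"
  proof -
    have "smooth_fun_on A (D \<inter> D') (\<lambda>q. components A (D', \<phi>') q (inv_into (tangent_space A q) (components A (D, \<phi>) q) v))"
      if c: "(D, \<phi>) \<in> A" and c': "(D', \<phi>') \<in> A" for D \<phi> D' \<phi>' v
    proof -
      have o: "openin (atlas_topology A) (D \<inter> D')"
        using openin_chart_domain[OF pre c] openin_chart_domain[OF pre c'] by (rule openin_Int)
      show ?thesis
        by (rule smooth_fun_on_cong[OF pre o, THEN iffD1, rotated,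
              OF smooth_coord_change[OF pre c c' o subset_refl smooth_fun_on_const[of _ _ v]]])
          (use c c' in \<open>auto simp: inv_into_components[OF A] components_change[OF A]\<close>)
    qed
    then show ?thesis by (auto simp: tangent_bundle_def)
  qed
qed


section \<open>Vector bundles\<close>

lemma linear_onD:
  assumes "linear_on S f" "x \<in> S" "y \<in> S"
  shows "f (a *\<^sub>R x + b *\<^sub>R y) = a *\<^sub>R f x + b *\<^sub>R f y"
  using assms unfolding linear_on_def by blast

lemma linear_on_scaleR:
  assumes "linear_on S f" "x \<in> S"
  shows "f (a *\<^sub>R x) = a *\<^sub>R f x"
  using linear_onD[OF assms assms(2), of a 0] by simp

lemma linear_on_plus:
  assumes "linear_on S f" "x \<in> S" "y \<in> S"
  shows "f (x + y) = f x + f y"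
  using linear_onD[OF assms, of 1 1] by simp

lemma linear_on_zero:
  assumes "linear_on S f" "x \<in> S"
  shows "f 0 = 0"
  using linear_on_scaleR[OF assms, of 0] by simp

abbreviation triv_inv where "triv_inv V \<psi> q \<equiv> inv_into (fiber V q) (\<psi> q)"

context
  fixes V :: "('q, 'm::fin_dim_inner, 'v::real_vector, 'k::fin_dim_inner) vbundle"
  assumes V: "vector_bundle V"
begin

lemma vector_bundle_base: "smooth_manifold (base V)" "pre_manifold (base V)"
  using V by (auto simp: vector_bundle_def)

lemma vector_bundle_subspace: "q \<in> carrier (base V) \<Longrightarrow> subspace (fiber V q)"
  using V by (auto simp: vector_bundle_def)

lemma vector_bundle_triv_ex:
  assumes "q \<in> carrier (base V)"
  obtains U \<psi> where "(U, \<psi>) \<in> trivs V" "q \<in> U"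
proof -
  have "q \<in> (\<Union>(U, \<psi>)\<in>trivs V. U)" using V assms unfolding vector_bundle_def by blast
  then show thesis using that by auto
qed

context
  fixes U \<psi>
  assumes t: "(U, \<psi>) \<in> trivs V"
begin

lemma triv_domain: "openin (atlas_topology (base V)) U" "U \<subseteq> carrier (base V)"
proof -
  show "openin (atlas_topology (base V)) U" using V t unfolding vector_bundle_def by blast
  then show "U \<subseteq> carrier (base V)"
    using openin_subset topspace_atlas_topology[OF vector_bundle_base(2)] by metis
qed

lemma triv_linear_on: "q \<in> U \<Longrightarrow> linear_on (fiber V q) (\<psi> q)"
  and triv_bij: "q \<in> U \<Longrightarrow> bij_betw (\<psi> q) (fiber V q) UNIV"
  using V t unfolding vector_bundle_def by blast+

lemma triv_inv_in: "q \<in> U \<Longrightarrow> triv_inv V \<psi> q y \<in> fiber V q"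
  using triv_bij by (metis UNIV_I bij_betw_imp_surj_on inv_into_into)

lemma triv_inv_right: "q \<in> U \<Longrightarrow> \<psi> q (triv_inv V \<psi> q y) = y"
  using triv_bij by (metis UNIV_I bij_betw_inv_into_right)

lemma triv_inv_left: "q \<in> U \<Longrightarrow> v \<in> fiber V q \<Longrightarrow> triv_inv V \<psi> q (\<psi> q v) = v"
  using triv_bij by (metis bij_betw_inv_into_left)

lemma triv_inj: "q \<in> U \<Longrightarrow> v \<in> fiber V q \<Longrightarrow> w \<in> fiber V q \<Longrightarrow> \<psi> q v = \<psi> q w \<Longrightarrow> v = w"
  using triv_inv_left by metis

lemma linear_triv_inv:
  assumes q: "q \<in> U"
  shows "linear (triv_inv V \<psi> q)"
proof -
  have sub: "subspace (fiber V q)" using vector_bundle_subspace triv_domain(2) q by blast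
  note lin = triv_linear_on[OF q] and inn = triv_inv_in[OF q] and rt = triv_inv_right[OF q]
  show ?thesis
  proof (rule linearI)
    show "triv_inv V \<psi> q (y + z) = triv_inv V \<psi> q y + triv_inv V \<psi> q z" for y z
      by (rule triv_inj[OF q]) (simp_all add: rt inn subspace_add[OF sub] linear_on_plus[OF lin])
    show "triv_inv V \<psi> q (r *\<^sub>R y) = r *\<^sub>R triv_inv V \<psi> q y" for r y
      by (rule triv_inj[OF q]) (simp_all add: rt inn subspace_scale[OF sub] linear_on_scaleR[OF lin])
  qed
qed

end

lemma linear_on_triv_inv:
  assumes t: "(U, \<psi>) \<in> trivs V" and q: "q \<in> U" and f: "linear_on (fiber V q) f"
  shows "linear (\<lambda>y. f (triv_inv V \<psi> q y))"
  using linear_triv_inv[OF t q] triv_inv_in[OF t q]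
  by (intro linearI) (simp_all add: linear_add linear_cmul linear_on_plus[OF f] linear_on_scaleR[OF f])

lemma smooth_transition_const:
  assumes t: "(U, \<psi>) \<in> trivs V" and t': "(U', \<psi>') \<in> trivs V"
  shows "smooth_fun_on (base V) (U \<inter> U') (\<lambda>q. \<psi>' q (triv_inv V \<psi> q y))"
  using V t t' unfolding vector_bundle_def by blast

end


section \<open>Total spaces, sections and morphisms\<close>

lemma smooth_mapI:
  assumes "F ` carrier A \<subseteq> carrier A'"
    and "\<And>D \<phi> D' \<phi>'. (D, \<phi>) \<in> A \<Longrightarrow> (D', \<phi>') \<in> A' \<Longrightarrow> open (\<phi> ` (D \<inter> F -` D')) \<and>
      smooth_on (\<phi> ` (D \<inter> F -` D')) (\<lambda>x. \<phi>' (F (inv_into D \<phi> x)))"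
  shows "smooth_map A A' F"
  unfolding smooth_map_def using assms by blast

lemma smooth_mapD:
  assumes "smooth_map A A' F" "(D, \<phi>) \<in> A" "(D', \<phi>') \<in> A'"
  shows "smooth_on (\<phi> ` (D \<inter> F -` D')) (\<lambda>x. \<phi>' (F (inv_into D \<phi> x)))"
  using assms unfolding smooth_map_def by blast

definition chart_dom :: "('q \<Rightarrow> 'v set) \<Rightarrow> 'q set \<Rightarrow> ('q \<times> 'v) set"
  where "chart_dom F W = {(q, v). q \<in> W \<and> v \<in> F q}"

lemma chart_dom_iff [simp]: "(q, v) \<in> chart_dom F W \<longleftrightarrow> q \<in> W \<and> v \<in> F q"
  by (simp add: chart_dom_def)

definition chart_map :: "('q \<Rightarrow> 'm) \<Rightarrow> ('q \<Rightarrow> 'v \<Rightarrow> 'k) \<Rightarrow> 'q \<times> 'v \<Rightarrow> 'm \<times> 'k"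
  where "chart_map \<phi> \<psi> = (\<lambda>(q, v). (\<phi> q, \<psi> q v))"

lemma chart_map_apply [simp]: "chart_map \<phi> \<psi> (q, v) = (\<phi> q, \<psi> q v)"
  by (simp add: chart_map_def)

lemma bundle_chart_eq: "bundle_chart F (D, \<phi>) (U, \<psi>) = (chart_dom F (D \<inter> U), chart_map \<phi> \<psi>)"
  by (simp add: bundle_chart_def chart_dom_def chart_map_def)

lemma in_total_atlas_iff:
  "(C, \<Phi>) \<in> total_atlas V \<longleftrightarrow> (\<exists>D \<phi> U \<psi>. (D, \<phi>) \<in> base V \<and> (U, \<psi>) \<in> trivs V \<and>
    C = chart_dom (fiber V) (D \<inter> U) \<and> \<Phi> = chart_map \<phi> \<psi>)"
  unfolding total_atlas_def mem_Collect_eq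
  by (simp only: split_paired_Ex bundle_chart_eq prod.inject) blast

lemma total_atlasI:
  "(D, \<phi>) \<in> base V \<Longrightarrow> (U, \<psi>) \<in> trivs V \<Longrightarrow>
    (chart_dom (fiber V) (D \<inter> U), chart_map \<phi> \<psi>) \<in> total_atlas V"
  by (auto simp: in_total_atlas_iff)

context
  fixes V :: "('q, 'm::fin_dim_inner, 'v::real_vector, 'k::fin_dim_inner) vbundle"
  assumes V: "vector_bundle V"
begin

lemma carrier_total_atlas: "carrier (total_atlas V) = chart_dom (fiber V) (carrier (base V))"
proof
  show "carrier (total_atlas V) \<subseteq> chart_dom (fiber V) (carrier (base V))"
  proof
    fix p assume "p \<in> carrier (total_atlas V)"
    then obtain C \<Phi> where "(C, \<Phi>) \<in> total_atlas V" "p \<in> C" by (rule in_carrierE)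
    then obtain D \<phi> U where "(D, \<phi>) \<in> base V" "p \<in> chart_dom (fiber V) (D \<inter> U)"
      unfolding in_total_atlas_iff by blast
    then show "p \<in> chart_dom (fiber V) (carrier (base V))"
      using chart_domain_carrier by (cases p) fastforce
  qed
  show "chart_dom (fiber V) (carrier (base V)) \<subseteq> carrier (total_atlas V)"
  proof clarify
    fix q v assume "(q, v) \<in> chart_dom (fiber V) (carrier (base V))"
    then have q: "q \<in> carrier (base V)" and v: "v \<in> fiber V q" by auto
    obtain D \<phi> where c: "(D, \<phi>) \<in> base V" "q \<in> D" using q by (rule in_carrierE)
    obtain U \<psi> where t: "(U, \<psi>) \<in> trivs V" "q \<in> U" using vector_bundle_triv_ex[OF V q] by blast
    show "(q, v) \<in> carrier (total_atlas V)"
      using chart_domain_carrier[OF total_atlasI[OF c(1) t(1)]] c t v by auto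
  qed
qed

context
  fixes D \<phi> U \<psi>
  assumes c: "(D, \<phi>) \<in> base V" and t: "(U, \<psi>) \<in> trivs V"
begin

lemma inj_on_chart_map: "inj_on (chart_map \<phi> \<psi>) (chart_dom (fiber V) (D \<inter> U))"
proof (rule inj_onI, clarify)
  fix q v q' v'
  assume a: "(q, v) \<in> chart_dom (fiber V) (D \<inter> U)" "(q', v') \<in> chart_dom (fiber V) (D \<inter> U)"
    and eq: "chart_map \<phi> \<psi> (q, v) = chart_map \<phi> \<psi> (q', v')"
  then have "q = q'"
    using inj_onD[OF pre_manifold_chart(1)[OF vector_bundle_base(2)[OF V] c]] by simp
  then show "q = q' \<and> v = v'" using a eq triv_inj[OF V t, of q v v'] by simp
qed

lemma chart_map_image:
  assumes "W \<subseteq> D \<inter> U"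
  shows "chart_map \<phi> \<psi> ` chart_dom (fiber V) W = \<phi> ` W \<times> UNIV"
proof
  show "chart_map \<phi> \<psi> ` chart_dom (fiber V) W \<subseteq> \<phi> ` W \<times> UNIV" by auto
  show "\<phi> ` W \<times> UNIV \<subseteq> chart_map \<phi> \<psi> ` chart_dom (fiber V) W"
  proof clarify
    fix q y assume q: "q \<in> W"
    then have "q \<in> U" using assms by blast
    then show "(\<phi> q, y) \<in> chart_map \<phi> \<psi> ` chart_dom (fiber V) W"
      using q triv_inv_in[OF V t] triv_inv_right[OF V t]
      by (intro image_eqI[of _ _ "(q, triv_inv V \<psi> q y)"]) auto
  qed
qed

lemma inv_chart_map:
  assumes "q \<in> D \<inter> U"
  shows "inv_into (chart_dom (fiber V) (D \<inter> U)) (chart_map \<phi> \<psi>) (\<phi> q, y) = (q, triv_inv V \<psi> q y)"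
  using assms triv_inv_in[OF V t] triv_inv_right[OF V t]
  by (intro inv_into_f_eq[OF inj_on_chart_map]) auto

end

end

lemma smooth_on_comp_fst:
  fixes S :: "'a::fin_dim_inner set"
  assumes "open S" "smooth_on S f"
  shows "smooth_on (S \<times> (UNIV :: 'b::fin_dim_inner set)) (\<lambda>z. f (fst z))"
  by (rule smooth_on_compose[OF assms(2)])
    (auto intro!: smooth_on_bounded_linear bounded_linear_fst open_Times assms(1))

text \<open>The identity morphism is the case that yields the smooth structure of the total space.\<close>

lemma morphism_in_charts:
  fixes V :: "('q, 'm::fin_dim_inner, 'v::real_vector, 'k::fin_dim_inner) vbundle"
    and W :: "('q, 'm, 'w::real_vector, 'l::fin_dim_inner) vbundle"
  assumes V: "vector_bundle V" and W: "vector_bundle W" and b: "base V = base W"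
    and h: "\<And>q. q \<in> carrier (base V) \<Longrightarrow> linear_on (fiber V q) (h q) \<and> h q ` fiber V q \<subseteq> fiber W q"
    and c: "(D, \<phi>) \<in> base V" and t: "(U, \<psi>) \<in> trivs V"
    and c': "(D', \<phi>') \<in> base V" and t': "(U', \<psi>') \<in> trivs W"
    and sm: "\<And>y. smooth_fun_on (base V) (U \<inter> U') (\<lambda>q. \<psi>' q (h q (triv_inv V \<psi> q y)))"
  defines "S \<equiv> chart_dom (fiber V) (D \<inter> U) \<inter> (\<lambda>(q, v). (q, h q v)) -` chart_dom (fiber W) (D' \<inter> U')"
  shows "open (chart_map \<phi> \<psi> ` S)"
    and "smooth_on (chart_map \<phi> \<psi> ` S) (\<lambda>z. chart_map \<phi>' \<psi>'
      ((\<lambda>(q, v). (q, h q v)) (inv_into (chart_dom (fiber V) (D \<inter> U)) (chart_map \<phi> \<psi>) z)))"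
proof -
  note pre = vector_bundle_base(2)[OF V]
  let ?W = "D \<inter> U \<inter> (D' \<inter> U')"
  have oW: "openin (atlas_topology (base V)) ?W"
    using openin_chart_domain[OF pre c] openin_chart_domain[OF pre c'] triv_domain(1)[OF V t]
      triv_domain(1)[OF W t', folded b] by (intro openin_Int)
  have UV: "U \<subseteq> carrier (base V)" by (rule triv_domain(2)[OF V t])
  \<comment> \<open>Because \<open>h\<close> maps fibres into fibres, membership of the image in the
    target chart only constrains the base point.\<close>
  have "S = chart_dom (fiber V) ?W"
    unfolding S_def using UV h by (auto simp: chart_dom_def)
  then have im: "chart_map \<phi> \<psi> ` S = \<phi> ` ?W \<times> UNIV"
    using chart_map_image[OF V c t, of ?W] by auto
  have "?W \<inter> D = ?W" by blast
  then have o': "open (\<phi> ` ?W)" using open_chart_image[OF pre c oW] by simp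
  then show o: "open (chart_map \<phi> \<psi> ` S)" unfolding im by (intro open_Times) auto
  let ?q = "\<lambda>z. inv_into D \<phi> (fst z)"
  have 1: "smooth_on (\<phi> ` ?W) (\<lambda>x. \<phi>' (inv_into D \<phi> x))"
    by (rule smooth_on_subset[OF pre_manifold_transition(2)[OF pre c c']]) auto
  have 2: "smooth_on (\<phi> ` ?W) (\<lambda>x. \<psi>' (inv_into D \<phi> x) (h (inv_into D \<phi> x) (triv_inv V \<psi> (inv_into D \<phi> x) y)))" for y
    by (rule smooth_on_subset[OF smooth_fun_onD[OF sm[of y] c]]) auto
  \<comment> \<open>Linearity in the fibre variable turns joint smoothness into smoothness in the
    base of the finitely many values at basis vectors, which is what \<open>sm\<close>
    supplies.\<close>
  have "smooth_on (\<phi> ` ?W \<times> UNIV) (\<lambda>z. (\<phi>' (?q z),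
      \<Sum>b\<in>onb. inner (snd z) b *\<^sub>R \<psi>' (?q z) (h (?q z) (triv_inv V \<psi> (?q z) b))))"
    by (intro smooth_on_Pair smooth_on_sum smooth_on_scaleR smooth_on_inner smooth_on_const
        smooth_on_comp_fst[OF o' 1] smooth_on_comp_fst[OF o' 2] o[unfolded im]
        smooth_on_bounded_linear[OF bounded_linear_snd])
  then show "smooth_on (chart_map \<phi> \<psi> ` S) (\<lambda>z. chart_map \<phi>' \<psi>'
      ((\<lambda>(q, v). (q, h q v)) (inv_into (chart_dom (fiber V) (D \<inter> U)) (chart_map \<phi> \<psi>) z)))"
    unfolding im
  proof (rule smooth_on_cong[OF o[unfolded im], THEN iffD1, rotated])
    fix z assume "z \<in> \<phi> ` ?W \<times> (UNIV :: 'k set)"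
    then obtain q y where z: "z = (\<phi> q, y)" and q: "q \<in> ?W" by (cases z) auto
    then have qc: "q \<in> carrier (base V)" using UV by blast
    have hq: "h q (triv_inv V \<psi> q y) \<in> fiber W q" for y
      using h[OF qc] triv_inv_in[OF V t] q by blast
    have "linear_on (fiber V q) (\<lambda>v. \<psi>' q (h q v))"
      unfolding linear_on_def
    proof (intro ballI allI)
      fix v w a b assume "v \<in> fiber V q" "w \<in> fiber V q"
      then show "\<psi>' q (h q (a *\<^sub>R v + b *\<^sub>R w)) = a *\<^sub>R \<psi>' q (h q v) + b *\<^sub>R \<psi>' q (h q w)"
        using h[OF qc] linear_onD[of "fiber V q" "h q" v w a b] q
          linear_onD[OF triv_linear_on[OF W t'], of q "h q v" "h q w" a b] by auto
    qed
    then have "\<psi>' q (h q (triv_inv V \<psi> q y)) =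
        (\<Sum>b\<in>onb. inner y b *\<^sub>R \<psi>' q (h q (triv_inv V \<psi> q b)))"
      using q by (intro linear_onb_expand linear_on_triv_inv[OF V t]) auto
    then show "(\<phi>' (?q z), \<Sum>b\<in>onb. inner (snd z) b *\<^sub>R \<psi>' (?q z) (h (?q z) (triv_inv V \<psi> (?q z) b))) =
        chart_map \<phi>' \<psi>' ((\<lambda>(q, v). (q, h q v)) (inv_into (chart_dom (fiber V) (D \<inter> U)) (chart_map \<phi> \<psi>) z))"
      using q unfolding z by (simp add: inv_chart_map[OF V c t] chart_inv[OF pre c])
  qed
qed

lemma vb_morphismI:
  fixes V :: "('q, 'm::fin_dim_inner, 'v::real_vector, 'k::fin_dim_inner) vbundle"
    and W :: "('q, 'm, 'w::real_vector, 'l::fin_dim_inner) vbundle"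
  assumes V: "vector_bundle V" and W: "vector_bundle W" and b: "base V = base W"
    and h: "\<And>q. q \<in> carrier (base V) \<Longrightarrow> linear_on (fiber V q) (h q) \<and> h q ` fiber V q \<subseteq> fiber W q"
    and sm: "\<And>U \<psi> U' \<psi>' y. (U, \<psi>) \<in> trivs V \<Longrightarrow> (U', \<psi>') \<in> trivs W \<Longrightarrow>
      smooth_fun_on (base V) (U \<inter> U') (\<lambda>q. \<psi>' q (h q (triv_inv V \<psi> q y)))"
  shows "vb_morphism V W h"
  unfolding vb_morphism_def
proof (intro conjI ballI smooth_mapI[of _ "total_atlas V" "total_atlas W"])
  show "linear_on (fiber V q) (h q)" "h q ` fiber V q \<subseteq> fiber W q" if "q \<in> carrier (base V)" for q
    using h[OF that] by blast+
  have "h q v \<in> fiber W q" if "q \<in> carrier (base V)" "v \<in> fiber V q" for q v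
    using h[OF that(1)] that(2) by blast
  then show "(\<lambda>(q, v). (q, h q v)) ` carrier (total_atlas V) \<subseteq> carrier (total_atlas W)"
    by (auto simp: carrier_total_atlas[OF V] carrier_total_atlas[OF W] b)
  fix C \<Phi> C' \<Phi>' assume "(C, \<Phi>) \<in> total_atlas V" "(C', \<Phi>') \<in> total_atlas W"
  then obtain D \<phi> U \<psi> D' \<phi>' U' \<psi>' where C: "(D, \<phi>) \<in> base V" "(U, \<psi>) \<in> trivs V"
    "(D', \<phi>') \<in> base V" "(U', \<psi>') \<in> trivs W"
    "C = chart_dom (fiber V) (D \<inter> U)" "\<Phi> = chart_map \<phi> \<psi>"
    "C' = chart_dom (fiber W) (D' \<inter> U')" "\<Phi>' = chart_map \<phi>' \<psi>'"
    by (auto simp: in_total_atlas_iff b)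
  show "open (\<Phi> ` (C \<inter> (\<lambda>(q, v). (q, h q v)) -` C'))"
    "smooth_on (\<Phi> ` (C \<inter> (\<lambda>(q, v). (q, h q v)) -` C'))
      (\<lambda>x. \<Phi>' ((\<lambda>(q, v). (q, h q v)) (inv_into C \<Phi> x)))"
    unfolding C(5-8) using morphism_in_charts[OF V W b h C(1-4) sm[OF C(2,4)]] by blast+
qed (fact b)

lemma pre_manifold_total_atlas:
  assumes V: "vector_bundle V"
  shows "pre_manifold (total_atlas V)"
proof -
  have id: "(\<lambda>(q, v). (q, v)) = (\<lambda>z. z)" by auto
  have 1: "inj_on \<Phi> C \<and> open (\<Phi> ` C)" if C: "(C, \<Phi>) \<in> total_atlas V" for C \<Phi>
  proof -
    obtain D \<phi> U \<psi> where c: "(D, \<phi>) \<in> base V" "(U, \<psi>) \<in> trivs V"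
      "C = chart_dom (fiber V) (D \<inter> U)" "\<Phi> = chart_map \<phi> \<psi>" using C by (auto simp: in_total_atlas_iff)
    have "open (\<phi> ` (U \<inter> D))"
      by (rule open_chart_image[OF vector_bundle_base(2)[OF V] c(1) triv_domain(1)[OF V c(2)]])
    then show ?thesis
      unfolding c(3,4) using inj_on_chart_map[OF V c(1,2)] chart_map_image[OF V c(1,2) subset_refl]
      by (auto simp: Int_commute intro: open_Times)
  qed
  have 2: "open (\<Phi> ` (C \<inter> C')) \<and> smooth_on (\<Phi> ` (C \<inter> C')) (\<lambda>x. \<Phi>' (inv_into C \<Phi> x))"
    if C: "(C, \<Phi>) \<in> total_atlas V" and C': "(C', \<Phi>') \<in> total_atlas V" for C \<Phi> C' \<Phi>'
  proof -
    obtain D \<phi> U \<psi> where c: "(D, \<phi>) \<in> base V" "(U, \<psi>) \<in> trivs V"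
      "C = chart_dom (fiber V) (D \<inter> U)" "\<Phi> = chart_map \<phi> \<psi>" using C by (auto simp: in_total_atlas_iff)
    obtain D' \<phi>' U' \<psi>' where c': "(D', \<phi>') \<in> base V" "(U', \<psi>') \<in> trivs V"
      "C' = chart_dom (fiber V) (D' \<inter> U')" "\<Phi>' = chart_map \<phi>' \<psi>'" using C' by (auto simp: in_total_atlas_iff)
    have h: "linear_on (fiber V q) (\<lambda>v. v) \<and> (\<lambda>v. v) ` fiber V q \<subseteq> fiber V q" for q
      by (auto simp: linear_on_def)
    show ?thesis
      using morphism_in_charts[OF V V refl h c(1,2) c'(1,2) smooth_transition_const[OF V c(2) c'(2)]]
      unfolding c(3,4) c'(3,4) id by simp
  qed
  show ?thesis unfolding pre_manifold_def using 1 2 by blast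
qed

section \<open>Smooth functions, topology and sections of the total space\<close>

context
  fixes V :: "('q, 'm::fin_dim_inner, 'v::real_vector, 'k::fin_dim_inner) vbundle"
  assumes V: "vector_bundle V"
begin

lemma smooth_fun_on_total_atlasI:
  assumes W: "W \<subseteq> carrier (base V)"
    and "\<And>D \<phi> U \<psi>. (D, \<phi>) \<in> base V \<Longrightarrow> (U, \<psi>) \<in> trivs V \<Longrightarrow>
      smooth_on (\<phi> ` (W \<inter> D \<inter> U) \<times> UNIV) (\<lambda>z. f (inv_into D \<phi> (fst z), triv_inv V \<psi> (inv_into D \<phi> (fst z)) (snd z)))"
    and oW: "openin (atlas_topology (base V)) W"
  shows "smooth_fun_on (total_atlas V) (chart_dom (fiber V) W) f"
proof (rule smooth_fun_onI)
  fix C \<Phi> assume "(C, \<Phi>) \<in> total_atlas V"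
  then obtain D \<phi> U \<psi> where c: "(D, \<phi>) \<in> base V" "(U, \<psi>) \<in> trivs V"
      "C = chart_dom (fiber V) (D \<inter> U)" "\<Phi> = chart_map \<phi> \<psi>" by (auto simp: in_total_atlas_iff)
  note pre = vector_bundle_base(2)[OF V]
  have int: "chart_dom (fiber V) W \<inter> C = chart_dom (fiber V) (W \<inter> D \<inter> U)"
    unfolding c by (auto simp: chart_dom_def)
  have im: "\<Phi> ` (chart_dom (fiber V) W \<inter> C) = \<phi> ` (W \<inter> D \<inter> U) \<times> UNIV"
    unfolding int c(4) by (rule chart_map_image[OF V c(1,2)]) auto
  have "openin (atlas_topology (base V)) (W \<inter> U)" using oW triv_domain(1)[OF V c(2)] by (rule openin_Int)
  then have "open (\<phi> ` (W \<inter> U \<inter> D))" by (rule open_chart_image[OF pre c(1)])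
  then have o: "open (\<phi> ` (W \<inter> D \<inter> U) \<times> (UNIV::'k set))"
    by (metis Int_assoc Int_commute open_Times open_UNIV)
  show "smooth_on (\<Phi> ` (chart_dom (fiber V) W \<inter> C)) (\<lambda>x. f (inv_into C \<Phi> x))"
    unfolding im
    by (rule smooth_on_cong[OF o, THEN iffD1, rotated, OF assms(2)[OF c(1,2)]])
      (auto simp: c inv_chart_map[OF V c(1,2)] chart_inv[OF pre c(1)])
qed

lemma smooth_fun_on_pullback:
  assumes W: "openin (atlas_topology (base V)) W" and f: "smooth_fun_on (base V) W f"
  shows "smooth_fun_on (total_atlas V) (chart_dom (fiber V) W) (\<lambda>p. f (fst p))"
proof (rule smooth_fun_on_total_atlasI[OF _ _ W])
  note pre = vector_bundle_base(2)[OF V]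
  show "W \<subseteq> carrier (base V)" using openin_subset[OF W] topspace_atlas_topology[OF pre] by simp
  fix D \<phi> U \<psi> assume c: "(D, \<phi>) \<in> base V" "(U, \<psi>) \<in> trivs V"
  have "openin (atlas_topology (base V)) (W \<inter> U)" using W triv_domain(1)[OF V c(2)] by (rule openin_Int)
  then have "open (\<phi> ` (W \<inter> U \<inter> D))" by (rule open_chart_image[OF pre c(1)])
  then have o: "open (\<phi> ` (W \<inter> D \<inter> U))"
    by (metis Int_assoc Int_commute)
  have "smooth_on (\<phi> ` (W \<inter> D \<inter> U)) (\<lambda>x. f (inv_into D \<phi> x))"
    by (rule smooth_on_subset[OF smooth_fun_onD[OF f c(1)]]) auto
  then show "smooth_on (\<phi> ` (W \<inter> D \<inter> U) \<times> (UNIV::'k set))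
      (\<lambda>z. f (fst (inv_into D \<phi> (fst z), triv_inv V \<psi> (inv_into D \<phi> (fst z)) (snd z))))"
    using smooth_on_comp_fst[OF o] by simp
qed

lemma openin_chart_dom:
  assumes W: "openin (atlas_topology (base V)) W"
  shows "openin (atlas_topology (total_atlas V)) (chart_dom (fiber V) W)"
  unfolding openin_atlas_topology[OF pre_manifold_total_atlas[OF V]]
proof (intro conjI allI impI)
  note pre = vector_bundle_base(2)[OF V]
  have "W \<subseteq> carrier (base V)" using openin_subset[OF W] topspace_atlas_topology[OF pre] by simp
  then show "chart_dom (fiber V) W \<subseteq> carrier (total_atlas V)"
    unfolding carrier_total_atlas[OF V] by (auto simp: chart_dom_def)
  fix C \<Phi> assume "(C, \<Phi>) \<in> total_atlas V"
  then obtain D \<phi> U \<psi> where c: "(D, \<phi>) \<in> base V" "(U, \<psi>) \<in> trivs V"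
      "C = chart_dom (fiber V) (D \<inter> U)" "\<Phi> = chart_map \<phi> \<psi>" by (auto simp: in_total_atlas_iff)
  have int: "chart_dom (fiber V) W \<inter> C = chart_dom (fiber V) (W \<inter> U \<inter> D)"
    unfolding c by (auto simp: chart_dom_def)
  have im: "\<Phi> ` (chart_dom (fiber V) W \<inter> C) = \<phi> ` (W \<inter> U \<inter> D) \<times> UNIV"
    unfolding int c(4) by (rule chart_map_image[OF V c(1,2)]) auto
  have "openin (atlas_topology (base V)) (W \<inter> U)" using W triv_domain(1)[OF V c(2)] by (rule openin_Int)
  then have "open (\<phi> ` (W \<inter> U \<inter> D))" by (rule open_chart_image[OF pre c(1)])
  then show "open (\<Phi> ` (chart_dom (fiber V) W \<inter> C))" unfolding im by (simp add: open_Times)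
qed

text \<open>Locally this is the second component of a bundle chart; the argument is local because
  \<open>U\<close> need not lie in a single chart of the base.\<close>

lemma smooth_fun_on_triv:
  assumes t: "(U, \<psi>) \<in> trivs V"
  shows "smooth_fun_on (total_atlas V) (chart_dom (fiber V) U) (\<lambda>p. \<psi> (fst p) (snd p))"
proof (rule smooth_fun_on_local[OF pre_manifold_total_atlas[OF V]])
  note pre = vector_bundle_base(2)[OF V]
  fix p assume "p \<in> chart_dom (fiber V) U"
  then obtain q v where p: "p = (q, v)" "q \<in> U" "v \<in> fiber V q" by (cases p) auto
  then have "q \<in> carrier (base V)" using triv_domain(2)[OF V t] by blast
  then obtain D \<phi> where c: "(D, \<phi>) \<in> base V" "q \<in> D" by (rule in_carrierE)
  let ?C = "chart_dom (fiber V) (D \<inter> U)"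
  have C: "(?C, chart_map \<phi> \<psi>) \<in> total_atlas V" by (rule total_atlasI[OF c(1) t])
  have o: "openin (atlas_topology (total_atlas V)) ?C"
    by (rule openin_chart_domain[OF pre_manifold_total_atlas[OF V] C])
  have "smooth_fun_on (total_atlas V) ?C (\<lambda>p. snd (chart_map \<phi> \<psi> p))"
    by (rule smooth_fun_on_snd[OF pre_manifold_total_atlas[OF V] o
          smooth_fun_on_chart[OF pre_manifold_total_atlas[OF V] C]])
  then have "smooth_fun_on (total_atlas V) ?C (\<lambda>p. \<psi> (fst p) (snd p))"
    by (simp add: chart_map_def case_prod_unfold)
  then show "\<exists>W'. openin (atlas_topology (total_atlas V)) W' \<and> p \<in> W' \<and>
      smooth_fun_on (total_atlas V) W' (\<lambda>p. \<psi> (fst p) (snd p))"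
    using o p c(2) by (intro exI[of _ ?C]) auto
qed

text \<open>Points over different base points are separated by sets pulled back from the base,
  points over the same base point inside one bundle chart. Second countability follows from
  countably many bundle charts.\<close>

lemma smooth_manifold_total_atlas: "smooth_manifold (total_atlas V)"
  unfolding smooth_manifold_iff
proof (intro conjI)
  note pre = vector_bundle_base(2)[OF V]
  show preV: "pre_manifold (total_atlas V)" by (rule pre_manifold_total_atlas[OF V])
  show "Hausdorff_space (atlas_topology (total_atlas V))"
    unfolding Hausdorff_space_def topspace_atlas_topology[OF preV] carrier_total_atlas[OF V]
  proof (intro allI impI, elim conjE)
    fix x y
    assume "x \<in> chart_dom (fiber V) (carrier (base V))" "y \<in> chart_dom (fiber V) (carrier (base V))"
      and "x \<noteq> y"
    moreover obtain q v q' v' where xy: "x = (q, v)" "y = (q', v')" by (cases x, cases y)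
    ultimately have ne: "\<not> (q = q' \<and> v = v')"
      and q: "q \<in> carrier (base V)" "q' \<in> carrier (base V)" and v: "v \<in> fiber V q" "v' \<in> fiber V q'"
      by auto
    show "\<exists>S T. openin (atlas_topology (total_atlas V)) S \<and> openin (atlas_topology (total_atlas V)) T \<and>
        x \<in> S \<and> y \<in> T \<and> disjnt S T"
    proof (cases "q = q'")
      case False
      have "Hausdorff_space (atlas_topology (base V))"
        using vector_bundle_base(1)[OF V] by (simp add: smooth_manifold_iff)
      then obtain S T where "openin (atlas_topology (base V)) S" "openin (atlas_topology (base V)) T"
        "q \<in> S" "q' \<in> T" "disjnt S T"
        unfolding Hausdorff_space_def topspace_atlas_topology[OF pre] using q False by metis
      then show ?thesis using openin_chart_dom v xy
        by (intro exI[of _ "chart_dom (fiber V) S"] exI[of _ "chart_dom (fiber V) T"])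
          (auto simp: disjnt_iff)
    next
      case True
      obtain D \<phi> where c: "(D, \<phi>) \<in> base V" "q \<in> D" using q(1) by (rule in_carrierE)
      obtain U \<psi> where t: "(U, \<psi>) \<in> trivs V" "q \<in> U" using vector_bundle_triv_ex[OF V q(1)] by blast
      have C: "(chart_dom (fiber V) (D \<inter> U), chart_map \<phi> \<psi>) \<in> total_atlas V" by (rule total_atlasI[OF c(1) t(1)])
      have "chart_map \<phi> \<psi> (q, v) \<noteq> chart_map \<phi> \<psi> (q', v')"
        using ne True triv_inj[OF V t] v by auto
      then obtain S T where "open S" "open T" "chart_map \<phi> \<psi> (q, v) \<in> S" "chart_map \<phi> \<psi> (q', v') \<in> T"
        "S \<inter> T = {}"
        using hausdorff by metis
      then show ?thesis
        using v c(2) t(2) True openin_chart_vimage[OF preV C]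
        by (intro exI[of _ "chart_dom (fiber V) (D \<inter> U) \<inter> chart_map \<phi> \<psi> -` S"]
            exI[of _ "chart_dom (fiber V) (D \<inter> U) \<inter> chart_map \<phi> \<psi> -` T"])
          (auto simp: xy disjnt_def simp del: chart_map_apply)
    qed
  qed
  show "second_countable (atlas_topology (total_atlas V))"
  proof -
    \<comment> \<open>The sets on which both a chart and a trivialisation are defined cover the
      base; since the base is Lindelof, countably many of these pairs suffice.\<close>
    let ?dom = "\<lambda>((D, \<phi>), (U, \<psi>)). D \<inter> U"
    let ?I = "base V \<times> trivs V"
    have "Lindelof_space (atlas_topology (base V))"
      using vector_bundle_base(1)[OF V] by (simp add: smooth_manifold_iff second_countable_imp_Lindelof_space)
    moreover have op: "\<forall>S\<in>?dom ` ?I. openin (atlas_topology (base V)) S"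
      using openin_chart_domain[OF pre] triv_domain(1)[OF V] by (auto intro!: openin_Int)
    moreover have "\<Union> (?dom ` ?I) = carrier (base V)"
    proof
      show "\<Union> (?dom ` ?I) \<subseteq> carrier (base V)"
        using chart_domain_carrier by fastforce
      show "carrier (base V) \<subseteq> \<Union> (?dom ` ?I)"
      proof
        fix q assume q: "q \<in> carrier (base V)"
        obtain D \<phi> where c: "(D, \<phi>) \<in> base V" "q \<in> D" using q(1) by (rule in_carrierE)
        obtain U \<psi> where t: "(U, \<psi>) \<in> trivs V" "q \<in> U" using vector_bundle_triv_ex[OF V q(1)] by blast
        show "q \<in> \<Union> (?dom ` ?I)" using c t by (intro UnionI[of "D \<inter> U"]) force+
      qed
    qed
    ultimately obtain \<V> where \<V>: "countable \<V>" "\<V> \<subseteq> ?dom ` ?I" "\<Union>\<V> = carrier (base V)"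
      unfolding Lindelof_space_def topspace_atlas_topology[OF pre] by meson
    obtain J where J: "countable J" "J \<subseteq> ?I" "\<V> = ?dom ` J"
      using countable_subset_image[THEN iffD1, OF conjI[OF \<V>(1,2)]] by blast
    let ?C = "(\<lambda>((D, \<phi>), (U, \<psi>)). (chart_dom (fiber V) (D \<inter> U), chart_map \<phi> \<psi>)) ` J"
    show ?thesis
    proof (rule second_countable_atlas_topology[OF preV, of ?C])
      show "?C \<subseteq> total_atlas V"
      proof
        fix C assume "C \<in> ?C"
        then obtain i where "i \<in> J" "C = (\<lambda>((D, \<phi>), (U, \<psi>)). (chart_dom (fiber V) (D \<inter> U), chart_map \<phi> \<psi>)) i" ..
        moreover obtain D \<phi> U \<psi> where "i = ((D, \<phi>), (U, \<psi>))" by (metis surj_pair)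
        ultimately show "C \<in> total_atlas V" using J(2) by (auto intro: total_atlasI)
      qed
      show "countable ?C" using J(1) by (rule countable_image)
      show "carrier (total_atlas V) \<subseteq> (\<Union>(D, \<phi>)\<in>?C. D)"
        unfolding carrier_total_atlas[OF V] \<V>(3)[symmetric] J(3) by (force simp: chart_dom_def)
    qed
  qed
qed

text \<open>In bundle charts a section has a base part, which is just a transition map, and a fibre
  part. Only the latter carries a condition, and it involves no chart of the base
  explicitly.\<close>

lemma sections_iff:
  "\<sigma> \<in> sections V \<longleftrightarrow> (\<forall>q\<in>carrier (base V). \<sigma> q \<in> fiber V q) \<and>
    (\<forall>q. q \<notin> carrier (base V) \<longrightarrow> \<sigma> q = 0) \<and>
    (\<forall>U \<psi>. (U, \<psi>) \<in> trivs V \<longrightarrow> smooth_fun_on (base V) U (\<lambda>q. \<psi> q (\<sigma> q)))"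
proof -
  note pre = vector_bundle_base(2)[OF V]
  have "smooth_map (base V) (total_atlas V) (\<lambda>q. (q, \<sigma> q)) \<longleftrightarrow>
      (\<forall>U \<psi>. (U, \<psi>) \<in> trivs V \<longrightarrow> smooth_fun_on (base V) U (\<lambda>q. \<psi> q (\<sigma> q)))" (is "?L \<longleftrightarrow> ?R")
    if \<sigma>: "\<forall>q\<in>carrier (base V). \<sigma> q \<in> fiber V q"
  proof -
    have pre_im: "D \<inter> (\<lambda>q. (q, \<sigma> q)) -` chart_dom (fiber V) (D' \<inter> U) = D \<inter> (D' \<inter> U)"
      if "(D, \<phi>) \<in> base V" for D \<phi> D' U
      using chart_domain_carrier[OF that] \<sigma> by (auto simp: chart_dom_def)
    show ?thesis
    proof
      assume L: ?L
      show ?R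
      proof (intro allI impI)
        fix U \<psi> assume t: "(U, \<psi>) \<in> trivs V"
        show "smooth_fun_on (base V) U (\<lambda>q. \<psi> q (\<sigma> q))"
        proof (rule smooth_fun_on_local[OF pre])
          fix q assume q: "q \<in> U"
          then have "q \<in> carrier (base V)" using triv_domain(2)[OF V t] by blast
          then obtain D' \<phi>' where c': "(D', \<phi>') \<in> base V" "q \<in> D'" by (rule in_carrierE)
          have oD: "openin (atlas_topology (base V)) (D' \<inter> U)"
            using openin_chart_domain[OF pre c'(1)] triv_domain(1)[OF V t] by (rule openin_Int)
          have "smooth_fun_on (base V) (D' \<inter> U) (\<lambda>q. \<psi> q (\<sigma> q))"
          proof (rule smooth_fun_onI)
            fix D \<phi> assume c: "(D, \<phi>) \<in> base V"
            have "open (\<phi> ` (D \<inter> (D' \<inter> U)))"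
              using open_chart_image[OF pre c oD] by (simp add: Int_commute)
            then have "smooth_on (\<phi> ` (D \<inter> (D' \<inter> U)))
                (\<lambda>x. snd (chart_map \<phi>' \<psi> (inv_into D \<phi> x, \<sigma> (inv_into D \<phi> x))))"
              using smooth_mapD[OF L c total_atlasI[OF c'(1) t]]
              unfolding pre_im[OF c] by (rule smooth_on_snd)
            then show "smooth_on (\<phi> ` (D' \<inter> U \<inter> D)) (\<lambda>x. \<psi> (inv_into D \<phi> x) (\<sigma> (inv_into D \<phi> x)))"
              by (simp add: Int_commute)
          qed
          then show "\<exists>W'. openin (atlas_topology (base V)) W' \<and> q \<in> W' \<and>
              smooth_fun_on (base V) W' (\<lambda>q. \<psi> q (\<sigma> q))"
            using oD q c'(2) by blast
        qed
      qed
    next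
      assume R: ?R
      show ?L
      proof (rule smooth_mapI)
        show "(\<lambda>q. (q, \<sigma> q)) ` carrier (base V) \<subseteq> carrier (total_atlas V)"
          using \<sigma> by (auto simp: carrier_total_atlas[OF V])
        fix D \<phi> C \<Phi> assume c: "(D, \<phi>) \<in> base V" and "(C, \<Phi>) \<in> total_atlas V"
        then obtain D' \<phi>' U \<psi> where c': "(D', \<phi>') \<in> base V" and t: "(U, \<psi>) \<in> trivs V"
          and C: "C = chart_dom (fiber V) (D' \<inter> U)" "\<Phi> = chart_map \<phi>' \<psi>"
          by (auto simp: in_total_atlas_iff)
        have oD: "openin (atlas_topology (base V)) (D' \<inter> U)"
          using openin_chart_domain[OF pre c'] triv_domain(1)[OF V t] by (rule openin_Int)
        have o: "open (\<phi> ` (D \<inter> (D' \<inter> U)))"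
          using open_chart_image[OF pre c oD] by (simp add: Int_commute)
        have "smooth_on (\<phi> ` (D \<inter> (D' \<inter> U))) (\<lambda>x. (\<phi>' (inv_into D \<phi> x), \<psi> (inv_into D \<phi> x) (\<sigma> (inv_into D \<phi> x))))"
          by (rule smooth_on_Pair[OF o smooth_on_subset[OF pre_manifold_transition(2)[OF pre c c']]
                smooth_on_subset[OF smooth_fun_onD[OF R[rule_format, OF t] c]]]) auto
        then show "open (\<phi> ` (D \<inter> (\<lambda>q. (q, \<sigma> q)) -` C)) \<and>
            smooth_on (\<phi> ` (D \<inter> (\<lambda>q. (q, \<sigma> q)) -` C)) (\<lambda>x. \<Phi> (inv_into D \<phi> x, \<sigma> (inv_into D \<phi> x)))"
          using o unfolding C pre_im[OF c] by simp
      qed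
    qed
  qed
  then show ?thesis unfolding sections_def by blast
qed

end

lemma sections_add:
  assumes V: "vector_bundle V" and s: "s \<in> sections V" "s' \<in> sections V"
  shows "s + s' \<in> sections V"
  unfolding sections_iff[OF V]
proof (intro conjI ballI allI impI)
  show "(s + s') q \<in> fiber V q" if "q \<in> carrier (base V)" for q
    using s that vector_bundle_subspace[OF V that] by (simp add: sections_iff[OF V] subspace_add)
  show "(s + s') q = 0" if "q \<notin> carrier (base V)" for q
    using s that by (simp add: sections_iff[OF V])
  fix U \<psi> assume t: "(U, \<psi>) \<in> trivs V"
  have "smooth_fun_on (base V) U (\<lambda>q. \<psi> q (s q) + \<psi> q (s' q))"
    using s t by (intro smooth_fun_on_add vector_bundle_base(2)[OF V] triv_domain(1)[OF V t])
      (auto simp: sections_iff[OF V])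
  then show "smooth_fun_on (base V) U (\<lambda>q. \<psi> q ((s + s') q))"
    by (rule smooth_fun_on_cong[OF vector_bundle_base(2)[OF V] triv_domain(1)[OF V t], THEN iffD1, rotated])
      (use s triv_domain(2)[OF V t] linear_on_plus[OF triv_linear_on[OF V t]] in \<open>auto simp: sections_iff[OF V]\<close>)
qed

lemma sections_smult:
  assumes V: "vector_bundle V" and s: "s \<in> sections V" and f: "f \<in> C_inf (base V)"
  shows "smult f s \<in> sections V"
  unfolding sections_iff[OF V] smult_def
proof (intro conjI ballI allI impI)
  show "f q *\<^sub>R s q \<in> fiber V q" if "q \<in> carrier (base V)" for q
    using s that vector_bundle_subspace[OF V that] by (simp add: sections_iff[OF V] subspace_scale)
  show "f q *\<^sub>R s q = 0" if "q \<notin> carrier (base V)" for q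
    using s that by (simp add: sections_iff[OF V])
  fix U \<psi> assume t: "(U, \<psi>) \<in> trivs V"
  have "smooth_fun_on (base V) U (\<lambda>q. f q *\<^sub>R \<psi> q (s q))"
    using s t smooth_fun_on_subset[of "base V" "carrier (base V)" f U] f triv_domain(2)[OF V t]
    by (intro smooth_fun_on_scaleR vector_bundle_base(2)[OF V] triv_domain(1)[OF V t])
      (auto simp: sections_iff[OF V] C_inf_def)
  then show "smooth_fun_on (base V) U (\<lambda>q. \<psi> q (f q *\<^sub>R s q))"
    by (rule smooth_fun_on_cong[OF vector_bundle_base(2)[OF V] triv_domain(1)[OF V t], THEN iffD1, rotated])
      (use s triv_domain(2)[OF V t] linear_on_scaleR[OF triv_linear_on[OF V t]] in \<open>auto simp: sections_iff[OF V]\<close>)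
qed

lemma sections_scaleR:
  assumes V: "vector_bundle V" and s: "s \<in> sections V"
  shows "a *\<^sub>R s \<in> sections V"
proof -
  have "a *\<^sub>R s = smult (\<lambda>_. a) s" by (simp add: smult_def scaleR_fun_def)
  moreover have "(\<lambda>_. a) \<in> C_inf (base V)" by (simp add: C_inf_def smooth_fun_on_const)
  ultimately show ?thesis using sections_smult[OF V s] by simp
qed

text \<open>Converse to \<open>vb_morphismI\<close>: restrict the smooth map between total spaces to
  points with constant fibre coordinate \<open>y\<close> and project to the fibre part.\<close>

lemma vb_morphism_smooth:
  fixes V :: "('q, 'm::fin_dim_inner, 'v::real_vector, 'k::fin_dim_inner) vbundle"
    and W :: "('q, 'm, 'w::real_vector, 'l::fin_dim_inner) vbundle"
  assumes V: "vector_bundle V" and W: "vector_bundle W" and h: "vb_morphism V W h"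
    and t: "(U, \<psi>) \<in> trivs V" and t': "(U', \<psi>') \<in> trivs W"
  shows "smooth_fun_on (base V) (U \<inter> U') (\<lambda>q. \<psi>' q (h q (triv_inv V \<psi> q y)))"
proof (rule smooth_fun_on_local[OF vector_bundle_base(2)[OF V]])
  note pre = vector_bundle_base(2)[OF V]
  fix q assume q: "q \<in> U \<inter> U'"
  have b: "base V = base W" and hf: "\<And>q. q \<in> carrier (base V) \<Longrightarrow> h q ` fiber V q \<subseteq> fiber W q"
    using h by (auto simp: vb_morphism_def)
  have UV: "U \<subseteq> carrier (base V)" by (rule triv_domain(2)[OF V t])
  then have "q \<in> carrier (base V)" using q by blast
  then obtain D \<phi> where c: "(D, \<phi>) \<in> base V" "q \<in> D" by (rule in_carrierE)
  let ?W = "D \<inter> U \<inter> (D \<inter> U')"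
  have oW: "openin (atlas_topology (base V)) ?W"
    using openin_chart_domain[OF pre c(1)] triv_domain(1)[OF V t] triv_domain(1)[OF W t', folded b]
    by (intro openin_Int)
  have "?W \<inter> D = ?W" by blast
  then have o: "open (\<phi> ` ?W)" using open_chart_image[OF pre c(1) oW] by simp
  let ?C = "chart_dom (fiber V) (D \<inter> U)"
  have S: "?C \<inter> (\<lambda>(q, v). (q, h q v)) -` chart_dom (fiber W) (D \<inter> U') = chart_dom (fiber V) ?W"
    using UV hf by (auto simp: chart_dom_def)
  have im: "chart_map \<phi> \<psi> ` chart_dom (fiber V) ?W = \<phi> ` ?W \<times> UNIV"
    by (rule chart_map_image[OF V c(1) t]) auto
  let ?F = "\<lambda>z. chart_map \<phi> \<psi>' ((\<lambda>(q, v). (q, h q v)) (inv_into ?C (chart_map \<phi> \<psi>) z))"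
  have "smooth_on (chart_map \<phi> \<psi> ` (?C \<inter> (\<lambda>(q, v). (q, h q v)) -` chart_dom (fiber W) (D \<inter> U'))) ?F"
    using h total_atlasI[OF c(1) t] total_atlasI[OF c(1)[unfolded b] t']
    unfolding vb_morphism_def by (intro smooth_mapD) blast+
  then have F: "smooth_on (\<phi> ` ?W \<times> UNIV) ?F" unfolding S im .
  have "smooth_on (\<phi> ` ?W) (\<lambda>x. snd (?F (x, y)))"
    by (intro smooth_on_snd[OF o] smooth_on_compose[OF F] smooth_on_Pair smooth_on_ident smooth_on_const o) auto
  then have "smooth_on (\<phi> ` ?W) (\<lambda>x. \<psi>' (inv_into D \<phi> x) (h (inv_into D \<phi> x) (triv_inv V \<psi> (inv_into D \<phi> x) y)))"
    by (rule smooth_on_cong[OF o, THEN iffD1, rotated])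
      (auto simp: inv_chart_map[OF V c(1) t] chart_inv[OF pre c(1)])
  then have "smooth_fun_on (base V) ?W (\<lambda>q. \<psi>' q (h q (triv_inv V \<psi> q y)))"
    by (intro smooth_fun_on_chartI[OF pre c(1) oW]) auto
  then show "\<exists>W'. openin (atlas_topology (base V)) W' \<and> q \<in> W' \<and>
      smooth_fun_on (base V) W' (\<lambda>q. \<psi>' q (h q (triv_inv V \<psi> q y)))"
    using oW q c(2) by blast
qed


section \<open>Dual bundles\<close>

text \<open>The inverse of \<open>dual_triv\<close> on a fibre; the value 0 outside the fibre is the
  convention that \<open>dual_bundle\<close> imposes on functionals.\<close>

definition riesz_functional ::
  "('q \<Rightarrow> 'v set) \<Rightarrow> ('q \<Rightarrow> 'v \<Rightarrow> 'k::real_inner) \<Rightarrow> 'q \<Rightarrow> 'k \<Rightarrow> 'v \<Rightarrow> real"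
  where "riesz_functional F \<psi> q w = (\<lambda>v. if v \<in> F q then inner w (\<psi> q v) else 0)"

lemma base_dual_bundle [simp]: "base (dual_bundle V) = base V"
  by (simp add: dual_bundle_def)

lemma fiber_dual_bundle_iff:
  "\<kappa> \<in> fiber (dual_bundle V) q \<longleftrightarrow> linear_on (fiber V q) \<kappa> \<and> (\<forall>v. v \<notin> fiber V q \<longrightarrow> \<kappa> v = 0)"
  by (simp add: dual_bundle_def)

lemma trivs_dual_bundle_iff:
  "(U, \<theta>) \<in> trivs (dual_bundle V) \<longleftrightarrow> (\<exists>\<psi>. (U, \<psi>) \<in> trivs V \<and> \<theta> = dual_triv (fiber V) \<psi>)"
  by (auto simp: dual_bundle_def)

lemma subspace_fiber_dual_bundle: "subspace (fiber (dual_bundle V) q)"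
  by (rule subspaceI) (auto simp: fiber_dual_bundle_iff linear_on_def scaleR_fun_def algebra_simps)

context
  fixes V :: "('q, 'm::fin_dim_inner, 'v::real_vector, 'k::fin_dim_inner) vbundle"
  assumes V: "vector_bundle V"
begin

context
  fixes U \<psi> q
  assumes t: "(U, \<psi>) \<in> trivs V" and q: "q \<in> U"
begin

lemma dual_triv_eqI:
  assumes "\<And>v. v \<in> fiber V q \<Longrightarrow> \<kappa> v = inner w (\<psi> q v)"
  shows "dual_triv (fiber V) \<psi> q \<kappa> = w"
  unfolding dual_triv_def
proof (rule the_equality)
  show "\<forall>v\<in>fiber V q. \<kappa> v = inner w (\<psi> q v)" using assms by blast
  fix w' assume w': "\<forall>v\<in>fiber V q. \<kappa> v = inner w' (\<psi> q v)"
  have "inner w' y = inner w y" for y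
    using w' assms triv_inv_in[OF V t q, of y] triv_inv_right[OF V t q, of y] by metis
  then have "inner (w' - w) (w' - w) = 0" by (simp add: inner_diff_left)
  then show "w' = w" by simp
qed

text \<open>Replaces the description of the Riesz vector by a finite sum, whose coefficients can be
  checked for smoothness one at a time.\<close>

lemma dual_triv_expand:
  assumes "linear_on (fiber V q) \<kappa>"
  shows "dual_triv (fiber V) \<psi> q \<kappa> = (\<Sum>b\<in>onb. \<kappa> (triv_inv V \<psi> q b) *\<^sub>R b)"
proof (rule dual_triv_eqI)
  fix v assume v: "v \<in> fiber V q"
  show "\<kappa> v = inner (\<Sum>b\<in>onb. \<kappa> (triv_inv V \<psi> q b) *\<^sub>R b) (\<psi> q v)"
    using riesz_vector[OF linear_on_triv_inv[OF V t q assms], of "\<psi> q v"] triv_inv_left[OF V t q v]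
    by simp
qed

lemma dual_triv_inner:
  assumes "linear_on (fiber V q) \<kappa>" "v \<in> fiber V q"
  shows "\<kappa> v = inner (dual_triv (fiber V) \<psi> q \<kappa>) (\<psi> q v)"
  using riesz_vector[OF linear_on_triv_inv[OF V t q assms(1)], of "\<psi> q v"] triv_inv_left[OF V t q assms(2)]
    dual_triv_expand[OF assms(1)] by simp

lemma riesz_functional_in: "riesz_functional (fiber V) \<psi> q w \<in> fiber (dual_bundle V) q"
proof -
  have "subspace (fiber V q)" using vector_bundle_subspace[OF V] triv_domain(2)[OF V t] q by blast
  then show ?thesis
    unfolding fiber_dual_bundle_iff linear_on_def riesz_functional_def
    using linear_onD[OF triv_linear_on[OF V t q]]
    by (simp add: subspace_add subspace_scale inner_add_right)
qed

lemma dual_triv_riesz_functional: "dual_triv (fiber V) \<psi> q (riesz_functional (fiber V) \<psi> q w) = w"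
  by (rule dual_triv_eqI) (simp add: riesz_functional_def)

lemma riesz_functional_dual_triv:
  assumes "\<kappa> \<in> fiber (dual_bundle V) q"
  shows "riesz_functional (fiber V) \<psi> q (dual_triv (fiber V) \<psi> q \<kappa>) = \<kappa>"
  using assms dual_triv_inner[of \<kappa>] by (auto simp: fiber_dual_bundle_iff riesz_functional_def fun_eq_iff)

lemma linear_on_dual_triv: "linear_on (fiber (dual_bundle V) q) (dual_triv (fiber V) \<psi> q)"
  unfolding linear_on_def
proof (intro ballI allI)
  fix \<kappa> \<mu> a b assume "\<kappa> \<in> fiber (dual_bundle V) q" "\<mu> \<in> fiber (dual_bundle V) q"
  then show "dual_triv (fiber V) \<psi> q (a *\<^sub>R \<kappa> + b *\<^sub>R \<mu>) =
      a *\<^sub>R dual_triv (fiber V) \<psi> q \<kappa> + b *\<^sub>R dual_triv (fiber V) \<psi> q \<mu>"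
    by (intro dual_triv_eqI)
      (simp add: fiber_dual_bundle_iff scaleR_fun_def inner_add_left dual_triv_inner[symmetric])
qed

lemma bij_dual_triv: "bij_betw (dual_triv (fiber V) \<psi> q) (fiber (dual_bundle V) q) UNIV"
  by (rule bij_betw_byWitness[where f' = "riesz_functional (fiber V) \<psi> q"])
    (auto simp: riesz_functional_dual_triv dual_triv_riesz_functional riesz_functional_in)

lemma inv_into_dual_triv:
  "inv_into (fiber (dual_bundle V) q) (dual_triv (fiber V) \<psi> q) w = riesz_functional (fiber V) \<psi> q w"
  by (intro inv_into_f_eq bij_betw_imp_inj_on[OF bij_dual_triv] riesz_functional_in dual_triv_riesz_functional)

end

text \<open>A transition function of the dual bundle is the transpose of the transition function of
  \<open>V\<close> in the opposite direction, hence smooth.\<close>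

lemma vector_bundle_dual_bundle: "vector_bundle (dual_bundle V)"
  unfolding vector_bundle_def base_dual_bundle
proof (intro conjI)
  note pre = vector_bundle_base(2)[OF V]
  show "smooth_manifold (base V)" by (rule vector_bundle_base(1)[OF V])
  show "\<forall>q\<in>carrier (base V). subspace (fiber (dual_bundle V) q)" by (simp add: subspace_fiber_dual_bundle)
  have "(\<Union>(U, \<theta>)\<in>trivs (dual_bundle V). U) = (\<Union>(U, \<psi>)\<in>trivs V. U)"
    unfolding dual_bundle_def by auto
  also have "\<dots> = carrier (base V)" using V unfolding vector_bundle_def by blast
  finally show "(\<Union>(U, \<theta>)\<in>trivs (dual_bundle V). U) = carrier (base V)" .
  show "\<forall>(U, \<theta>)\<in>trivs (dual_bundle V). openin (atlas_topology (base V)) U \<and>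
      (\<forall>q\<in>U. linear_on (fiber (dual_bundle V) q) (\<theta> q) \<and> bij_betw (\<theta> q) (fiber (dual_bundle V) q) UNIV)"
    using triv_domain(1)[OF V] linear_on_dual_triv bij_dual_triv by (auto simp: trivs_dual_bundle_iff)
  have "smooth_fun_on (base V) (U \<inter> U') (\<lambda>q. dual_triv (fiber V) \<psi>' q
      (inv_into (fiber (dual_bundle V) q) (dual_triv (fiber V) \<psi> q) w))"
    if t: "(U, \<psi>) \<in> trivs V" and t': "(U', \<psi>') \<in> trivs V" for U \<psi> U' \<psi>' w
  proof -
    have o: "openin (atlas_topology (base V)) (U \<inter> U')"
      using triv_domain(1)[OF V t] triv_domain(1)[OF V t'] by (rule openin_Int)
    have sm: "smooth_fun_on (base V) (U \<inter> U') (\<lambda>q. \<psi> q (triv_inv V \<psi>' q b))" for b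
      using smooth_transition_const[OF V t' t] by (simp add: Int_commute)
    have "smooth_fun_on (base V) (U \<inter> U') (\<lambda>q. \<Sum>b\<in>onb. inner w (\<psi> q (triv_inv V \<psi>' q b)) *\<^sub>R b)"
      by (intro smooth_fun_on_sum smooth_fun_on_scaleR smooth_fun_on_inner smooth_fun_on_const sm pre o)
    then show ?thesis
    proof (rule smooth_fun_on_cong[OF pre o, THEN iffD1, rotated])
      fix q assume q: "q \<in> U \<inter> U'"
      then have qU: "q \<in> U" "q \<in> U'" by auto
      show "(\<Sum>b\<in>onb. inner w (\<psi> q (triv_inv V \<psi>' q b)) *\<^sub>R b) = dual_triv (fiber V) \<psi>' q
          (inv_into (fiber (dual_bundle V) q) (dual_triv (fiber V) \<psi> q) w)"
        using riesz_functional_in[OF t qU(1), of w] triv_inv_in[OF V t' qU(2)]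
        by (simp add: inv_into_dual_triv[OF t qU(1)] dual_triv_expand[OF t' qU(2)] fiber_dual_bundle_iff
            riesz_functional_def)
    qed
  qed
  then show "\<forall>(U, \<theta>)\<in>trivs (dual_bundle V). \<forall>(U', \<theta>')\<in>trivs (dual_bundle V). \<forall>w.
      smooth_fun_on (base V) (U \<inter> U') (\<lambda>q. \<theta>' q (inv_into (fiber (dual_bundle V) q) (\<theta> q) w))"
    unfolding Ball_def split_paired_All prod.case trivs_dual_bundle_iff by blast
qed

end


section \<open>The left tangent bundle is a vector bundle\<close>

locale anchored_bundle =
  fixes E :: "('q, 'm::fin_dim_inner, 'v::real_vector, 'k::fin_dim_inner) vbundle"
    and \<rho> :: "'q \<Rightarrow> 'v \<Rightarrow> ('q \<Rightarrow> real) \<Rightarrow> real"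
  assumes E: "vector_bundle E" and anchor: "vb_morphism E (tangent_bundle (base E)) \<rho>"
begin

abbreviation "Es \<equiv> dual_bundle E"
abbreviation "M \<equiv> total_atlas (dual_bundle E)"
abbreviation "LTE \<equiv> left_tangent E \<rho>"
abbreviation "dtriv \<equiv> dual_triv (fiber E)"
abbreviation "over \<equiv> chart_dom (fiber (dual_bundle E))"
abbreviation "echart D \<phi> U \<psi> \<equiv> (over (D \<inter> U), chart_map \<phi> (dtriv \<psi>))"

lemma Es: "vector_bundle Es" by (rule vector_bundle_dual_bundle[OF E])

lemma mfdM: "smooth_manifold M" by (rule smooth_manifold_total_atlas[OF Es])
lemma preM: "pre_manifold M" using mfdM by simp
lemma mfdQ: "smooth_manifold (base E)" by (rule vector_bundle_base(1)[OF E])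
lemma preQ: "pre_manifold (base E)" using mfdQ by simp

lemma carrierM: "carrier M = over (carrier (base E))"
  using carrier_total_atlas[OF Es] by simp

lemma dtriv_trivs: "(U, \<psi>) \<in> trivs E \<Longrightarrow> (U, dtriv \<psi>) \<in> trivs Es"
  by (auto simp: trivs_dual_bundle_iff)

lemma echart_in: "(D, \<phi>) \<in> base E \<Longrightarrow> (U, \<psi>) \<in> trivs E \<Longrightarrow> echart D \<phi> U \<psi> \<in> M"
  using total_atlasI[of D \<phi> Es U] dtriv_trivs by simp

lemma M_cases:
  assumes "(C, \<Phi>) \<in> M"
  obtains D \<phi> U \<psi> where "(D, \<phi>) \<in> base E" "(U, \<psi>) \<in> trivs E" "C = over (D \<inter> U)" "\<Phi> = chart_map \<phi> (dtriv \<psi>)"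
  using assms unfolding in_total_atlas_iff trivs_dual_bundle_iff base_dual_bundle by blast

lemma openin_over: "openin (atlas_topology (base E)) W \<Longrightarrow> openin (atlas_topology M) (over W)"
  using openin_chart_dom[OF Es] by simp

lemma openin_over_triv: "(U, \<psi>) \<in> trivs E \<Longrightarrow> openin (atlas_topology M) (over U)"
  using openin_over triv_domain(1)[OF E] by blast

lemma openin_over_chart:
  "(D, \<phi>) \<in> base E \<Longrightarrow> (U, \<psi>) \<in> trivs E \<Longrightarrow> openin (atlas_topology M) (over (D \<inter> U))"
  using openin_chart_domain[OF preM echart_in] by blast

lemma smooth_pullback:
  "openin (atlas_topology (base E)) W \<Longrightarrow> smooth_fun_on (base E) W f \<Longrightarrow>
    smooth_fun_on M (over W) (\<lambda>p. f (fst p))"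
  using smooth_fun_on_pullback[OF Es] by simp

lemma base_LTE [simp]: "base LTE = M"
  by (simp add: left_tangent_def Let_def)

lemma fiber_LTE_iff:
  "(\<sigma>, X) \<in> fiber LTE (q, \<kappa>) \<longleftrightarrow> \<sigma> \<in> fiber E q \<and> X \<in> tangent_space M (q, \<kappa>) \<and>
    \<rho> q \<sigma> = tangent_map (base E) fst X"
  by (simp add: left_tangent_def Let_def)

definition lt_triv :: "'q set \<Rightarrow> ('q \<Rightarrow> 'm) \<Rightarrow> 'q set \<Rightarrow> ('q \<Rightarrow> 'v \<Rightarrow> 'k) \<Rightarrow>
    'q \<times> ('v \<Rightarrow> real) \<Rightarrow> 'v \<times> (('q \<times> ('v \<Rightarrow> real) \<Rightarrow> real) \<Rightarrow> real) \<Rightarrow> 'k \<times> 'k"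
  where "lt_triv D \<phi> U \<psi> = (\<lambda>(q, \<kappa>) (\<sigma>, X). (\<psi> q \<sigma>, snd (components M (echart D \<phi> U \<psi>) (q, \<kappa>) X)))"

lemma trivs_LTE_iff:
  "(S, \<Psi>) \<in> trivs LTE \<longleftrightarrow> (\<exists>D \<phi> U \<psi>. (D, \<phi>) \<in> base E \<and> (U, \<psi>) \<in> trivs E \<and>
    S = over (D \<inter> U) \<and> \<Psi> = lt_triv D \<phi> U \<psi>)"
proof -
  have "(S, \<Psi>) \<in> trivs LTE \<longleftrightarrow> (\<exists>c U \<psi>. c \<in> base E \<and> (U, \<psi>) \<in> trivs E \<and>
      S = over (fst c \<inter> U) \<and> \<Psi> = lt_triv (fst c) (snd c) U \<psi>)"
    unfolding left_tangent_def Let_def lt_triv_def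
    by (simp add: bundle_chart_def chart_dom_def chart_map_def case_prod_unfold) blast
  then show ?thesis by auto
qed

lemma rho_linear_on: "q \<in> carrier (base E) \<Longrightarrow> linear_on (fiber E q) (\<rho> q)"
  and rho_tangent: "q \<in> carrier (base E) \<Longrightarrow> v \<in> fiber E q \<Longrightarrow> \<rho> q v \<in> tangent_space (base E) q"
  using anchor by (auto simp: vb_morphism_def tangent_bundle_def)

lemma subspace_fiber_LTE:
  assumes "q \<in> carrier (base E)" "\<kappa> \<in> fiber Es q"
  shows "subspace (fiber LTE (q, \<kappa>))"
proof -
  have p: "(q, \<kappa>) \<in> carrier M" using assms by (simp add: carrierM)
  obtain C \<Phi> where "(C, \<Phi>) \<in> M" "(q, \<kappa>) \<in> C" using p by (rule in_carrierE)
  then have T: "subspace (tangent_space M (q, \<kappa>))" by (rule subspace_tangent_space[OF mfdM])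
  have F: "subspace (fiber E q)" by (rule vector_bundle_subspace[OF E assms(1)])
  note lin = rho_linear_on[OF assms(1)]
  have 0: "tangent_map (base E) fst (0 :: ('q \<times> ('v \<Rightarrow> real) \<Rightarrow> real) \<Rightarrow> real) = 0"
    and add: "tangent_map (base E) fst (X + Y) = tangent_map (base E) fst X + tangent_map (base E) fst Y"
    and scale: "tangent_map (base E) fst (r *\<^sub>R X) = r *\<^sub>R tangent_map (base E) fst X"
    for X Y :: "('q \<times> ('v \<Rightarrow> real) \<Rightarrow> real) \<Rightarrow> real" and r
    by (auto simp: tangent_map_def fun_eq_iff scaleR_fun_def)
  show ?thesis
  proof (rule subspaceI)
    show "0 \<in> fiber LTE (q, \<kappa>)"
      using subspace_0[OF T] subspace_0[OF F] 0 linear_on_zero[OF lin subspace_0[OF F]]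
      by (simp add: zero_prod_def fiber_LTE_iff)
    show "x + y \<in> fiber LTE (q, \<kappa>)" if "x \<in> fiber LTE (q, \<kappa>)" "y \<in> fiber LTE (q, \<kappa>)" for x y
      using that by (cases x, cases y)
        (simp add: fiber_LTE_iff subspace_add[OF T] subspace_add[OF F] add linear_on_plus[OF lin])
    show "r *\<^sub>R x \<in> fiber LTE (q, \<kappa>)" if "x \<in> fiber LTE (q, \<kappa>)" for x r
      using that by (cases x)
        (simp add: fiber_LTE_iff subspace_scale[OF T] subspace_scale[OF F] scale linear_on_scaleR[OF lin])
  qed
qed

text \<open>The matrix of the left anchor in a chart of the base and a local frame of
  \<open>E\<close>, applied to \<open>u\<close>.\<close>

definition anchor_coeff :: "'q set \<Rightarrow> ('q \<Rightarrow> 'm) \<Rightarrow> ('q \<Rightarrow> 'v \<Rightarrow> 'k) \<Rightarrow> 'q \<Rightarrow> 'k \<Rightarrow> 'm"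
  where "anchor_coeff D \<phi> \<psi> q u = components (base E) (D, \<phi>) q (\<rho> q (triv_inv E \<psi> q u))"

text \<open>Inverse of \<open>lt_triv\<close>: the vertical components are free, while the base
  components are dictated by the anchor condition.\<close>

definition lt_vec :: "'q set \<Rightarrow> ('q \<Rightarrow> 'm) \<Rightarrow> 'q set \<Rightarrow> ('q \<Rightarrow> 'v \<Rightarrow> 'k) \<Rightarrow>
    'q \<times> ('v \<Rightarrow> real) \<Rightarrow> 'k \<times> 'k \<Rightarrow> 'v \<times> (('q \<times> ('v \<Rightarrow> real) \<Rightarrow> real) \<Rightarrow> real)"
  where "lt_vec D \<phi> U \<psi> p z = (triv_inv E \<psi> (fst p) (fst z),
    chart_vector M (echart D \<phi> U \<psi>) p (anchor_coeff D \<phi> \<psi> (fst p) (fst z), snd z))"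

context
  fixes D \<phi> U \<psi>
  assumes c: "(D, \<phi>) \<in> base E" and t: "(U, \<psi>) \<in> trivs E"
begin

lemma echart_inv:
  "q \<in> D \<inter> U \<Longrightarrow> inv_into (over (D \<inter> U)) (chart_map \<phi> (dtriv \<psi>)) (\<phi> q, y) =
    (q, riesz_functional (fiber E) \<psi> q y)"
  using inv_chart_map[OF Es _ dtriv_trivs[OF t], of D \<phi> q y] c inv_into_dual_triv[OF E t] by simp

lemma open_echart_image: "open (\<phi> ` (D \<inter> U))"
  using open_chart_image[OF preQ c triv_domain(1)[OF E t]] by (simp add: Int_commute)

text \<open>In a bundle chart the projection to the base is \<open>fst\<close>. Evaluated on a
  smooth function of the base, the tangent map is differentiation of its pullback, which is smooth
  on the total space.\<close>

lemma tangent_map_fst: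
  assumes p: "(q, \<kappa>) \<in> over (D \<inter> U)"
  shows "tangent_map (base E) fst (chart_vector M (echart D \<phi> U \<psi>) (q, \<kappa>) z) =
    chart_vector (base E) (D, \<phi>) q (fst z)"
proof
  fix f
  show "tangent_map (base E) fst (chart_vector M (echart D \<phi> U \<psi>) (q, \<kappa>) z) f =
      chart_vector (base E) (D, \<phi>) q (fst z) f"
  proof (cases "f \<in> C_inf (base E)")
    case True
    let ?g = "\<lambda>p. f (fst p)"
    have q: "q \<in> D" using p by simp
    have g: "?g \<in> C_inf M"
      using smooth_pullback[OF openin_carrier[OF preQ]] True by (simp add: C_inf_def carrierM)
    have "((\<lambda>x. f (inv_into D \<phi> x)) has_derivative (\<lambda>v. chart_vector (base E) (D, \<phi>) q v f)) (at (\<phi> q))"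
      using C_inf_has_derivative[OF preQ c q True] by simp
    then have "((\<lambda>z. f (inv_into D \<phi> (fst z))) has_derivative
        (\<lambda>z. chart_vector (base E) (D, \<phi>) q (fst z) f)) (at (chart_map \<phi> (dtriv \<psi>) (q, \<kappa>)))"
      by (intro has_derivative_compose[OF bounded_linear_imp_has_derivative[OF bounded_linear_fst]]) simp
    then have "((\<lambda>z. ?g (inv_into (over (D \<inter> U)) (chart_map \<phi> (dtriv \<psi>)) z)) has_derivative
        (\<lambda>z. chart_vector (base E) (D, \<phi>) q (fst z) f)) (at (chart_map \<phi> (dtriv \<psi>) (q, \<kappa>)))"
      by (rule has_derivative_transform_within_open[where s = "\<phi> ` (D \<inter> U) \<times> UNIV"])
        (use p open_echart_image in \<open>auto simp: echart_inv chart_inv[OF preQ c] intro!: open_Times\<close>)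
    then have "(\<lambda>z. chart_vector (base E) (D, \<phi>) q (fst z) f) =
        (\<lambda>z. chart_vector M (echart D \<phi> U \<psi>) (q, \<kappa>) z ?g)"
      using C_inf_has_derivative[OF preM echart_in[OF c t] p g] by simp
    from fun_cong[OF this, of z] show ?thesis using True by (simp add: tangent_map_def)
  qed (simp add: tangent_map_def chart_vector_def)
qed

lemma linear_anchor_coeff:
  assumes q: "q \<in> D \<inter> U"
  shows "linear (anchor_coeff D \<phi> \<psi> q)"
proof -
  have qc: "q \<in> carrier (base E)" using q chart_domain_carrier[OF c] by blast
  have "linear_on (fiber E q) (\<lambda>v. components (base E) (D, \<phi>) q (\<rho> q v))"
    using q rho_tangent[OF qc] linear_onD[OF rho_linear_on[OF qc]] linear_onD[OF linear_on_components[OF mfdQ c]]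
    unfolding linear_on_def[of "fiber E q"] by simp
  then show ?thesis unfolding anchor_coeff_def using q by (intro linear_on_triv_inv[OF E t]) auto
qed

lemma smooth_anchor_coeff: "smooth_fun_on (base E) (D \<inter> U) (\<lambda>q. anchor_coeff D \<phi> \<psi> q u)"
proof -
  have "(D, components (base E) (D, \<phi>)) \<in> trivs (tangent_bundle (base E))"
    using c by (force simp: tangent_bundle_def)
  from vb_morphism_smooth[OF E vector_bundle_tangent_bundle[OF mfdQ] anchor t this]
  show ?thesis by (simp add: anchor_coeff_def Int_commute)
qed

context
  fixes p
  assumes p: "p \<in> over (D \<inter> U)"
begin

private lemma q: "fst p \<in> D" "fst p \<in> U" "fst p \<in> D \<inter> U" "fst p \<in> carrier (base E)"
  using p chart_domain_carrier[OF c] by (auto simp: chart_dom_def)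

private lemma comp_M:
  "components M (echart D \<phi> U \<psi>) p (chart_vector M (echart D \<phi> U \<psi>) p z) = z"
  by (rule components_chart_vector[OF mfdM echart_in[OF c t] p])

lemma lt_vec_in: "lt_vec D \<phi> U \<psi> p z \<in> fiber LTE p"
proof -
  obtain q' \<kappa> where pq: "p = (q', \<kappa>)" by (cases p)
  show ?thesis
    using q p chart_vector_in_tangent_space[OF mfdM echart_in[OF c t] p]
      rho_tangent[OF q(4) triv_inv_in[OF E t q(2)]] triv_inv_in[OF E t q(2)]
    unfolding pq lt_vec_def
    by (simp add: fiber_LTE_iff tangent_map_fst[OF p[unfolded pq]] anchor_coeff_def
        chart_vector_components[OF mfdQ c])
qed

lemma lt_triv_vec: "lt_triv D \<phi> U \<psi> p (lt_vec D \<phi> U \<psi> p z) = z"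
  using triv_inv_right[OF E t q(2)] comp_M
  by (cases p) (simp add: lt_triv_def lt_vec_def)

text \<open>The condition linking the anchor of \<sigma> to the tangent map of \<open>X\<close>
  recovers the base components that \<open>lt_triv\<close> drops.\<close>

lemma lt_vec_triv:
  assumes v: "v \<in> fiber LTE p"
  shows "lt_vec D \<phi> U \<psi> p (lt_triv D \<phi> U \<psi> p v) = v"
proof -
  obtain \<sigma> X where vX: "v = (\<sigma>, X)" by (cases v)
  have \<sigma>: "\<sigma> \<in> fiber E (fst p)" and X: "X \<in> tangent_space M p"
    and rho: "\<rho> (fst p) \<sigma> = tangent_map (base E) fst X"
    using v fiber_LTE_iff[of \<sigma> X "fst p" "snd p"] by (simp_all add: vX)
  let ?z = "components M (echart D \<phi> U \<psi>) p X"
  have X': "X = chart_vector M (echart D \<phi> U \<psi>) p ?z"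
    using chart_vector_components[OF mfdM echart_in[OF c t] p X] by simp
  have "\<rho> (fst p) \<sigma> = chart_vector (base E) (D, \<phi>) (fst p) (fst ?z)"
    unfolding rho using tangent_map_fst[of "fst p" "snd p" ?z] p X' by simp
  then have "anchor_coeff D \<phi> \<psi> (fst p) (\<psi> (fst p) \<sigma>) = fst ?z"
    unfolding anchor_coeff_def triv_inv_left[OF E t q(2) \<sigma>]
    using components_chart_vector[OF mfdQ c q(1)] by simp
  then show ?thesis
    using triv_inv_left[OF E t q(2) \<sigma>] X'
    by (cases p) (simp add: lt_vec_def lt_triv_def vX)
qed

lemma bij_lt_triv: "bij_betw (lt_triv D \<phi> U \<psi> p) (fiber LTE p) UNIV"
  by (rule bij_betw_byWitness[where f' = "lt_vec D \<phi> U \<psi> p"])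
    (auto simp: lt_vec_triv lt_triv_vec lt_vec_in)

lemma inv_into_lt_triv: "inv_into (fiber LTE p) (lt_triv D \<phi> U \<psi> p) z = lt_vec D \<phi> U \<psi> p z"
  by (intro inv_into_f_eq bij_betw_imp_inj_on[OF bij_lt_triv] lt_vec_in lt_triv_vec)

lemma linear_on_lt_triv: "linear_on (fiber LTE p) (lt_triv D \<phi> U \<psi> p)"
  unfolding linear_on_def
proof (intro ballI allI)
  fix v w a b assume v: "v \<in> fiber LTE p" and w: "w \<in> fiber LTE p"
  obtain \<sigma> X \<tau> Y where vw: "v = (\<sigma>, X)" "w = (\<tau>, Y)" by (cases v, cases w)
  have "\<sigma> \<in> fiber E (fst p)" "X \<in> tangent_space M p" "\<tau> \<in> fiber E (fst p)" "Y \<in> tangent_space M p"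
    using v w fiber_LTE_iff[of \<sigma> X "fst p" "snd p"] fiber_LTE_iff[of \<tau> Y "fst p" "snd p"]
    by (simp_all add: vw)
  then show "lt_triv D \<phi> U \<psi> p (a *\<^sub>R v + b *\<^sub>R w) =
      a *\<^sub>R lt_triv D \<phi> U \<psi> p v + b *\<^sub>R lt_triv D \<phi> U \<psi> p w"
    using linear_onD[OF linear_on_components[OF mfdM echart_in[OF c t] p], of X Y a b]
      linear_onD[OF triv_linear_on[OF E t q(2)], of \<sigma> \<tau> a b]
    by (cases p) (simp add: lt_triv_def vw)
qed

end

text \<open>The Jacobian of a bundle chart transition also feeds the base components into the
  vertical ones. This contribution depends on the fibre coordinate of \<open>p\<close>;
  \<open>adapted\<close> is later designed to remove it.\<close>

lemma smooth_lt_transition: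
  assumes c': "(D', \<phi>') \<in> base E" and t': "(U', \<psi>') \<in> trivs E"
  shows "smooth_fun_on M (over (D \<inter> U) \<inter> over (D' \<inter> U')) (\<lambda>p. lt_triv D' \<phi>' U' \<psi>' p (lt_vec D \<phi> U \<psi> p z))"
proof -
  let ?S = "over (D \<inter> U) \<inter> over (D' \<inter> U')"
  have o: "openin (atlas_topology M) ?S"
    using openin_over_chart[OF c t] openin_over_chart[OF c' t'] by (rule openin_Int)
  have oQ: "openin (atlas_topology (base E)) (D \<inter> U)" "openin (atlas_topology (base E)) (U \<inter> U')"
    using openin_chart_domain[OF preQ c] triv_domain(1)[OF E t] triv_domain(1)[OF E t'] by auto
  have 1: "smooth_fun_on M ?S (\<lambda>p. \<psi>' (fst p) (triv_inv E \<psi> (fst p) (fst z)))"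
    by (rule smooth_fun_on_subset[OF smooth_pullback[OF oQ(2) smooth_transition_const[OF E t t']]])
      (auto simp: chart_dom_def)
  have 2: "smooth_fun_on M ?S (\<lambda>p. anchor_coeff D \<phi> \<psi> (fst p) (fst z))"
    by (rule smooth_fun_on_subset[OF smooth_pullback[OF oQ(1) smooth_anchor_coeff]]) auto
  have "smooth_fun_on M ?S (\<lambda>p. (\<psi>' (fst p) (triv_inv E \<psi> (fst p) (fst z)),
      snd (coord_change (echart D \<phi> U \<psi>) (echart D' \<phi>' U' \<psi>') p (anchor_coeff D \<phi> \<psi> (fst p) (fst z), snd z))))"
    by (intro smooth_fun_on_Pair smooth_fun_on_snd smooth_coord_change smooth_fun_on_const 1 2 preM o
        echart_in c c' t t') auto
  then show ?thesis
  proof (rule smooth_fun_on_cong[OF preM o, THEN iffD1, rotated])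
    fix p assume p: "p \<in> ?S"
    then show "(\<psi>' (fst p) (triv_inv E \<psi> (fst p) (fst z)),
        snd (coord_change (echart D \<phi> U \<psi>) (echart D' \<phi>' U' \<psi>') p (anchor_coeff D \<phi> \<psi> (fst p) (fst z), snd z)))
        = lt_triv D' \<phi>' U' \<psi>' p (lt_vec D \<phi> U \<psi> p z)"
      using components_change[OF mfdM echart_in[OF c t] _ echart_in[OF c' t'], of p]
      by (cases p) (simp add: lt_triv_def lt_vec_def)
  qed
qed

end

lemma vector_bundle_LTE: "vector_bundle LTE"
  unfolding vector_bundle_def base_LTE
proof (intro conjI)
  show "smooth_manifold M" by (rule mfdM)
  show "\<forall>p\<in>carrier M. subspace (fiber LTE p)"
    using subspace_fiber_LTE by (auto simp: carrierM chart_dom_def)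
  show "(\<Union>(S, \<Psi>)\<in>trivs LTE. S) = carrier M"
  proof
    show "(\<Union>(S, \<Psi>)\<in>trivs LTE. S) \<subseteq> carrier M"
    proof
      fix p assume "p \<in> (\<Union>(S, \<Psi>)\<in>trivs LTE. S)"
      then obtain S \<Psi> where "(S, \<Psi>) \<in> trivs LTE" "p \<in> S" by blast
      then show "p \<in> carrier M" unfolding trivs_LTE_iff using chart_domain_carrier[OF echart_in] by blast
    qed
    show "carrier M \<subseteq> (\<Union>(S, \<Psi>)\<in>trivs LTE. S)"
    proof
      fix p assume "p \<in> carrier M"
      then obtain C \<Phi> where C: "(C, \<Phi>) \<in> M" "p \<in> C" by (rule in_carrierE)
      from C(1) obtain D \<phi> U \<psi> where "(D, \<phi>) \<in> base E" "(U, \<psi>) \<in> trivs E" "C = over (D \<inter> U)"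
        by (rule M_cases)
      then have "(C, lt_triv D \<phi> U \<psi>) \<in> trivs LTE" using trivs_LTE_iff by blast
      then show "p \<in> (\<Union>(S, \<Psi>)\<in>trivs LTE. S)" using C(2) by blast
    qed
  qed
  show "\<forall>(S, \<Psi>)\<in>trivs LTE. openin (atlas_topology M) S \<and>
      (\<forall>p\<in>S. linear_on (fiber LTE p) (\<Psi> p) \<and> bij_betw (\<Psi> p) (fiber LTE p) UNIV)"
    unfolding Ball_def split_paired_All prod.case trivs_LTE_iff
    using openin_over_chart linear_on_lt_triv bij_lt_triv by blast
  have "smooth_fun_on M (over (D \<inter> U) \<inter> over (D' \<inter> U'))
      (\<lambda>p. lt_triv D' \<phi>' U' \<psi>' p (inv_into (fiber LTE p) (lt_triv D \<phi> U \<psi> p) z))"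
    if c: "(D, \<phi>) \<in> base E" and t: "(U, \<psi>) \<in> trivs E" and c': "(D', \<phi>') \<in> base E" and t': "(U', \<psi>') \<in> trivs E"
    for D \<phi> U \<psi> D' \<phi>' U' \<psi>' z
  proof -
    have o: "openin (atlas_topology M) (over (D \<inter> U) \<inter> over (D' \<inter> U'))"
      using openin_over_chart[OF c t] openin_over_chart[OF c' t'] by (rule openin_Int)
    show ?thesis
      by (rule smooth_fun_on_cong[OF preM o, THEN iffD1, rotated, OF smooth_lt_transition[OF c t c' t']])
        (simp add: inv_into_lt_triv[OF c t])
  qed
  then show "\<forall>(S, \<Psi>)\<in>trivs LTE. \<forall>(S', \<Psi>')\<in>trivs LTE. \<forall>z.
      smooth_fun_on M (S \<inter> S') (\<lambda>p. \<Psi>' p (inv_into (fiber LTE p) (\<Psi> p) z))"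
    unfolding Ball_def split_paired_All prod.case trivs_LTE_iff by blast
qed

end


section \<open>Derivatives along the fibres of the dual bundle\<close>

text \<open>The fibre sits in a function space without a topology, so the derivative is taken along
  a real line in it; only the target has to be normed.\<close>

definition fiber_deriv ::
  "('q \<times> ('v \<Rightarrow> real) \<Rightarrow> 'b::real_normed_vector) \<Rightarrow> 'q \<times> ('v \<Rightarrow> real) \<Rightarrow> ('v \<Rightarrow> real) \<Rightarrow> 'b"
  where "fiber_deriv F p \<alpha> = vector_derivative (\<lambda>t. F (fst p, snd p + t *\<^sub>R \<alpha>)) (at 0)"

context anchored_bundle
begin

text \<open>The value 0 on arguments that are not smooth agrees with the convention of
  \<open>chart_vector\<close>, so that a vertical lift is literally a tangent vector.\<close>

definition vlift ::
  "'q \<times> ('v \<Rightarrow> real) \<Rightarrow> ('v \<Rightarrow> real) \<Rightarrow> ('q \<times> ('v \<Rightarrow> real) \<Rightarrow> real) \<Rightarrow> real"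
  where "vlift p \<alpha> = (\<lambda>f. if f \<in> C_inf M then fiber_deriv f p \<alpha> else 0)"

lemma over_line:
  assumes "p \<in> over W" "\<alpha> \<in> fiber Es (fst p)"
  shows "(fst p, snd p + t *\<^sub>R \<alpha>) \<in> over W"
proof -
  have "snd p \<in> fiber Es (fst p)" using assms(1) by (cases p) simp
  then have "snd p + t *\<^sub>R \<alpha> \<in> fiber Es (fst p)"
    using assms(2) by (intro subspace_add subspace_scale subspace_fiber_dual_bundle)
  then show ?thesis using assms(1) by (cases p) simp
qed

lemma over_mono: "W \<subseteq> W' \<Longrightarrow> over W \<subseteq> over W'"
  by (auto simp: chart_dom_def)

lemma over_fst: "p \<in> over W \<Longrightarrow> fst p \<in> W" "p \<in> over W \<Longrightarrow> snd p \<in> fiber Es (fst p)"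
  by (auto simp: chart_dom_def)

lemma carrierM_triv:
  assumes "p \<in> carrier M"
  obtains U \<psi> where "(U, \<psi>) \<in> trivs E" "p \<in> over U"
proof -
  have "fst p \<in> carrier (base E)" "snd p \<in> fiber Es (fst p)"
    using assms by (auto simp: carrierM chart_dom_def)
  then show thesis using vector_bundle_triv_ex[OF E, of "fst p" thesis] that by (cases p) auto
qed

lemma over_triv_chart:
  assumes "(U, \<psi>) \<in> trivs E" "p \<in> over U"
  obtains D \<phi> where "(D, \<phi>) \<in> base E" "p \<in> over (D \<inter> U)"
proof -
  have "fst p \<in> carrier (base E)" using triv_domain(2)[OF E assms(1)] assms(2) by (auto simp: chart_dom_def)
  then obtain D \<phi> where "(D, \<phi>) \<in> base E" "fst p \<in> D" by (rule in_carrierE)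
  then show thesis using that assms(2) by (cases p) auto
qed

lemma over_triv_carrier: "(U, \<psi>) \<in> trivs E \<Longrightarrow> over U \<subseteq> carrier M"
  unfolding carrierM by (rule over_mono) (rule triv_domain(2)[OF E])

context
  fixes D \<phi> U \<psi>
  assumes c: "(D, \<phi>) \<in> base E" and t: "(U, \<psi>) \<in> trivs E"
begin

text \<open>The dual trivialisation is linear on fibres, so a line in the fibre becomes a line in
  the chart with direction \<open>(0, dtriv \<psi> (fst p) \<alpha>)\<close>, and the chain rule
  applies.\<close>

lemma fiber_deriv_chart:
  assumes p: "p \<in> over (D \<inter> U)" "p \<in> W" and \<alpha>: "\<alpha> \<in> fiber Es (fst p)" and F: "smooth_fun_on M W F"
  shows "((\<lambda>t. F (fst p, snd p + t *\<^sub>R \<alpha>)) has_vector_derivative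
      frechet_derivative (\<lambda>z. F (inv_into (over (D \<inter> U)) (chart_map \<phi> (dtriv \<psi>)) z))
        (at (chart_map \<phi> (dtriv \<psi>) p)) (0, dtriv \<psi> (fst p) \<alpha>)) (at 0)"
proof -
  let ?C = "over (D \<inter> U)" and ?\<Phi> = "chart_map \<phi> (dtriv \<psi>)" and ?a = "(0, dtriv \<psi> (fst p) \<alpha>)"
  let ?G = "\<lambda>z. F (inv_into ?C ?\<Phi> z)"
  have q: "fst p \<in> U" using over_fst(1)[OF p(1)] by simp
  have G: "(?G has_derivative frechet_derivative ?G (at (?\<Phi> p))) (at (?\<Phi> p))"
    by (rule smooth_fun_on_has_derivative[OF preM echart_in[OF c t] p F])
  have "((\<lambda>t. ?\<Phi> p + t *\<^sub>R ?a) has_derivative (\<lambda>t. t *\<^sub>R ?a)) (at (0::real))"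
    by (auto intro!: derivative_eq_intros)
  moreover have "(?G has_derivative frechet_derivative ?G (at (?\<Phi> p))) (at (?\<Phi> p + 0 *\<^sub>R ?a))"
    using G by (simp only: scaleR_zero_left add_0_right)
  ultimately have "((\<lambda>t. ?G (?\<Phi> p + t *\<^sub>R ?a)) has_derivative
      (\<lambda>t. frechet_derivative ?G (at (?\<Phi> p)) (t *\<^sub>R ?a))) (at (0::real))"
    by (rule has_derivative_compose)
  then have "((\<lambda>t. ?G (?\<Phi> p + t *\<^sub>R ?a)) has_vector_derivative frechet_derivative ?G (at (?\<Phi> p)) ?a) (at 0)"
    unfolding has_vector_derivative_def linear_cmul[OF has_derivative_linear[OF G]] .
  moreover have "?G (?\<Phi> p + t *\<^sub>R ?a) = F (fst p, snd p + t *\<^sub>R \<alpha>)" for t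
  proof -
    have "dtriv \<psi> (fst p) (1 *\<^sub>R snd p + t *\<^sub>R \<alpha>) = 1 *\<^sub>R dtriv \<psi> (fst p) (snd p) + t *\<^sub>R dtriv \<psi> (fst p) \<alpha>"
      by (rule linear_onD[OF linear_on_dual_triv[OF E t q] over_fst(2)[OF p(1)] \<alpha>])
    then have "?\<Phi> p + t *\<^sub>R ?a = ?\<Phi> (fst p, snd p + t *\<^sub>R \<alpha>)" by (cases p) simp
    then show ?thesis using chart_inv[OF preM echart_in[OF c t] over_line[OF p(1) \<alpha>]] by metis
  qed
  ultimately show ?thesis by simp
qed

lemma fiber_deriv_frechet:
  assumes "p \<in> over (D \<inter> U)" "p \<in> W" "\<alpha> \<in> fiber Es (fst p)" "smooth_fun_on M W F"
  shows "fiber_deriv F p \<alpha> =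
      frechet_derivative (\<lambda>z. F (inv_into (over (D \<inter> U)) (chart_map \<phi> (dtriv \<psi>)) z))
        (at (chart_map \<phi> (dtriv \<psi>) p)) (0, dtriv \<psi> (fst p) \<alpha>)"
  unfolding fiber_deriv_def by (rule vector_derivative_at[OF fiber_deriv_chart[OF assms]])

text \<open>A derivative along lines need not be linear in the direction; here it is, because in a
  chart it is a Frechet derivative.\<close>

lemma fiber_deriv_lincomb:
  assumes p: "p \<in> over (D \<inter> U)" "p \<in> W" and \<alpha>: "\<alpha> \<in> fiber Es (fst p)" "\<beta> \<in> fiber Es (fst p)"
    and F: "smooth_fun_on M W F"
  shows "fiber_deriv F p (a *\<^sub>R \<alpha> + b *\<^sub>R \<beta>) = a *\<^sub>R fiber_deriv F p \<alpha> + b *\<^sub>R fiber_deriv F p \<beta>"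
proof -
  have q: "fst p \<in> U" using over_fst(1)[OF p(1)] by simp
  have mem: "a *\<^sub>R \<alpha> + b *\<^sub>R \<beta> \<in> fiber Es (fst p)"
    using \<alpha> by (intro subspace_add subspace_scale subspace_fiber_dual_bundle)
  let ?L = "frechet_derivative (\<lambda>z. F (inv_into (over (D \<inter> U)) (chart_map \<phi> (dtriv \<psi>)) z))
        (at (chart_map \<phi> (dtriv \<psi>) p))"
  have lin: "linear ?L"
    by (rule has_derivative_linear[OF smooth_fun_on_has_derivative[OF preM echart_in[OF c t] p F]])
  have "?L (0, dtriv \<psi> (fst p) (a *\<^sub>R \<alpha> + b *\<^sub>R \<beta>)) =
      ?L (a *\<^sub>R (0, dtriv \<psi> (fst p) \<alpha>) + b *\<^sub>R (0, dtriv \<psi> (fst p) \<beta>))"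
    using linear_onD[OF linear_on_dual_triv[OF E t q] \<alpha>] by simp
  also have "\<dots> = a *\<^sub>R ?L (0, dtriv \<psi> (fst p) \<alpha>) + b *\<^sub>R ?L (0, dtriv \<psi> (fst p) \<beta>)"
    by (simp only: linear_add[OF lin] linear_cmul[OF lin])
  finally show ?thesis
    unfolding fiber_deriv_frechet[OF p \<alpha>(1) F] fiber_deriv_frechet[OF p \<alpha>(2) F] fiber_deriv_frechet[OF p mem F] .
qed

lemma smooth_fiber_deriv:
  assumes W: "openin (atlas_topology M) W" "W \<subseteq> over (D \<inter> U)" and F: "smooth_fun_on M W F"
    and \<alpha>: "\<And>p. p \<in> W \<Longrightarrow> \<alpha> p \<in> fiber Es (fst p)" "smooth_fun_on M W (\<lambda>p. dtriv \<psi> (fst p) (\<alpha> p))"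
  shows "smooth_fun_on M W (\<lambda>p. fiber_deriv F p (\<alpha> p))"
proof (rule smooth_fun_on_cong[OF preM W(1), THEN iffD2])
  show "fiber_deriv F p (\<alpha> p) =
      frechet_derivative (\<lambda>z. F (inv_into (over (D \<inter> U)) (chart_map \<phi> (dtriv \<psi>)) z))
        (at (chart_map \<phi> (dtriv \<psi>) p)) (0, dtriv \<psi> (fst p) (\<alpha> p))" if "p \<in> W" for p
    using fiber_deriv_frechet[OF _ that \<alpha>(1)[OF that] F] that W(2) by blast
  show "smooth_fun_on M W (\<lambda>p. frechet_derivative (\<lambda>z. F (inv_into (over (D \<inter> U)) (chart_map \<phi> (dtriv \<psi>)) z))
        (at (chart_map \<phi> (dtriv \<psi>) p)) (0, dtriv \<psi> (fst p) (\<alpha> p)))"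
    by (intro smooth_fun_on_chart_derivative[OF preM W(1) echart_in[OF c t] W(2) F] smooth_fun_on_Pair
        smooth_fun_on_const preM W(1) \<alpha>(2))
qed

lemma vlift_chart_vector:
  assumes p: "p \<in> over (D \<inter> U)" and \<alpha>: "\<alpha> \<in> fiber Es (fst p)"
  shows "vlift p \<alpha> = chart_vector M (echart D \<phi> U \<psi>) p (0, dtriv \<psi> (fst p) \<alpha>)"
proof
  fix f
  have "p \<in> carrier M" using p chart_domain_carrier[OF echart_in[OF c t]] by blast
  then show "vlift p \<alpha> f = chart_vector M (echart D \<phi> U \<psi>) p (0, dtriv \<psi> (fst p) \<alpha>) f"
    using fiber_deriv_frechet[OF p _ \<alpha>, of "carrier M" f]
    by (simp add: vlift_def chart_vector_def C_inf_def)
qed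

lemma components_vlift:
  assumes p: "p \<in> over (D \<inter> U)" and \<alpha>: "\<alpha> \<in> fiber Es (fst p)"
  shows "components M (echart D \<phi> U \<psi>) p (vlift p \<alpha>) = (0, dtriv \<psi> (fst p) \<alpha>)"
  unfolding vlift_chart_vector[OF assms] by (rule components_chart_vector[OF mfdM echart_in[OF c t] p])

text \<open>A vertical vector has zero component in \<open>E\<close>, hence zero anchor coefficient.
  In particular it satisfies the defining condition of the fibre.\<close>

lemma vertical_eq_lt_vec:
  assumes p: "p \<in> over (D \<inter> U)" and \<alpha>: "\<alpha> \<in> fiber Es (fst p)"
  shows "(0, vlift p \<alpha>) = lt_vec D \<phi> U \<psi> p (0, dtriv \<psi> (fst p) \<alpha>)"
  using linear_0[OF linear_anchor_coeff[OF c t over_fst(1)[OF p]]] over_fst(1)[OF p]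
    linear_0[OF linear_triv_inv[OF E t, of "fst p"]]
  by (simp add: lt_vec_def vlift_chart_vector[OF p \<alpha>])

text \<open>Since a vertical projection is prescribed on vertical lifts, this reduces all
  information about it to the vectors with vertical coordinate 0.\<close>

lemma lt_vec_split:
  assumes p: "p \<in> over (D \<inter> U)"
  shows "lt_vec D \<phi> U \<psi> p (u, w) =
    lt_vec D \<phi> U \<psi> p (u, 0) + (0, vlift p (riesz_functional (fiber E) \<psi> (fst p) w))"
proof -
  have q: "fst p \<in> U" using over_fst(1)[OF p] by simp
  have lin: "linear (chart_vector M (echart D \<phi> U \<psi>) p)"
    by (rule linear_chart_vector[OF preM echart_in[OF c t] p])
  let ?a = "anchor_coeff D \<phi> \<psi> (fst p) u"
  have "chart_vector M (echart D \<phi> U \<psi>) p (?a, w) =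
      chart_vector M (echart D \<phi> U \<psi>) p (?a, 0) + chart_vector M (echart D \<phi> U \<psi>) p (0, w)"
    using linear_add[OF lin, of "(?a, 0)" "(0, w)"] by simp
  then show ?thesis
    by (simp add: lt_vec_def vlift_chart_vector[OF p riesz_functional_in[OF E t q]]
        dual_triv_riesz_functional[OF E t q])
qed

end

lemma fiber_deriv_has_vector_derivative:
  assumes W: "openin (atlas_topology M) W" and p: "p \<in> W" and \<alpha>: "\<alpha> \<in> fiber Es (fst p)"
    and F: "smooth_fun_on M W F"
  shows "((\<lambda>t. F (fst p, snd p + t *\<^sub>R \<alpha>)) has_vector_derivative fiber_deriv F p \<alpha>) (at 0)"
proof -
  have "p \<in> carrier M" using W p openin_subset topspace_atlas_topology[OF preM] by blast
  then obtain U \<psi> where t: "(U, \<psi>) \<in> trivs E" "p \<in> over U" by (rule carrierM_triv)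
  obtain D \<phi> where c: "(D, \<phi>) \<in> base E" "p \<in> over (D \<inter> U)" using t by (rule over_triv_chart)
  show ?thesis
    using fiber_deriv_chart[OF c(1) t(1) c(2) p \<alpha> F] fiber_deriv_frechet[OF c(1) t(1) c(2) p \<alpha> F] by simp
qed

text \<open>Expands the Riesz vector in the second frame, with coefficients obtained by pairing the
  first one with transition functions of \<open>E\<close>.\<close>

lemma smooth_dual_change:
  assumes t: "(U, \<psi>) \<in> trivs E" and t': "(U', \<psi>') \<in> trivs E"
    and W: "openin (atlas_topology M) W" "W \<subseteq> over (U \<inter> U')"
    and \<alpha>: "\<And>p. p \<in> W \<Longrightarrow> \<alpha> p \<in> fiber Es (fst p)" "smooth_fun_on M W (\<lambda>p. dtriv \<psi> (fst p) (\<alpha> p))"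
  shows "smooth_fun_on M W (\<lambda>p. dtriv \<psi>' (fst p) (\<alpha> p))"
proof (rule smooth_fun_on_cong[OF preM W(1), THEN iffD2])
  have o: "openin (atlas_topology (base E)) (U' \<inter> U)"
    using triv_domain(1)[OF E t] triv_domain(1)[OF E t'] by blast
  have sm: "smooth_fun_on M W (\<lambda>p. \<psi> (fst p) (triv_inv E \<psi>' (fst p) b))" for b
    by (rule smooth_fun_on_subset[OF smooth_pullback[OF o smooth_transition_const[OF E t' t]]])
      (use W(2) in \<open>simp add: Int_commute\<close>)
  show "smooth_fun_on M W (\<lambda>p. \<Sum>b\<in>onb. inner (dtriv \<psi> (fst p) (\<alpha> p)) (\<psi> (fst p) (triv_inv E \<psi>' (fst p) b)) *\<^sub>R b)"
    by (intro smooth_fun_on_sum smooth_fun_on_scaleR smooth_fun_on_inner smooth_fun_on_const sm preM W(1) \<alpha>(2))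
  fix p assume p: "p \<in> W"
  then have q: "fst p \<in> U" "fst p \<in> U'" using W(2) over_fst(1) by blast+
  have lin: "linear_on (fiber E (fst p)) (\<alpha> p)" using \<alpha>(1)[OF p] by (simp add: fiber_dual_bundle_iff)
  show "dtriv \<psi>' (fst p) (\<alpha> p) =
      (\<Sum>b\<in>onb. inner (dtriv \<psi> (fst p) (\<alpha> p)) (\<psi> (fst p) (triv_inv E \<psi>' (fst p) b)) *\<^sub>R b)"
    unfolding dual_triv_expand[OF E t' q(2) lin]
    using dual_triv_inner[OF E t q(1) lin] triv_inv_in[OF E t' q(2)] by simp
qed


section \<open>A vertical projection\<close>

text \<open>Smoothness is demanded only on vectors \<open>(u, 0)\<close> paired with frame vectors:
  on vertical lifts the values are prescribed, and linearity determines the rest.\<close>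

definition vertical_projection where
  "vertical_projection K \<longleftrightarrow>
    (\<forall>p\<in>carrier M. linear_on (fiber LTE p) (K p) \<and>
      (\<forall>v\<in>fiber LTE p. K p v \<in> fiber Es (fst p)) \<and>
      (\<forall>\<alpha>\<in>fiber Es (fst p). K p (0, vlift p \<alpha>) = \<alpha>)) \<and>
    (\<forall>D \<phi> U \<psi> u b. (D, \<phi>) \<in> base E \<longrightarrow> (U, \<psi>) \<in> trivs E \<longrightarrow>
      smooth_fun_on M (over (D \<inter> U)) (\<lambda>p. K p (lt_vec D \<phi> U \<psi> p (u, 0)) (triv_inv E \<psi> (fst p) b)))"

text \<open>In each bundle chart the vertical coordinate gives such a projection. Being the identity
  on vertical lifts is an affine condition, so it survives averaging with weights that sum to
  1.\<close>

lemma vertical_projection_exists: "\<exists>K. vertical_projection K"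
proof (cases "M = {}")
  \<comment> \<open>The partition of unity requires a nonempty atlas; over an empty one all
    conditions are vacuous.\<close>
  case True
  then have "carrier M = {}" by (auto simp: carrier_def)
  moreover have "False" if "(D, \<phi>) \<in> base E" "(U, \<psi>) \<in> trivs E" for D \<phi> U \<psi>
    using echart_in[OF that] True by simp
  ultimately show ?thesis unfolding vertical_projection_def by blast
next
  case False
  obtain C :: "nat \<Rightarrow> _" and g :: "nat \<Rightarrow> _" and Z :: "nat \<Rightarrow> _"
    where C: "\<And>n. C n \<in> M" and g: "\<And>n. g n \<in> C_inf M" and Z: "\<And>n. closedin (atlas_topology M) (Z n)"
    "\<And>n. Z n \<subseteq> fst (C n)" and gZ: "\<And>n q. q \<notin> Z n \<Longrightarrow> g n q = 0"
    and fin: "\<And>p. p \<in> carrier M \<Longrightarrow> \<exists>W N. openin (atlas_topology M) W \<and> p \<in> W \<and>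
        (\<forall>q\<in>W. (\<forall>n\<ge>N. g n q = 0) \<and> (\<Sum>n<N. g n q) = 1)"
  proof (rule partition_of_unity[OF mfdM False], goal_cases)
    case (1 c g Z)
    show ?case by (rule 1(1)[OF 1(2-7)])
  qed
  have "\<exists>D \<phi> U \<psi>. (D, \<phi>) \<in> base E \<and> (U, \<psi>) \<in> trivs E \<and> C n = echart D \<phi> U \<psi>" for n
  proof -
    obtain C' \<Phi> where C': "C n = (C', \<Phi>)" by (cases "C n")
    show ?thesis by (rule M_cases[OF C[of n, unfolded C']]) (use C' in blast)
  qed
  then obtain D \<phi> U \<psi> where c: "\<And>n. (D n, \<phi> n) \<in> base E" and t: "\<And>n. (U n, \<psi> n) \<in> trivs E"
    and Ceq: "\<And>n. C n = echart (D n) (\<phi> n) (U n) (\<psi> n)" by metis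
  define k where "k n p v = snd (lt_triv (D n) (\<phi> n) (U n) (\<psi> n) p v)" for n p v
  \<comment> \<open>Only indices with nonzero weight enter, because \<open>k n p\<close> is
    meaningful only for \<open>p\<close> in the \<open>n\<close>th chart. The value 0 outside the
    fibre makes the result an element of the dual fibre.\<close>
  define K where "K p v = (\<lambda>u. if u \<in> fiber E (fst p)
    then \<Sum>n\<in>{n. g n p \<noteq> 0}. g n p * inner (k n p v) (\<psi> n (fst p) u) else 0)" for p v
  have supp: "p \<in> over (D n \<inter> U n)" if "g n p \<noteq> 0" for n p
    using that gZ[of p n] Z(2)[of n] Ceq[of n] by auto
  have sum1: "(\<Sum>n\<in>{n. g n p \<noteq> 0}. g n p) = 1" if p: "p \<in> carrier M" for p
  proof -
    obtain N where N: "\<forall>n\<ge>N. g n p = 0" "(\<Sum>n<N. g n p) = 1" using fin[OF p] by blast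
    have "(\<Sum>n\<in>{n. g n p \<noteq> 0}. g n p) = (\<Sum>n<N. g n p)"
      using N(1) by (intro sum.mono_neutral_left) (auto simp: not_le[symmetric])
    then show ?thesis using N(2) by simp
  qed
  have lin: "linear_on (fiber LTE p) (K p)" if p: "p \<in> carrier M" for p
    unfolding linear_on_def
  proof (intro ballI allI ext)
    fix v w a b u assume vw: "v \<in> fiber LTE p" "w \<in> fiber LTE p"
    have "g n p * inner (k n p (a *\<^sub>R v + b *\<^sub>R w)) (\<psi> n (fst p) u) =
        a * (g n p * inner (k n p v) (\<psi> n (fst p) u)) + b * (g n p * inner (k n p w) (\<psi> n (fst p) u))"
      if "n \<in> {n. g n p \<noteq> 0}" for n
      using linear_onD[OF linear_on_lt_triv[OF c[of n] t[of n] supp[of n p]] vw, of a b] that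
      by (simp add: k_def inner_add_left algebra_simps)
    then show "K p (a *\<^sub>R v + b *\<^sub>R w) u = (a *\<^sub>R K p v + b *\<^sub>R K p w) u"
      by (simp add: K_def scaleR_fun_def sum.distrib sum_distrib_left)
  qed
  have mem: "K p v \<in> fiber Es (fst p)" if p: "p \<in> carrier M" for p v
    unfolding fiber_dual_bundle_iff linear_on_def
  proof (intro conjI ballI allI impI)
    have F: "subspace (fiber E (fst p))"
      using p vector_bundle_subspace[OF E] over_fst(1) unfolding carrierM by blast
    fix u w a b assume uw: "u \<in> fiber E (fst p)" "w \<in> fiber E (fst p)"
    have "g n p * inner (k n p v) (\<psi> n (fst p) (a *\<^sub>R u + b *\<^sub>R w)) =
        a * (g n p * inner (k n p v) (\<psi> n (fst p) u)) + b * (g n p * inner (k n p v) (\<psi> n (fst p) w))"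
      if "n \<in> {n. g n p \<noteq> 0}" for n
      using linear_onD[OF triv_linear_on[OF E t[of n]] uw, of a b] over_fst(1)[OF supp[of n p]] that
      by (simp add: inner_add_right algebra_simps)
    then show "K p v (a *\<^sub>R u + b *\<^sub>R w) = a *\<^sub>R K p v u + b *\<^sub>R K p v w"
      using uw subspace_add[OF F subspace_scale[OF F uw(1)] subspace_scale[OF F uw(2)]]
      by (simp add: K_def sum.distrib sum_distrib_left)
  qed (simp add: K_def)
  have vert: "K p (0, vlift p \<alpha>) = \<alpha>" if p: "p \<in> carrier M" and \<alpha>: "\<alpha> \<in> fiber Es (fst p)" for p \<alpha>
  proof
    fix u
    \<comment> \<open>Whatever the chart, the vertical coordinate of the lift of \<alpha> is the
      Riesz vector of \<alpha>, so all summands evaluate \<alpha> at \<open>u\<close> and differ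
      only in their weights.\<close>
    have "inner (k n p (0, vlift p \<alpha>)) (\<psi> n (fst p) u) = \<alpha> u"
      if "n \<in> {n. g n p \<noteq> 0}" "u \<in> fiber E (fst p)" for n
    proof -
      have pn: "p \<in> over (D n \<inter> U n)" using supp that by simp
      then have "fst p \<in> U n" using over_fst(1) by blast
      then show ?thesis
        using dual_triv_inner[OF E t, of "fst p" n \<alpha> u] \<alpha> that(2)
        unfolding k_def vertical_eq_lt_vec[OF c t pn \<alpha>] lt_triv_vec[OF c t pn]
        by (simp add: fiber_dual_bundle_iff)
    qed
    then show "K p (0, vlift p \<alpha>) u = \<alpha> u"
      using sum1[OF p] \<alpha> by (auto simp: K_def fiber_dual_bundle_iff sum_distrib_right[symmetric])
  qed
  have smooth: "smooth_fun_on M (over (D' \<inter> U')) (\<lambda>p. K p (lt_vec D' \<phi>' U' \<psi>' p (u, 0)) (triv_inv E \<psi>' (fst p) b))"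
    if c': "(D', \<phi>') \<in> base E" and t': "(U', \<psi>') \<in> trivs E" for D' \<phi>' U' \<psi>' u b
  proof (rule smooth_fun_on_local[OF preM])
    let ?S = "over (D' \<inter> U')"
    have oS: "openin (atlas_topology M) ?S" by (rule openin_over_chart[OF c' t'])
    let ?h = "\<lambda>n p. inner (k n p (lt_vec D' \<phi>' U' \<psi>' p (u, 0))) (\<psi> n (fst p) (triv_inv E \<psi>' (fst p) b))"
    \<comment> \<open>\<open>?h n\<close> is controlled only on the overlap with the
      \<open>n\<close>th chart; the closed support \<open>Z n\<close> inside that chart makes the
      weighted term smooth on all of \<open>?S\<close>.\<close>
    have hn: "smooth_fun_on M ?S (\<lambda>p. g n p *\<^sub>R ?h n p)" for n
    proof (rule smooth_fun_on_cutoff[OF preM oS openin_over_chart[OF c t] _ Z(1) _ gZ])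
      show "smooth_fun_on M ?S (g n)"
        using g[of n] smooth_fun_on_subset chart_domain_carrier[OF echart_in[OF c' t']]
        unfolding C_inf_def by blast
      show "Z n \<subseteq> over (D n \<inter> U n)" using Z(2)[of n] Ceq[of n] by simp
      let ?SV = "?S \<inter> over (D n \<inter> U n)"
      have o: "openin (atlas_topology M) ?SV"
        using oS openin_over_chart[OF c t] by (rule openin_Int)
      have oQ: "openin (atlas_topology (base E)) (U' \<inter> U n)"
        using triv_domain(1)[OF E t] triv_domain(1)[OF E t'] by blast
      have "smooth_fun_on M ?SV (\<lambda>p. \<psi> n (fst p) (triv_inv E \<psi>' (fst p) b))"
        by (rule smooth_fun_on_subset[OF smooth_pullback[OF oQ smooth_transition_const[OF E t' t]]])
          (auto simp: chart_dom_def)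
      then show "smooth_fun_on M ?SV (?h n)"
        unfolding k_def by (intro smooth_fun_on_inner smooth_fun_on_snd smooth_lt_transition c t c' t' preM o)
    qed
    fix p assume p: "p \<in> ?S"
    then have "p \<in> carrier M" using chart_domain_carrier[OF echart_in[OF c' t']] by blast
    from fin[OF this] obtain W N where W: "openin (atlas_topology M) W" "p \<in> W"
      and N: "\<forall>q\<in>W. (\<forall>n\<ge>N. g n q = 0) \<and> (\<Sum>n<N. g n q) = 1"
      by (elim exE conjE) (rule that)
    have o: "openin (atlas_topology M) (?S \<inter> W)" using oS W(1) by (rule openin_Int)
    have "smooth_fun_on M (?S \<inter> W) (\<lambda>p. \<Sum>n<N. g n p *\<^sub>R ?h n p)"
      by (intro smooth_fun_on_sum smooth_fun_on_subset[OF hn] preM o) auto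
    then have "smooth_fun_on M (?S \<inter> W) (\<lambda>p. K p (lt_vec D' \<phi>' U' \<psi>' p (u, 0)) (triv_inv E \<psi>' (fst p) b))"
    proof (rule smooth_fun_on_cong[OF preM o, THEN iffD1, rotated])
      fix q assume q: "q \<in> ?S \<inter> W"
      then have "fst q \<in> U'" using over_fst(1) by blast
      then have "triv_inv E \<psi>' (fst q) b \<in> fiber E (fst q)" by (rule triv_inv_in[OF E t'])
      \<comment> \<open>The index set varies with the point; padding with zero terms replaces it by
        a range whose length is constant on \<open>W\<close>.\<close>
      moreover have "(\<Sum>n\<in>{n. g n q \<noteq> 0}. g n q *\<^sub>R ?h n q) = (\<Sum>n<N. g n q *\<^sub>R ?h n q)"
        using N q by (intro sum.mono_neutral_left) (auto simp: not_le[symmetric])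
      ultimately show "(\<Sum>n<N. g n q *\<^sub>R ?h n q) = K q (lt_vec D' \<phi>' U' \<psi>' q (u, 0)) (triv_inv E \<psi>' (fst q) b)"
        by (simp add: K_def)
    qed
    then show "\<exists>W'. openin (atlas_topology M) W' \<and> p \<in> W' \<and>
        smooth_fun_on M W' (\<lambda>p. K p (lt_vec D' \<phi>' U' \<psi>' p (u, 0)) (triv_inv E \<psi>' (fst p) b))"
      using o p W(2) by blast
  qed
  show ?thesis
    unfolding vertical_projection_def using lin mem vert smooth by blast
qed

end


section \<open>The exact symplectic structure\<close>

locale split_anchored_bundle = anchored_bundle E \<rho>
  for E :: "('q, 'm::fin_dim_inner, 'v::real_vector, 'k::fin_dim_inner) vbundle"
    and \<rho> :: "'q \<Rightarrow> 'v \<Rightarrow> ('q \<Rightarrow> real) \<Rightarrow> real" +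
  fixes K
  assumes K: "vertical_projection K"
begin

lemma K_linear_on: "p \<in> carrier M \<Longrightarrow> linear_on (fiber LTE p) (K p)"
  and K_in: "p \<in> carrier M \<Longrightarrow> v \<in> fiber LTE p \<Longrightarrow> K p v \<in> fiber Es (fst p)"
  and K_vertical: "p \<in> carrier M \<Longrightarrow> \<alpha> \<in> fiber Es (fst p) \<Longrightarrow> K p (0, vlift p \<alpha>) = \<alpha>"
  and K_smooth: "(D, \<phi>) \<in> base E \<Longrightarrow> (U, \<psi>) \<in> trivs E \<Longrightarrow>
      smooth_fun_on M (over (D \<inter> U)) (\<lambda>p. K p (lt_vec D \<phi> U \<psi> p (u, 0)) (triv_inv E \<psi> (fst p) b))"
  using K unfolding vertical_projection_def by blast+

text \<open>
  In these fibre coordinates the left tangent bundle is the sum of the pullbacks of \<open>E\<close> and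
  \<open>E\<^sup>*\<close>, so the transition functions are constant along the fibres of \<open>E\<^sup>*\<close>.
\<close>

definition adapted ::
  "('q \<Rightarrow> 'v \<Rightarrow> 'k) \<Rightarrow> 'q \<times> ('v \<Rightarrow> real) \<Rightarrow> 'v \<times> (('q \<times> ('v \<Rightarrow> real) \<Rightarrow> real) \<Rightarrow> real) \<Rightarrow> 'k \<times> 'k"
  where "adapted \<psi> p v = (\<psi> (fst p) (fst v), dtriv \<psi> (fst p) (K p v))"

lemma fst_in: "v \<in> fiber LTE p \<Longrightarrow> fst v \<in> fiber E (fst p)"
  using fiber_LTE_iff[of "fst v" "snd v" "fst p" "snd p"] by simp

context
  fixes U \<psi>
  assumes t: "(U, \<psi>) \<in> trivs E"
begin

lemma K_dtriv_inner:
  assumes p: "p \<in> over U" and v: "v \<in> fiber LTE p" and e: "e \<in> fiber E (fst p)"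
  shows "K p v e = inner (snd (adapted \<psi> p v)) (\<psi> (fst p) e)"
  using dual_triv_inner[OF E t over_fst(1)[OF p] _ e] K_in[OF _ v] over_triv_carrier[OF t] p
  by (auto simp: adapted_def fiber_dual_bundle_iff)

lemma adapted_linear_on:
  assumes p: "p \<in> over U"
  shows "linear_on (fiber LTE p) (adapted \<psi> p)"
  unfolding linear_on_def
proof (intro ballI allI)
  have pM: "p \<in> carrier M" using p over_triv_carrier[OF t] by blast
  note q = over_fst(1)[OF p]
  fix v w a b assume vw: "v \<in> fiber LTE p" "w \<in> fiber LTE p"
  show "adapted \<psi> p (a *\<^sub>R v + b *\<^sub>R w) = a *\<^sub>R adapted \<psi> p v + b *\<^sub>R adapted \<psi> p w"
    using linear_onD[OF triv_linear_on[OF E t q] fst_in[OF vw(1)] fst_in[OF vw(2)], of a b]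
      linear_onD[OF K_linear_on[OF pM] vw, of a b]
      linear_onD[OF linear_on_dual_triv[OF E t q] K_in[OF pM vw(1)] K_in[OF pM vw(2)], of a b]
    by (simp add: adapted_def)
qed

context
  fixes D \<phi>
  assumes c: "(D, \<phi>) \<in> base E"
begin

text \<open>The connection coefficients of \<open>K\<close> in the chart: its value on the vector
  with vertical coordinate 0.\<close>

definition shear :: "'q \<times> ('v \<Rightarrow> real) \<Rightarrow> 'k \<Rightarrow> 'k"
  where "shear p u = dtriv \<psi> (fst p) (K p (lt_vec D \<phi> U \<psi> p (u, 0)))"

lemma linear_shear:
  assumes p: "p \<in> over (D \<inter> U)"
  shows "linear (shear p)"
proof -
  have pU: "p \<in> over U" using p over_mono[of "D \<inter> U" U] by blast
  have tV: "(over (D \<inter> U), lt_triv D \<phi> U \<psi>) \<in> trivs LTE" using c t trivs_LTE_iff by blast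
  have lin: "linear (\<lambda>z. adapted \<psi> p (lt_vec D \<phi> U \<psi> p z))"
    using linear_on_triv_inv[OF vector_bundle_LTE tV p adapted_linear_on[OF pU]]
    unfolding inv_into_lt_triv[OF c t p] .
  show ?thesis
  proof (rule linearI)
    show "shear p (u + w) = shear p u + shear p w" for u w
      using linear_add[OF lin, of "(u, 0)" "(w, 0)"] by (simp add: shear_def adapted_def)
    show "shear p (r *\<^sub>R u) = r *\<^sub>R shear p u" for u r
      using linear_cmul[OF lin, of r "(u, 0)"] by (simp add: shear_def adapted_def)
  qed
qed

text \<open>The smoothness assumption on \<open>K\<close> concerns fixed basis vectors in both
  slots; linearity in \<open>u\<close> and the expansion of the Riesz vector extend it to varying
  \<open>u\<close>.\<close>

lemma smooth_shear:
  assumes u: "smooth_fun_on M (over (D \<inter> U)) u"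
  shows "smooth_fun_on M (over (D \<inter> U)) (\<lambda>p. shear p (u p))"
proof -
  let ?S = "over (D \<inter> U)"
  have o: "openin (atlas_topology M) ?S" by (rule openin_over_chart[OF c t])
  have 1: "smooth_fun_on M ?S (\<lambda>p. shear p b)" for b
  proof (rule smooth_fun_on_cong[OF preM o, THEN iffD1, rotated])
    show "smooth_fun_on M ?S (\<lambda>p. \<Sum>b'\<in>onb. K p (lt_vec D \<phi> U \<psi> p (b, 0)) (triv_inv E \<psi> (fst p) b') *\<^sub>R b')"
      by (intro smooth_fun_on_sum smooth_fun_on_scaleR smooth_fun_on_const K_smooth c t preM o)
    fix p assume p: "p \<in> ?S"
    have pM: "p \<in> carrier M" using p chart_domain_carrier[OF echart_in[OF c t]] by blast
    have "linear_on (fiber E (fst p)) (K p (lt_vec D \<phi> U \<psi> p (b, 0)))"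
      using K_in[OF pM lt_vec_in[OF c t p]] by (simp add: fiber_dual_bundle_iff)
    then show "(\<Sum>b'\<in>onb. K p (lt_vec D \<phi> U \<psi> p (b, 0)) (triv_inv E \<psi> (fst p) b') *\<^sub>R b') = shear p b"
      unfolding shear_def using dual_triv_expand[OF E t, of "fst p"] over_fst(1)[OF p] by simp
  qed
  have "smooth_fun_on M ?S (\<lambda>p. \<Sum>b\<in>onb. inner (u p) b *\<^sub>R shear p b)"
    by (intro smooth_fun_on_sum smooth_fun_on_scaleR smooth_fun_on_inner smooth_fun_on_const 1 u preM o)
  then show ?thesis
    by (rule smooth_fun_on_cong[OF preM o, THEN iffD1, rotated]) (simp add: linear_onb_expand[OF linear_shear])
qed

text \<open>Splitting off the vertical lift, which \<open>K\<close> reproduces, shows that the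
  passage to adapted coordinates is the triangular map
  \<open>(u, w) \<mapsto> (u, w + shear p u)\<close>.\<close>

lemma adapted_lt_vec:
  assumes p: "p \<in> over (D \<inter> U)"
  shows "adapted \<psi> p (lt_vec D \<phi> U \<psi> p (u, w)) = (u, w + shear p u)"
proof -
  have q: "fst p \<in> U" using over_fst(1)[OF p] by simp
  have pM: "p \<in> carrier M" using p chart_domain_carrier[OF echart_in[OF c t]] by blast
  let ?\<alpha> = "riesz_functional (fiber E) \<psi> (fst p) w"
  have \<alpha>: "?\<alpha> \<in> fiber Es (fst p)" by (rule riesz_functional_in[OF E t q])
  have "(0, vlift p ?\<alpha>) \<in> fiber LTE p"
    unfolding vertical_eq_lt_vec[OF c t p \<alpha>] by (rule lt_vec_in[OF c t p])
  then have "K p (lt_vec D \<phi> U \<psi> p (u, w)) = K p (lt_vec D \<phi> U \<psi> p (u, 0)) + ?\<alpha>"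
    unfolding lt_vec_split[OF c t p, of u w]
    using linear_on_plus[OF K_linear_on[OF pM] lt_vec_in[OF c t p]] K_vertical[OF pM \<alpha>] by simp
  moreover have "dtriv \<psi> (fst p) (K p (lt_vec D \<phi> U \<psi> p (u, 0)) + ?\<alpha>) = shear p u + w"
    using linear_on_plus[OF linear_on_dual_triv[OF E t q] K_in[OF pM lt_vec_in[OF c t p]] \<alpha>]
    by (simp add: shear_def dual_triv_riesz_functional[OF E t q])
  moreover have "\<psi> (fst p) (fst (lt_vec D \<phi> U \<psi> p (u, w))) = u"
    by (simp add: lt_vec_def triv_inv_right[OF E t q])
  ultimately show ?thesis by (simp add: adapted_def add.commute)
qed

lemma adapted_eq_lt_triv:
  assumes p: "p \<in> over (D \<inter> U)" and v: "v \<in> fiber LTE p"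
  shows "adapted \<psi> p v = (fst (lt_triv D \<phi> U \<psi> p v),
      snd (lt_triv D \<phi> U \<psi> p v) + shear p (fst (lt_triv D \<phi> U \<psi> p v)))"
  using adapted_lt_vec[OF p, of "fst (lt_triv D \<phi> U \<psi> p v)" "snd (lt_triv D \<phi> U \<psi> p v)"]
    lt_vec_triv[OF c t p v] by simp

text \<open>The triangular change of coordinates and its inverse, which subtracts the shear, are
  both smooth, so either system describes the same smooth sections.\<close>

lemma smooth_adapted_iff:
  assumes s: "\<And>p. p \<in> over (D \<inter> U) \<Longrightarrow> s p \<in> fiber LTE p"
  shows "smooth_fun_on M (over (D \<inter> U)) (\<lambda>p. adapted \<psi> p (s p)) \<longleftrightarrow>
    smooth_fun_on M (over (D \<inter> U)) (\<lambda>p. lt_triv D \<phi> U \<psi> p (s p))" (is "?L \<longleftrightarrow> ?R")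
proof
  let ?S = "over (D \<inter> U)" and ?z = "\<lambda>p. lt_triv D \<phi> U \<psi> p (s p)" and ?y = "\<lambda>p. adapted \<psi> p (s p)"
  have o: "openin (atlas_topology M) ?S" by (rule openin_over_chart[OF c t])
  note yz = adapted_eq_lt_triv[OF _ s]
  {
    assume ?R
    then have "smooth_fun_on M ?S (\<lambda>p. (fst (?z p), snd (?z p) + shear p (fst (?z p))))"
      by (intro smooth_fun_on_Pair smooth_fun_on_add smooth_shear smooth_fun_on_fst smooth_fun_on_snd preM o)
    then show ?L
      by (rule smooth_fun_on_cong[OF preM o, THEN iffD1, rotated]) (simp add: yz)
  next
    assume ?L
    then have "smooth_fun_on M ?S (\<lambda>p. (fst (?y p), snd (?y p) - shear p (fst (?y p))))"
      by (intro smooth_fun_on_Pair smooth_fun_on_diff smooth_shear smooth_fun_on_fst smooth_fun_on_snd preM o)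
    then show ?R
      by (rule smooth_fun_on_cong[OF preM o, THEN iffD1, rotated]) (simp add: yz)
  }
qed

end

lemma bij_adapted:
  assumes p: "p \<in> over U"
  shows "bij_betw (adapted \<psi> p) (fiber LTE p) UNIV"
proof -
  obtain D \<phi> where c: "(D, \<phi>) \<in> base E" "p \<in> over (D \<inter> U)" using t p by (rule over_triv_chart)
  show ?thesis
  proof (rule bij_betw_byWitness[where f' = "\<lambda>y. lt_vec D \<phi> U \<psi> p (fst y, snd y - shear D \<phi> p (fst y))"])
    show "\<forall>v\<in>fiber LTE p. lt_vec D \<phi> U \<psi> p (fst (adapted \<psi> p v),
        snd (adapted \<psi> p v) - shear D \<phi> p (fst (adapted \<psi> p v))) = v"
      using lt_vec_triv[OF c(1) t c(2)] by (simp add: adapted_eq_lt_triv[OF c])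
  qed (auto simp: adapted_lt_vec[OF c] lt_vec_in[OF c(1) t c(2)])
qed

abbreviation "adapted_inv p \<equiv> inv_into (fiber LTE p) (adapted \<psi> p)"

lemma adapted_inv_in: "p \<in> over U \<Longrightarrow> adapted_inv p y \<in> fiber LTE p"
  using bij_adapted by (metis UNIV_I bij_betw_imp_surj_on inv_into_into)

lemma adapted_inv_right: "p \<in> over U \<Longrightarrow> adapted \<psi> p (adapted_inv p y) = y"
  using bij_adapted by (metis UNIV_I bij_betw_inv_into_right)

lemma adapted_inj: "p \<in> over U \<Longrightarrow> v \<in> fiber LTE p \<Longrightarrow> w \<in> fiber LTE p \<Longrightarrow> adapted \<psi> p v = adapted \<psi> p w \<Longrightarrow> v = w"
  using bij_adapted by (metis bij_betw_inv_into_left)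

end

text \<open>Replaces the given trivialisations by adapted coordinates for all later work. These need
  no chart of the base and are available over the whole of \<open>over U\<close>.\<close>

lemma adapted_sections_iff:
  "s \<in> sections LTE \<longleftrightarrow> (\<forall>p\<in>carrier M. s p \<in> fiber LTE p) \<and> (\<forall>p. p \<notin> carrier M \<longrightarrow> s p = 0) \<and>
    (\<forall>U \<psi>. (U, \<psi>) \<in> trivs E \<longrightarrow> smooth_fun_on M (over U) (\<lambda>p. adapted \<psi> p (s p)))"
proof -
  have "(\<forall>S \<Psi>. (S, \<Psi>) \<in> trivs LTE \<longrightarrow> smooth_fun_on M S (\<lambda>p. \<Psi> p (s p))) \<longleftrightarrow>
      (\<forall>U \<psi>. (U, \<psi>) \<in> trivs E \<longrightarrow> smooth_fun_on M (over U) (\<lambda>p. adapted \<psi> p (s p)))" (is "?L \<longleftrightarrow> ?R")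
    if s: "\<forall>p\<in>carrier M. s p \<in> fiber LTE p"
  proof -
    have s': "s p \<in> fiber LTE p" if "(D, \<phi>) \<in> base E" "(U, \<psi>) \<in> trivs E" "p \<in> over (D \<inter> U)" for p D \<phi> U \<psi>
      using s that chart_domain_carrier[OF echart_in[OF that(1,2)]] by blast
    show ?thesis
    proof
      assume L: ?L
      show ?R
      proof (intro allI impI)
        fix U \<psi> assume t: "(U, \<psi>) \<in> trivs E"
        show "smooth_fun_on M (over U) (\<lambda>p. adapted \<psi> p (s p))"
        proof (rule smooth_fun_on_local[OF preM])
          fix p assume "p \<in> over U"
          with t obtain D \<phi> where c: "(D, \<phi>) \<in> base E" "p \<in> over (D \<inter> U)" by (rule over_triv_chart)
          have "(over (D \<inter> U), lt_triv D \<phi> U \<psi>) \<in> trivs LTE" using c(1) t trivs_LTE_iff by blast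
          then have "smooth_fun_on M (over (D \<inter> U)) (\<lambda>p. lt_triv D \<phi> U \<psi> p (s p))" using L by blast
          then have "smooth_fun_on M (over (D \<inter> U)) (\<lambda>p. adapted \<psi> p (s p))"
            using smooth_adapted_iff[OF t c(1), of s] s'[OF c(1) t] by blast
          then show "\<exists>W'. openin (atlas_topology M) W' \<and> p \<in> W' \<and> smooth_fun_on M W' (\<lambda>p. adapted \<psi> p (s p))"
            using openin_over_chart[OF c(1) t] c(2) by blast
        qed
      qed
    next
      assume R: ?R
      show ?L
      proof (intro allI impI)
        fix S \<Psi> assume "(S, \<Psi>) \<in> trivs LTE"
        then obtain D \<phi> U \<psi> where c: "(D, \<phi>) \<in> base E" and t: "(U, \<psi>) \<in> trivs E"
          and S: "S = over (D \<inter> U)" "\<Psi> = lt_triv D \<phi> U \<psi>" unfolding trivs_LTE_iff by blast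
        have "smooth_fun_on M (over (D \<inter> U)) (\<lambda>p. adapted \<psi> p (s p))"
          by (rule smooth_fun_on_subset[OF R[rule_format, OF t] over_mono]) auto
        then show "smooth_fun_on M S (\<lambda>p. \<Psi> p (s p))"
          unfolding S using smooth_adapted_iff[OF t c, of s] s'[OF c t] by blast
      qed
    qed
  qed
  then show ?thesis unfolding sections_iff[OF vector_bundle_LTE] base_LTE by blast
qed

lemma section_in: "s \<in> sections LTE \<Longrightarrow> p \<in> carrier M \<Longrightarrow> s p \<in> fiber LTE p"
  and section_outside: "s \<in> sections LTE \<Longrightarrow> p \<notin> carrier M \<Longrightarrow> s p = 0"
  and section_smooth: "s \<in> sections LTE \<Longrightarrow> (U, \<psi>) \<in> trivs E \<Longrightarrow> smooth_fun_on M (over U) (\<lambda>p. adapted \<psi> p (s p))"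
  unfolding adapted_sections_iff by blast+

lemma sections_eqI:
  assumes s: "s \<in> sections LTE" "s' \<in> sections LTE"
    and eq: "\<And>U \<psi> p. (U, \<psi>) \<in> trivs E \<Longrightarrow> p \<in> over U \<Longrightarrow> adapted \<psi> p (s p) = adapted \<psi> p (s' p)"
  shows "s = s'"
proof
  fix p
  show "s p = s' p"
  proof (cases "p \<in> carrier M")
    case True
    then obtain U \<psi> where "(U, \<psi>) \<in> trivs E" "p \<in> over U" by (rule carrierM_triv)
    then show ?thesis using adapted_inj eq section_in[OF s(1) True] section_in[OF s(2) True] by blast
  qed (simp add: section_outside[OF s(1)] section_outside[OF s(2)])
qed

section \<open>The bracket from derivatives along the fibres\<close>

definition sec_deriv where
  "sec_deriv \<psi> s p \<alpha> = fiber_deriv (\<lambda>r. adapted \<psi> r (s r)) p \<alpha>"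

definition local_bracket where
  "local_bracket \<psi> s s' p = sec_deriv \<psi> s' p (K p (s p)) - sec_deriv \<psi> s p (K p (s' p))"

text \<open>Defined pointwise through an arbitrary choice of trivialisation;
  \<open>local_bracket_transition\<close> shows that the choice does not matter. The value 0 outside
  the base is the convention for sections.\<close>

definition bracket where
  "bracket s s' p = (if p \<in> carrier M
    then let \<psi> = (SOME \<psi>. \<exists>U. (U, \<psi>) \<in> trivs E \<and> p \<in> over U)
      in inv_into (fiber LTE p) (adapted \<psi> p) (local_bracket \<psi> s s' p) else 0)"

definition vanchor where "vanchor p v = vlift p (K p v)"

lemma sec_deriv_has:
  assumes t: "(U, \<psi>) \<in> trivs E" and p: "p \<in> over U" and s: "s \<in> sections LTE" and \<alpha>: "\<alpha> \<in> fiber Es (fst p)"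
  shows "((\<lambda>t. adapted \<psi> (fst p, snd p + t *\<^sub>R \<alpha>) (s (fst p, snd p + t *\<^sub>R \<alpha>)))
    has_vector_derivative sec_deriv \<psi> s p \<alpha>) (at 0)"
  unfolding sec_deriv_def
  by (rule fiber_deriv_has_vector_derivative[OF openin_over_triv[OF t] p \<alpha> section_smooth[OF s t]])

lemma sec_deriv_lincomb:
  assumes t: "(U, \<psi>) \<in> trivs E" and p: "p \<in> over U" and s: "s \<in> sections LTE"
    and \<alpha>: "\<alpha> \<in> fiber Es (fst p)" "\<beta> \<in> fiber Es (fst p)"
  shows "sec_deriv \<psi> s p (a *\<^sub>R \<alpha> + b *\<^sub>R \<beta>) = a *\<^sub>R sec_deriv \<psi> s p \<alpha> + b *\<^sub>R sec_deriv \<psi> s p \<beta>"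
proof -
  obtain D \<phi> where c: "(D, \<phi>) \<in> base E" "p \<in> over (D \<inter> U)" using t p by (rule over_triv_chart)
  show ?thesis
    unfolding sec_deriv_def by (rule fiber_deriv_lincomb[OF c(1) t c(2) p \<alpha> section_smooth[OF s t]])
qed

lemma sec_deriv_add:
  assumes t: "(U, \<psi>) \<in> trivs E" and p: "p \<in> over U" and s: "s \<in> sections LTE" "s' \<in> sections LTE"
    and \<alpha>: "\<alpha> \<in> fiber Es (fst p)"
  shows "sec_deriv \<psi> (s + s') p \<alpha> = sec_deriv \<psi> s p \<alpha> + sec_deriv \<psi> s' p \<alpha>"
proof -
  let ?r = "\<lambda>t::real. (fst p, snd p + t *\<^sub>R \<alpha>)"
  have "adapted \<psi> (?r t) ((s + s') (?r t)) = adapted \<psi> (?r t) (s (?r t)) + adapted \<psi> (?r t) (s' (?r t))" for t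
    using over_line[OF p \<alpha>, of t] over_triv_carrier[OF t] section_in[OF s(1)] section_in[OF s(2)]
    by (simp add: linear_on_plus[OF adapted_linear_on[OF t]] subset_iff)
  then show ?thesis
    using has_vector_derivative_add[OF sec_deriv_has[OF t p s(1) \<alpha>] sec_deriv_has[OF t p s(2) \<alpha>]]
    by (simp add: sec_deriv_def[of _ "s + s'"] fiber_deriv_def vector_derivative_at)
qed

lemma sec_deriv_smult:
  assumes t: "(U, \<psi>) \<in> trivs E" and p: "p \<in> over U" and s: "s \<in> sections LTE" and f: "f \<in> C_inf M"
    and \<alpha>: "\<alpha> \<in> fiber Es (fst p)"
  shows "sec_deriv \<psi> (smult f s) p \<alpha> = f p *\<^sub>R sec_deriv \<psi> s p \<alpha> + fiber_deriv f p \<alpha> *\<^sub>R adapted \<psi> p (s p)"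
proof -
  let ?r = "\<lambda>t::real. (fst p, snd p + t *\<^sub>R \<alpha>)"
  have pM: "p \<in> carrier M" using p over_triv_carrier[OF t] by blast
  have "((\<lambda>t. f (?r t)) has_real_derivative fiber_deriv f p \<alpha>) (at 0)"
    using fiber_deriv_has_vector_derivative[OF openin_carrier[OF preM] pM \<alpha>] f
    by (simp add: C_inf_def has_real_derivative_iff_has_vector_derivative)
  from has_vector_derivative_scaleR[OF this sec_deriv_has[OF t p s \<alpha>]]
  have "((\<lambda>t. f (?r t) *\<^sub>R adapted \<psi> (?r t) (s (?r t))) has_vector_derivative
      f p *\<^sub>R sec_deriv \<psi> s p \<alpha> + fiber_deriv f p \<alpha> *\<^sub>R adapted \<psi> p (s p)) (at 0)"
    by simp
  moreover have "adapted \<psi> (?r t) (smult f s (?r t)) = f (?r t) *\<^sub>R adapted \<psi> (?r t) (s (?r t))" for t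
    using over_line[OF p \<alpha>, of t] over_triv_carrier[OF t] section_in[OF s]
    by (simp add: smult_def linear_on_scaleR[OF adapted_linear_on[OF t]] subset_iff)
  ultimately show ?thesis by (simp add: sec_deriv_def[of _ "smult f s"] fiber_deriv_def vector_derivative_at)
qed

text \<open>The change of adapted coordinates \<open>?G\<close> is linear and depends on the base
  point only. It is therefore constant along the line that is differentiated and commutes with the
  derivative.\<close>

lemma local_bracket_transition:
  assumes t: "(U, \<psi>) \<in> trivs E" and t': "(U', \<psi>') \<in> trivs E" and p: "p \<in> over U" "p \<in> over U'"
    and s: "s \<in> sections LTE" "s' \<in> sections LTE" and v: "v \<in> fiber LTE p"
    and eq: "adapted \<psi> p v = local_bracket \<psi> s s' p"
  shows "adapted \<psi>' p v = local_bracket \<psi>' s s' p"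
proof -
  let ?q = "fst p"
  have q: "?q \<in> U" "?q \<in> U'" using over_fst(1) p by blast+
  have pM: "p \<in> carrier M" using p over_triv_carrier[OF t] by blast
  let ?G = "\<lambda>y. (\<psi>' ?q (triv_inv E \<psi> ?q (fst y)), dtriv \<psi>' ?q (riesz_functional (fiber E) \<psi> ?q (snd y)))"
  have lin1: "linear (\<lambda>y. \<psi>' ?q (triv_inv E \<psi> ?q y))"
    by (rule linear_on_triv_inv[OF E t q(1) triv_linear_on[OF E t' q(2)]])
  have lin2: "linear (\<lambda>y. dtriv \<psi>' ?q (riesz_functional (fiber E) \<psi> ?q y))"
    using linear_on_triv_inv[OF Es dtriv_trivs[OF t] q(1) linear_on_dual_triv[OF E t' q(2)]]
    by (simp add: inv_into_dual_triv[OF E t q(1)])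
  have G: "linear ?G"
    by (rule linearI) (simp_all add: linear_add[OF lin1] linear_add[OF lin2] linear_cmul[OF lin1] linear_cmul[OF lin2])
  have tr: "adapted \<psi>' r w = ?G (adapted \<psi> r w)"
    if r: "r \<in> carrier M" "fst r = ?q" and w: "w \<in> fiber LTE r" for r w
    using triv_inv_left[OF E t q(1), of "fst w"] fst_in[OF w] K_in[OF r(1) w] r(2)
      riesz_functional_dual_triv[OF E t q(1)] by (simp add: adapted_def)
  have D: "sec_deriv \<psi>' \<sigma> p \<alpha> = ?G (sec_deriv \<psi> \<sigma> p \<alpha>)"
    if \<sigma>: "\<sigma> \<in> sections LTE" and \<alpha>: "\<alpha> \<in> fiber Es ?q" for \<sigma> \<alpha>
  proof -
    have "adapted \<psi>' (?q, snd p + t *\<^sub>R \<alpha>) (\<sigma> (?q, snd p + t *\<^sub>R \<alpha>)) =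
        ?G (adapted \<psi> (?q, snd p + t *\<^sub>R \<alpha>) (\<sigma> (?q, snd p + t *\<^sub>R \<alpha>)))" for t
    proof (rule tr)
      show "(?q, snd p + t *\<^sub>R \<alpha>) \<in> carrier M"
        using over_line[OF p(1) \<alpha>, of t] over_triv_carrier[OF \<open>(U, \<psi>) \<in> trivs E\<close>] by blast
      then show "\<sigma> (?q, snd p + t *\<^sub>R \<alpha>) \<in> fiber LTE (?q, snd p + t *\<^sub>R \<alpha>)"
        by (rule section_in[OF \<sigma>])
    qed simp
    then show ?thesis
      using bounded_linear.has_vector_derivative[OF linear_imp_bounded_linear[OF G] sec_deriv_has[OF t p(1) \<sigma> \<alpha>]]
      by (simp add: sec_deriv_def[of \<psi>'] fiber_deriv_def vector_derivative_at)
  qed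
  have \<alpha>: "K p (s p) \<in> fiber Es ?q" "K p (s' p) \<in> fiber Es ?q"
    using K_in[OF pM section_in[OF _ pM]] s by blast+
  have "adapted \<psi>' p v = ?G (local_bracket \<psi> s s' p)" using tr[OF pM refl v] eq by simp
  also have "\<dots> = local_bracket \<psi>' s s' p"
    unfolding local_bracket_def by (simp only: linear_diff[OF G] D[OF s(2) \<alpha>(1)] D[OF s(1) \<alpha>(2)])
  finally show ?thesis .
qed

lemma adapted_bracket:
  assumes t: "(U, \<psi>) \<in> trivs E" and p: "p \<in> over U" and s: "s \<in> sections LTE" "s' \<in> sections LTE"
  shows "adapted \<psi> p (bracket s s' p) = local_bracket \<psi> s s' p" "bracket s s' p \<in> fiber LTE p"
proof -
  have pM: "p \<in> carrier M" using p over_triv_carrier[OF t] by blast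
  define \<eta> where "\<eta> = (SOME \<psi>. \<exists>U. (U, \<psi>) \<in> trivs E \<and> p \<in> over U)"
  have "\<exists>\<psi> U. (U, \<psi>) \<in> trivs E \<and> p \<in> over U" using t p by blast
  from someI_ex[OF this] obtain U' where t': "(U', \<eta>) \<in> trivs E" "p \<in> over U'"
    unfolding \<eta>_def[symmetric] by blast
  have b: "bracket s s' p = inv_into (fiber LTE p) (adapted \<eta> p) (local_bracket \<eta> s s' p)"
    using pM by (simp add: bracket_def \<eta>_def Let_def)
  show *: "bracket s s' p \<in> fiber LTE p" unfolding b by (rule adapted_inv_in[OF t'])
  show "adapted \<psi> p (bracket s s' p) = local_bracket \<psi> s s' p"
    by (rule local_bracket_transition[OF t'(1) t t'(2) p s *]) (simp add: b adapted_inv_right[OF t'])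
qed

lemma smooth_sec_deriv:
  assumes t: "(U, \<psi>) \<in> trivs E" and s: "s \<in> sections LTE" "s' \<in> sections LTE"
  shows "smooth_fun_on M (over U) (\<lambda>p. sec_deriv \<psi> s p (K p (s' p)))"
proof (rule smooth_fun_on_local[OF preM])
  fix p assume "p \<in> over U"
  with t obtain D \<phi> where c: "(D, \<phi>) \<in> base E" "p \<in> over (D \<inter> U)" by (rule over_triv_chart)
  let ?S = "over (D \<inter> U)"
  have o: "openin (atlas_topology M) ?S" by (rule openin_over_chart[OF c(1) t])
  have sub: "?S \<subseteq> over U" "?S \<subseteq> carrier M"
    using over_mono[of "D \<inter> U" U] over_triv_carrier[OF t] by auto
  have "smooth_fun_on M ?S (\<lambda>p. sec_deriv \<psi> s p (K p (s' p)))"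
    unfolding sec_deriv_def
  proof (rule smooth_fiber_deriv[OF c(1) t o subset_refl])
    show "smooth_fun_on M ?S (\<lambda>r. adapted \<psi> r (s r))"
      by (rule smooth_fun_on_subset[OF section_smooth[OF s(1) t] sub(1)])
    show "K p (s' p) \<in> fiber Es (fst p)" if "p \<in> ?S" for p
      using that sub(2) K_in section_in[OF s(2)] by blast
    have "smooth_fun_on M ?S (\<lambda>r. snd (adapted \<psi> r (s' r)))"
      by (rule smooth_fun_on_snd[OF preM o smooth_fun_on_subset[OF section_smooth[OF s(2) t] sub(1)]])
    then show "smooth_fun_on M ?S (\<lambda>p. dtriv \<psi> (fst p) (K p (s' p)))" by (simp add: adapted_def)
  qed
  then show "\<exists>W'. openin (atlas_topology M) W' \<and> p \<in> W' \<and>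
      smooth_fun_on M W' (\<lambda>p. sec_deriv \<psi> s p (K p (s' p)))"
    using o c(2) by blast
qed

lemma bracket_in_sections:
  assumes s: "s \<in> sections LTE" "s' \<in> sections LTE"
  shows "bracket s s' \<in> sections LTE"
  unfolding adapted_sections_iff
proof (intro conjI ballI allI impI)
  show "bracket s s' p \<in> fiber LTE p" if p: "p \<in> carrier M" for p
  proof -
    obtain U \<psi> where "(U, \<psi>) \<in> trivs E" "p \<in> over U" using p by (rule carrierM_triv)
    then show ?thesis by (rule adapted_bracket(2)[OF _ _ s])
  qed
  show "bracket s s' p = 0" if "p \<notin> carrier M" for p
    using that by (simp add: bracket_def)
  fix U \<psi> assume t: "(U, \<psi>) \<in> trivs E"
  have "smooth_fun_on M (over U) (\<lambda>p. local_bracket \<psi> s s' p)"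
    unfolding local_bracket_def
    by (intro smooth_fun_on_diff smooth_sec_deriv[OF t] s preM openin_over_triv[OF t])
  then show "smooth_fun_on M (over U) (\<lambda>p. adapted \<psi> p (bracket s s' p))"
    by (rule smooth_fun_on_cong[OF preM openin_over_triv[OF t], THEN iffD1, rotated])
      (simp add: adapted_bracket(1)[OF t _ s])
qed

section \<open>The anchors\<close>

lemma vlift_lincomb:
  assumes p: "p \<in> carrier M" and \<alpha>: "\<alpha> \<in> fiber Es (fst p)" "\<beta> \<in> fiber Es (fst p)"
  shows "vlift p (a *\<^sub>R \<alpha> + b *\<^sub>R \<beta>) = a *\<^sub>R vlift p \<alpha> + b *\<^sub>R vlift p \<beta>"
    and "vlift p \<alpha> \<in> tangent_space M p"
proof -
  obtain U \<psi> where t: "(U, \<psi>) \<in> trivs E" "p \<in> over U" using p by (rule carrierM_triv)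
  obtain D \<phi> where c: "(D, \<phi>) \<in> base E" "p \<in> over (D \<inter> U)" using t by (rule over_triv_chart)
  note vl = vlift_chart_vector[OF c(1) t(1) c(2)]
  have q: "fst p \<in> U" using over_fst(1)[OF t(2)] .
  have lin: "linear (chart_vector M (echart D \<phi> U \<psi>) p)"
    by (rule linear_chart_vector[OF preM echart_in[OF c(1) t(1)] c(2)])
  have mem: "a *\<^sub>R \<alpha> + b *\<^sub>R \<beta> \<in> fiber Es (fst p)"
    using \<alpha> by (intro subspace_add subspace_scale subspace_fiber_dual_bundle)
  have "(0::'m, dtriv \<psi> (fst p) (a *\<^sub>R \<alpha> + b *\<^sub>R \<beta>)) =
      a *\<^sub>R (0, dtriv \<psi> (fst p) \<alpha>) + b *\<^sub>R (0, dtriv \<psi> (fst p) \<beta>)"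
    using linear_onD[OF linear_on_dual_triv[OF E t(1) q] \<alpha>] by simp
  then show "vlift p (a *\<^sub>R \<alpha> + b *\<^sub>R \<beta>) = a *\<^sub>R vlift p \<alpha> + b *\<^sub>R vlift p \<beta>"
    unfolding vl[OF mem] vl[OF \<alpha>(1)] vl[OF \<alpha>(2)]
    by (simp only: linear_add[OF lin] linear_cmul[OF lin])
  show "vlift p \<alpha> \<in> tangent_space M p"
    unfolding vl[OF \<alpha>(1)] by (rule chart_vector_in_tangent_space[OF mfdM echart_in[OF c(1) t(1)] c(2)])
qed

text \<open>In charts the anchor sends \<open>(u, w)\<close> to the vertical vector with components
  \<open>(0, w + shear p u)\<close>, up to a change of the dual frame; each ingredient is
  smooth.\<close>

lemma vb_morphism_vanchor: "vb_morphism LTE (tangent_bundle M) vanchor"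
proof (rule vb_morphismI[OF vector_bundle_LTE vector_bundle_tangent_bundle[OF mfdM]], unfold base_LTE)
  show "M = base (tangent_bundle M)" by (simp add: tangent_bundle_def)
  show "linear_on (fiber LTE p) (vanchor p) \<and> vanchor p ` fiber LTE p \<subseteq> fiber (tangent_bundle M) p"
    if p: "p \<in> carrier M" for p
  proof
    show "linear_on (fiber LTE p) (vanchor p)"
      unfolding linear_on_def vanchor_def
      using linear_onD[OF K_linear_on[OF p]] vlift_lincomb(1)[OF p] K_in[OF p] by simp
    show "vanchor p ` fiber LTE p \<subseteq> fiber (tangent_bundle M) p"
      using vlift_lincomb(2)[OF p] K_in[OF p] by (auto simp: vanchor_def tangent_bundle_def)
  qed
  fix S \<Psi> C' \<Theta> z assume "(S, \<Psi>) \<in> trivs LTE" "(C', \<Theta>) \<in> trivs (tangent_bundle M)"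
  then obtain D \<phi> U \<psi> \<Phi>' where c: "(D, \<phi>) \<in> base E" and t: "(U, \<psi>) \<in> trivs E"
    and S: "S = over (D \<inter> U)" "\<Psi> = lt_triv D \<phi> U \<psi>"
    and C': "(C', \<Phi>') \<in> M" and \<Theta>: "\<Theta> = components M (C', \<Phi>')"
    unfolding trivs_LTE_iff by (auto simp: tangent_bundle_def)
  from C' obtain D' \<phi>' U' \<psi>' where c': "(D', \<phi>') \<in> base E" and t': "(U', \<psi>') \<in> trivs E"
    and C'eq: "C' = over (D' \<inter> U')" "\<Phi>' = chart_map \<phi>' (dtriv \<psi>')" by (rule M_cases)
  let ?W = "S \<inter> C'"
  have W: "openin (atlas_topology M) ?W"
    unfolding S C'eq using openin_over_chart[OF c t] openin_over_chart[OF c' t'] by (rule openin_Int)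
  have WM: "?W \<subseteq> carrier M" unfolding S using chart_domain_carrier[OF echart_in[OF c t]] by blast
  have mem: "K p (lt_vec D \<phi> U \<psi> p z) \<in> fiber Es (fst p)" if "p \<in> ?W" for p
    using that WM K_in lt_vec_in[OF c t] unfolding S by blast
  have "smooth_fun_on M ?W (\<lambda>p. snd z + shear U \<psi> D \<phi> p (fst z))"
    unfolding S
    by (rule smooth_fun_on_subset[OF smooth_fun_on_add[OF preM openin_over_chart[OF c t] smooth_fun_on_const
            smooth_shear[OF t c smooth_fun_on_const]]]) auto
  then have "smooth_fun_on M ?W (\<lambda>p. dtriv \<psi> (fst p) (K p (lt_vec D \<phi> U \<psi> p z)))"
  proof (rule smooth_fun_on_cong[OF preM W, THEN iffD1, rotated])
    fix p assume "p \<in> ?W"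
    then have "p \<in> over (D \<inter> U)" unfolding S by blast
    from adapted_lt_vec[OF t c this, of "fst z" "snd z"]
    show "snd z + shear U \<psi> D \<phi> p (fst z) = dtriv \<psi> (fst p) (K p (lt_vec D \<phi> U \<psi> p z))"
      by (simp add: adapted_def)
  qed
  moreover have "?W \<subseteq> over (U \<inter> U')" by (auto simp: S C'eq chart_dom_def)
  ultimately have "smooth_fun_on M ?W (\<lambda>p. dtriv \<psi>' (fst p) (K p (lt_vec D \<phi> U \<psi> p z)))"
    using smooth_dual_change[OF t t' W _ mem] by blast
  then have "smooth_fun_on M ?W (\<lambda>p. (0::'m, dtriv \<psi>' (fst p) (K p (lt_vec D \<phi> U \<psi> p z))))"
    by (intro smooth_fun_on_Pair smooth_fun_on_const preM W)
  then show "smooth_fun_on M ?W (\<lambda>p. \<Theta> p (vanchor p (inv_into (fiber LTE p) (\<Psi> p) z)))"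
  proof (rule smooth_fun_on_cong[OF preM W, THEN iffD1, rotated])
    fix p assume p: "p \<in> ?W"
    then have "p \<in> over (D \<inter> U)" "p \<in> over (D' \<inter> U')" unfolding S C'eq by blast+
    then show "(0, dtriv \<psi>' (fst p) (K p (lt_vec D \<phi> U \<psi> p z))) =
        \<Theta> p (vanchor p (inv_into (fiber LTE p) (\<Psi> p) z))"
      unfolding \<Theta> C'eq S vanchor_def using inv_into_lt_triv[OF c t] components_vlift[OF c' t'] mem[OF p] by simp
  qed
qed

section \<open>Bilinearity and the Leibniz rule\<close>

lemma sec_deriv_scaleR:
  assumes t: "(U, \<psi>) \<in> trivs E" and p: "p \<in> over U" and s: "s \<in> sections LTE" and \<alpha>: "\<alpha> \<in> fiber Es (fst p)"
  shows "sec_deriv \<psi> (a *\<^sub>R s) p \<alpha> = a *\<^sub>R sec_deriv \<psi> s p \<alpha>"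
proof -
  have "a *\<^sub>R s = smult (\<lambda>_. a) s" by (simp add: smult_def scaleR_fun_def)
  moreover have "(\<lambda>_. a) \<in> C_inf M" by (simp add: C_inf_def smooth_fun_on_const)
  ultimately show ?thesis
    using sec_deriv_smult[OF t p s _ \<alpha>, of "\<lambda>_. a"] by (simp add: fiber_deriv_def)
qed

lemma local_bracket_lincomb:
  assumes t: "(U, \<psi>) \<in> trivs E" and p: "p \<in> over U"
    and s: "s \<in> sections LTE" "s1 \<in> sections LTE" "s2 \<in> sections LTE"
  shows "local_bracket \<psi> s (a *\<^sub>R s1 + b *\<^sub>R s2) p = a *\<^sub>R local_bracket \<psi> s s1 p + b *\<^sub>R local_bracket \<psi> s s2 p"
proof -
  have pM: "p \<in> carrier M" using p over_triv_carrier[OF t] by blast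
  note Ks = K_in[OF pM section_in[OF _ pM]]
  have "K p ((a *\<^sub>R s1 + b *\<^sub>R s2) p) = a *\<^sub>R K p (s1 p) + b *\<^sub>R K p (s2 p)"
    using linear_onD[OF K_linear_on[OF pM] section_in[OF s(2) pM] section_in[OF s(3) pM]]
    by (simp add: scaleR_fun_def)
  then show ?thesis
    using sec_deriv_lincomb[OF t p s(1) Ks[OF s(2)] Ks[OF s(3)], of a b]
      sec_deriv_add[OF t p sections_scaleR[OF vector_bundle_LTE s(2), of a]
        sections_scaleR[OF vector_bundle_LTE s(3), of b] Ks[OF s(1)]]
      sec_deriv_scaleR[OF t p s(2) Ks[OF s(1)], of a] sec_deriv_scaleR[OF t p s(3) Ks[OF s(1)], of b]
    by (simp add: local_bracket_def scaleR_diff_right)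
qed

lemma local_bracket_swap: "local_bracket \<psi> s' s p = - local_bracket \<psi> s s' p"
  by (simp add: local_bracket_def)

text \<open>Equations between sections are tested in adapted coordinates. Linearity in the second
  argument is \<open>local_bracket_lincomb\<close>, and skew-symmetry transfers it to the
  first.\<close>

lemma bracket_linear:
  assumes s: "s \<in> sections LTE"
  shows "linear_on (sections LTE) (\<lambda>s'. bracket s s')" "linear_on (sections LTE) (\<lambda>s'. bracket s' s)"
proof -
  note V = vector_bundle_LTE
  have *: "\<sigma> = a *\<^sub>R \<tau>1 + b *\<^sub>R \<tau>2"
    if st: "\<sigma> \<in> sections LTE" "\<tau>1 \<in> sections LTE" "\<tau>2 \<in> sections LTE"
      and eq: "\<And>U \<psi> p. (U, \<psi>) \<in> trivs E \<Longrightarrow> p \<in> over U \<Longrightarrow>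
        adapted \<psi> p (\<sigma> p) = a *\<^sub>R adapted \<psi> p (\<tau>1 p) + b *\<^sub>R adapted \<psi> p (\<tau>2 p)" for \<sigma> \<tau>1 \<tau>2 a b
  proof (rule sections_eqI[OF st(1) sections_add[OF V sections_scaleR[OF V st(2)] sections_scaleR[OF V st(3)]]])
    fix U \<psi> p assume t: "(U, \<psi>) \<in> trivs E" and p: "p \<in> over U"
    have pM: "p \<in> carrier M" using p over_triv_carrier[OF t] by blast
    show "adapted \<psi> p (\<sigma> p) = adapted \<psi> p ((a *\<^sub>R \<tau>1 + b *\<^sub>R \<tau>2) p)"
      using linear_onD[OF adapted_linear_on[OF t p] section_in[OF st(2) pM] section_in[OF st(3) pM], of a b]
        eq[OF t p] by (simp add: scaleR_fun_def)
  qed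
  have lc: "a *\<^sub>R s1 + b *\<^sub>R s2 \<in> sections LTE" if "s1 \<in> sections LTE" "s2 \<in> sections LTE" for a b s1 s2
    by (intro sections_add sections_scaleR V that)
  show "linear_on (sections LTE) (\<lambda>s'. bracket s s')"
    unfolding linear_on_def
  proof (intro ballI allI)
    fix s1 s2 a b assume s12: "s1 \<in> sections LTE" "s2 \<in> sections LTE"
    show "bracket s (a *\<^sub>R s1 + b *\<^sub>R s2) = a *\<^sub>R bracket s s1 + b *\<^sub>R bracket s s2"
      by (rule *[OF bracket_in_sections[OF s lc[OF s12]] bracket_in_sections[OF s s12(1)] bracket_in_sections[OF s s12(2)]])
        (simp add: adapted_bracket(1)[OF _ _ s] s12 lc[OF s12] local_bracket_lincomb s)
  qed
  show "linear_on (sections LTE) (\<lambda>s'. bracket s' s)"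
    unfolding linear_on_def
  proof (intro ballI allI)
    fix s1 s2 a b assume s12: "s1 \<in> sections LTE" "s2 \<in> sections LTE"
    show "bracket (a *\<^sub>R s1 + b *\<^sub>R s2) s = a *\<^sub>R bracket s1 s + b *\<^sub>R bracket s2 s"
      by (rule *[OF bracket_in_sections[OF lc[OF s12] s] bracket_in_sections[OF s12(1) s] bracket_in_sections[OF s12(2) s]])
        (simp add: adapted_bracket(1)[OF _ _ _ s] s12 lc[OF s12] local_bracket_lincomb s local_bracket_swap[of _ _ s])
  qed
qed

lemma anchor_deriv_vanchor:
  "f \<in> C_inf M \<Longrightarrow> anchor_deriv vanchor s f p = fiber_deriv f p (K p (s p))"
  by (simp add: anchor_deriv_def vanchor_def vlift_def)

lemma smooth_anchor_deriv:
  assumes s: "s \<in> sections LTE" and f: "f \<in> C_inf M"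
  shows "anchor_deriv vanchor s f \<in> C_inf M"
  unfolding C_inf_def mem_Collect_eq
proof (rule smooth_fun_on_local[OF preM])
  fix p assume "p \<in> carrier M"
  then obtain U \<psi> where t: "(U, \<psi>) \<in> trivs E" "p \<in> over U" by (rule carrierM_triv)
  then obtain D \<phi> where c: "(D, \<phi>) \<in> base E" "p \<in> over (D \<inter> U)" by (rule over_triv_chart)
  let ?S = "over (D \<inter> U)"
  have o: "openin (atlas_topology M) ?S" by (rule openin_over_chart[OF c(1) t(1)])
  have sub: "?S \<subseteq> over U" "?S \<subseteq> carrier M"
    using over_mono[of "D \<inter> U" U] over_triv_carrier[OF t(1)] by auto
  have "smooth_fun_on M ?S (\<lambda>p. fiber_deriv f p (K p (s p)))"
  proof (rule smooth_fiber_deriv[OF c(1) t(1) o subset_refl])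
    show "smooth_fun_on M ?S f"
      using f smooth_fun_on_subset[OF _ sub(2)] by (simp add: C_inf_def)
    show "K p (s p) \<in> fiber Es (fst p)" if "p \<in> ?S" for p
      using that sub(2) K_in section_in[OF s] by blast
    have "smooth_fun_on M ?S (\<lambda>r. snd (adapted \<psi> r (s r)))"
      by (rule smooth_fun_on_snd[OF preM o smooth_fun_on_subset[OF section_smooth[OF s t(1)] sub(1)]])
    then show "smooth_fun_on M ?S (\<lambda>p. dtriv \<psi> (fst p) (K p (s p)))" by (simp add: adapted_def)
  qed
  then have "smooth_fun_on M ?S (anchor_deriv vanchor s f)"
    by (rule smooth_fun_on_cong[OF preM o, THEN iffD1, rotated]) (simp add: anchor_deriv_vanchor[OF f])
  then show "\<exists>W'. openin (atlas_topology M) W' \<and> p \<in> W' \<and> smooth_fun_on M W' (anchor_deriv vanchor s f)"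
    using o c(2) by blast
qed

lemma C_inf_mult: "f \<in> C_inf M \<Longrightarrow> g \<in> C_inf M \<Longrightarrow> f * g \<in> C_inf M"
  unfolding C_inf_def mem_Collect_eq times_fun_def by (rule smooth_fun_on_mult[OF preM openin_carrier[OF preM]])

text \<open>By the product rule, differentiating a rescaled section adds one term with the
  derivative of the factor. That derivative is taken along the value of \<open>K\<close>, which is
  exactly the action of the anchor; scaling the direction itself is linear.\<close>

lemma bracket_leibniz:
  assumes f: "f \<in> C_inf M" "f' \<in> C_inf M" and s: "s \<in> sections LTE" "s' \<in> sections LTE"
  shows "bracket (smult f s) (smult f' s') =
    smult (f * anchor_deriv vanchor s f') s' - smult (f' * anchor_deriv vanchor s' f) s + smult (f * f') (bracket s s')"
    (is "_ = ?A - ?B + ?C")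
proof -
  note V = vector_bundle_LTE
  note sm = sections_smult[OF V, unfolded base_LTE]
  have A: "?A \<in> sections LTE" "?B \<in> sections LTE" "?C \<in> sections LTE"
    by (intro sm s C_inf_mult smooth_anchor_deriv f bracket_in_sections)+
  \<comment> \<open>Rewritten because closure of sections is available for sums and scalar
    multiples.\<close>
  have "?A - ?B + ?C = ?A + (- 1) *\<^sub>R ?B + ?C" by simp
  then have R: "?A - ?B + ?C \<in> sections LTE"
    using sections_add[OF V sections_add[OF V A(1) sections_scaleR[OF V A(2), of "- 1"]] A(3)] by metis
  show ?thesis
  proof (rule sections_eqI[OF bracket_in_sections[OF sm[OF s(1) f(1)] sm[OF s(2) f(2)]] R])
    fix U \<psi> p assume t: "(U, \<psi>) \<in> trivs E" and p: "p \<in> over U"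
    have pM: "p \<in> carrier M" using p over_triv_carrier[OF t] by blast
    note sp = section_in[OF s(1) pM] section_in[OF s(2) pM] section_in[OF bracket_in_sections[OF s] pM]
    note Ks = K_in[OF pM sp(1)] K_in[OF pM sp(2)]
    let ?a = "\<lambda>\<sigma>. adapted \<psi> p (\<sigma> p)"
    have sub: "subspace (fiber LTE p)" by (rule vector_bundle_subspace[OF V, unfolded base_LTE, OF pM])
    note al = adapted_linear_on[OF t p]
    have diff: "adapted \<psi> p (v - w) = adapted \<psi> p v - adapted \<psi> p w" if "v \<in> fiber LTE p" "w \<in> fiber LTE p" for v w
      using linear_onD[OF al that, of 1 "- 1"] by simp
    have "?a (?A - ?B + ?C) = ?a ?A - ?a ?B + ?a ?C"
      using section_in[OF A(1) pM] section_in[OF A(2) pM] section_in[OF A(3) pM]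
      by (simp add: linear_on_plus[OF al] subspace_diff[OF sub] diff)
    also have "?a ?A = (f p * fiber_deriv f' p (K p (s p))) *\<^sub>R ?a s'"
      by (simp add: smult_def linear_on_scaleR[OF al] sp anchor_deriv_vanchor[OF f(2)])
    also have "?a ?B = (f' p * fiber_deriv f p (K p (s' p))) *\<^sub>R ?a s"
      by (simp add: smult_def linear_on_scaleR[OF al] sp anchor_deriv_vanchor[OF f(1)])
    also have "?a ?C = (f p * f' p) *\<^sub>R local_bracket \<psi> s s' p"
      by (simp add: smult_def linear_on_scaleR[OF al] sp adapted_bracket(1)[OF t p s])
    finally have R: "?a (?A - ?B + ?C) = (f p * fiber_deriv f' p (K p (s p))) *\<^sub>R ?a s'
        - (f' p * fiber_deriv f p (K p (s' p))) *\<^sub>R ?a s + (f p * f' p) *\<^sub>R local_bracket \<psi> s s' p" .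
    have Kf: "K p (smult f s p) = f p *\<^sub>R K p (s p)" "K p (smult f' s' p) = f' p *\<^sub>R K p (s' p)"
      by (simp_all add: smult_def linear_on_scaleR[OF K_linear_on[OF pM]] sp)
    have scale: "sec_deriv \<psi> \<sigma> p (r *\<^sub>R \<alpha>) = r *\<^sub>R sec_deriv \<psi> \<sigma> p \<alpha>"
      if "\<sigma> \<in> sections LTE" "\<alpha> \<in> fiber Es (fst p)" for \<sigma> r \<alpha>
      using sec_deriv_lincomb[OF t p that that(2), of r 0] by simp
    have "?a (bracket (smult f s) (smult f' s')) = local_bracket \<psi> (smult f s) (smult f' s') p"
      by (rule adapted_bracket(1)[OF t p sm[OF s(1) f(1)] sm[OF s(2) f(2)]])
    also have "\<dots> = f p *\<^sub>R sec_deriv \<psi> (smult f' s') p (K p (s p)) - f' p *\<^sub>R sec_deriv \<psi> (smult f s) p (K p (s' p))"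
      by (simp add: local_bracket_def Kf scale sm f s Ks)
    also have "\<dots> = ?a (?A - ?B + ?C)"
      unfolding R sec_deriv_smult[OF t p s(1) f(1) Ks(2)] sec_deriv_smult[OF t p s(2) f(2) Ks(1)]
      by (simp add: local_bracket_def algebra_simps)
    finally show "?a (bracket (smult f s) (smult f' s')) = ?a (?A - ?B + ?C)" .
  qed
qed

lemma algebroid_LTE: "algebroid LTE bracket vanchor vanchor"
  unfolding algebroid_def base_LTE
  using vector_bundle_LTE bracket_in_sections bracket_linear vb_morphism_vanchor bracket_leibniz by blast

section \<open>The Liouville section\<close>

definition liouville where
  "liouville p = (\<lambda>v. if p \<in> carrier M \<and> v \<in> fiber LTE p then snd p (fst v) else 0)"

text \<open>The coordinate form, in which the value is bilinear in the fibre coordinate of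
  \<open>p\<close> and the first adapted component of \<open>v\<close>. All smoothness and
  derivative computations start from it.\<close>

lemma liouville_eq:
  assumes t: "(U, \<psi>) \<in> trivs E" and p: "p \<in> over U" and v: "v \<in> fiber LTE p"
  shows "liouville p v = inner (dtriv \<psi> (fst p) (snd p)) (fst (adapted \<psi> p v))"
  using dual_triv_inner[OF E t over_fst(1)[OF p] _ fst_in[OF v], of "snd p"] over_fst(2)[OF p] v
    over_triv_carrier[OF t] p
  by (auto simp: liouville_def adapted_def fiber_dual_bundle_iff)

lemma smooth_fiber_coord:
  "(U, \<psi>) \<in> trivs E \<Longrightarrow> smooth_fun_on M (over U) (\<lambda>p. dtriv \<psi> (fst p) (snd p))"
  using smooth_fun_on_triv[OF Es dtriv_trivs] .

text \<open>Its Riesz vector is \<open>(y, 0)\<close> with \<open>y\<close> the fibre coordinate of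
  the base point, in the original trivialisations as well: these share their first component with
  the adapted ones, and the second does not occur.\<close>

lemma liouville_section: "liouville \<in> sections (dual_bundle LTE)"
  unfolding sections_iff[OF vector_bundle_dual_bundle[OF vector_bundle_LTE]] base_dual_bundle base_LTE
proof (intro conjI ballI allI impI)
  fix p assume p: "p \<in> carrier M"
  have sub: "subspace (fiber LTE p)" by (rule vector_bundle_subspace[OF vector_bundle_LTE, unfolded base_LTE, OF p])
  have "snd p \<in> fiber Es (fst p)" using p by (simp add: carrierM over_fst)
  then have "linear_on (fiber E (fst p)) (snd p)" by (simp add: fiber_dual_bundle_iff)
  then show "liouville p \<in> fiber (dual_bundle LTE) p"
    unfolding fiber_dual_bundle_iff linear_on_def liouville_def
    using p fst_in subspace_add[OF sub] subspace_scale[OF sub] by simp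
next
  show "liouville p = 0" if "p \<notin> carrier M" for p
    using that by (simp add: liouville_def fun_eq_iff)
next
  fix S \<Theta> assume "(S, \<Theta>) \<in> trivs (dual_bundle LTE)"
  then obtain D \<phi> U \<psi> where c: "(D, \<phi>) \<in> base E" and t: "(U, \<psi>) \<in> trivs E"
    and S: "S = over (D \<inter> U)" "\<Theta> = dual_triv (fiber LTE) (lt_triv D \<phi> U \<psi>)"
    unfolding trivs_dual_bundle_iff trivs_LTE_iff by blast
  have tV: "(over (D \<inter> U), lt_triv D \<phi> U \<psi>) \<in> trivs LTE" using c t trivs_LTE_iff by blast
  have o: "openin (atlas_topology M) S" unfolding S by (rule openin_over_chart[OF c t])
  have sub: "S \<subseteq> over U" unfolding S by (rule over_mono) auto
  have "smooth_fun_on M S (\<lambda>p. (dtriv \<psi> (fst p) (snd p), 0::'k))"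
    by (intro smooth_fun_on_Pair smooth_fun_on_const preM o smooth_fun_on_subset[OF smooth_fiber_coord[OF t] sub])
  then show "smooth_fun_on M S (\<lambda>p. \<Theta> p (liouville p))"
  proof (rule smooth_fun_on_cong[OF preM o, THEN iffD1, rotated])
    fix p assume p: "p \<in> S"
    have "\<Theta> p (liouville p) = (dtriv \<psi> (fst p) (snd p), 0)"
      unfolding S
    proof (rule dual_triv_eqI[OF vector_bundle_LTE tV p[unfolded S]])
      fix v assume v: "v \<in> fiber LTE p"
      show "liouville p v = inner (dtriv \<psi> (fst p) (snd p), 0) (lt_triv D \<phi> U \<psi> p v)"
        using liouville_eq[OF t _ v] p sub adapted_eq_lt_triv[OF t c _ v] p S(1)
        by (auto simp: inner_prod_def)
    qed
    then show "(dtriv \<psi> (fst p) (snd p), 0) = \<Theta> p (liouville p)" by simp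
  qed
qed

text \<open>Needed before the anchors can act on the pairing, since \<open>vlift\<close> returns 0
  on functions outside \<open>C_inf M\<close>.\<close>

lemma pairing_liouville_smooth:
  assumes s: "s \<in> sections LTE"
  shows "pairing liouville s \<in> C_inf M"
  unfolding C_inf_def mem_Collect_eq
proof (rule smooth_fun_on_local[OF preM])
  fix p assume "p \<in> carrier M"
  then obtain U \<psi> where t: "(U, \<psi>) \<in> trivs E" "p \<in> over U" by (rule carrierM_triv)
  have o: "openin (atlas_topology M) (over U)" by (rule openin_over_triv[OF t(1)])
  have "smooth_fun_on M (over U) (\<lambda>p. inner (dtriv \<psi> (fst p) (snd p)) (fst (adapted \<psi> p (s p))))"
    by (intro smooth_fun_on_inner smooth_fun_on_fst smooth_fiber_coord section_smooth s t preM o)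
  then have "smooth_fun_on M (over U) (pairing liouville s)"
  proof (rule smooth_fun_on_cong[OF preM o, THEN iffD1, rotated])
    fix r assume r: "r \<in> over U"
    then have "r \<in> carrier M" using over_triv_carrier[OF t(1)] by blast
    from liouville_eq[OF t(1) r section_in[OF s this]]
    show "inner (dtriv \<psi> (fst r) (snd r)) (fst (adapted \<psi> r (s r))) = pairing liouville s r"
      by (simp add: pairing_def)
  qed
  then show "\<exists>W'. openin (atlas_topology M) W' \<and> p \<in> W' \<and> smooth_fun_on M W' (pairing liouville s)"
    using o t(2) by blast
qed

text \<open>Product rule for the coordinate form: the fibre coordinate moves with velocity given by
  \<alpha>, which contributes \<alpha> evaluated on the component in \<open>E\<close>; the other
  term differentiates the section.\<close>

lemma fiber_deriv_pairing:
  assumes t: "(U, \<psi>) \<in> trivs E" and p: "p \<in> over U" and s: "s \<in> sections LTE" and \<alpha>: "\<alpha> \<in> fiber Es (fst p)"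
  shows "fiber_deriv (pairing liouville s) p \<alpha> =
    \<alpha> (fst (s p)) + inner (dtriv \<psi> (fst p) (snd p)) (fst (sec_deriv \<psi> s p \<alpha>))"
proof -
  let ?r = "\<lambda>t::real. (fst p, snd p + t *\<^sub>R \<alpha>)"
  let ?y = "dtriv \<psi> (fst p) (snd p)" and ?a = "dtriv \<psi> (fst p) \<alpha>"
  have pM: "p \<in> carrier M" using p over_triv_carrier[OF t] by blast
  have q: "fst p \<in> U" using over_fst(1)[OF p] .
  have "((\<lambda>t. ?y + t *\<^sub>R ?a) has_vector_derivative ?a) (at 0)"
    by (auto intro!: derivative_eq_intros)
  from bounded_bilinear.has_vector_derivative[OF bounded_bilinear_inner this
      bounded_linear.has_vector_derivative[OF bounded_linear_fst sec_deriv_has[OF t p s \<alpha>]]]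
  have "((\<lambda>t. inner (?y + t *\<^sub>R ?a) (fst (adapted \<psi> (?r t) (s (?r t))))) has_vector_derivative
      inner ?y (fst (sec_deriv \<psi> s p \<alpha>)) + inner ?a (fst (adapted \<psi> p (s p)))) (at 0)"
    by simp
  moreover have "pairing liouville s (?r t) = inner (?y + t *\<^sub>R ?a) (fst (adapted \<psi> (?r t) (s (?r t))))" for t
  proof -
    have r: "?r t \<in> over U" by (rule over_line[OF p \<alpha>])
    then have "?r t \<in> carrier M" using over_triv_carrier[OF \<open>(U, \<psi>) \<in> trivs E\<close>] by blast
    then have "s (?r t) \<in> fiber LTE (?r t)" by (rule section_in[OF s])
    moreover have "dtriv \<psi> (fst p) (1 *\<^sub>R snd p + t *\<^sub>R \<alpha>) = 1 *\<^sub>R ?y + t *\<^sub>R ?a"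
      by (rule linear_onD[OF linear_on_dual_triv[OF E \<open>(U, \<psi>) \<in> trivs E\<close> q] over_fst(2)[OF p] \<alpha>])
    ultimately show ?thesis
      using liouville_eq[OF \<open>(U, \<psi>) \<in> trivs E\<close> r] by (simp add: pairing_def)
  qed
  moreover have "inner ?a (fst (adapted \<psi> p (s p))) = \<alpha> (fst (s p))"
    using dual_triv_inner[OF E t q _ fst_in[OF section_in[OF s pM]], of \<alpha>] \<alpha>
    by (simp add: adapted_def fiber_dual_bundle_iff)
  ultimately show ?thesis by (simp add: fiber_deriv_def vector_derivative_at)
qed

section \<open>The canonical symplectic form\<close>

definition symplectic_form where
  "symplectic_form p v w = K p w (fst v) - K p v (fst w)"

text \<open>The two terms that differentiate sections form the pairing with the local bracket and
  cancel against the last term of \<open>d_lr\<close>. What remains is the value of \<open>K\<close>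
  on one section evaluated on the other, and the sign of the form comes from the minus in front of
  \<open>d_lr\<close>.\<close>

lemma symplectic_form_eq_d_lr:
  assumes s: "s \<in> sections LTE" "s' \<in> sections LTE" and p: "p \<in> carrier M"
  shows "symplectic_form p (s p) (s' p) = - d_lr bracket vanchor vanchor liouville s s' p"
proof -
  obtain U \<psi> where t: "(U, \<psi>) \<in> trivs E" "p \<in> over U" using p by (rule carrierM_triv)
  note Ks = K_in[OF p section_in[OF s(1) p]] K_in[OF p section_in[OF s(2) p]]
  have "pairing liouville (bracket s s') p =
      inner (dtriv \<psi> (fst p) (snd p)) (fst (local_bracket \<psi> s s' p))"
    using liouville_eq[OF t adapted_bracket(2)[OF t s]] adapted_bracket(1)[OF t s] by (simp add: pairing_def)
  then show ?thesis
    using fiber_deriv_pairing[OF t s(2) Ks(1)] fiber_deriv_pairing[OF t s(1) Ks(2)]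
    by (simp add: d_lr_def anchor_deriv_vanchor pairing_liouville_smooth s symplectic_form_def local_bracket_def
        inner_diff_right)
qed

lemma tensor02_symplectic_form: "tensor02 LTE symplectic_form"
  unfolding tensor02_def base_LTE
proof (intro conjI ballI)
  fix p v assume p: "p \<in> carrier M" and v: "v \<in> fiber LTE p"
  have lin: "linear_on (fiber E (fst p)) (K p w)" if "w \<in> fiber LTE p" for w
    using K_in[OF p that] by (simp add: fiber_dual_bundle_iff)
  have Kl: "K p (a *\<^sub>R w + b *\<^sub>R w') e = a * K p w e + b * K p w' e"
    if "w \<in> fiber LTE p" "w' \<in> fiber LTE p" for a b w w' e
    using linear_onD[OF K_linear_on[OF p] that, of a b] by (simp add: scaleR_fun_def)
  show "linear_on (fiber LTE p) (\<lambda>w. symplectic_form p v w)" "linear_on (fiber LTE p) (\<lambda>w. symplectic_form p w v)"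
    unfolding linear_on_def symplectic_form_def
    using linear_onD[OF lin[OF v] fst_in fst_in] Kl by (simp_all add: algebra_simps)
next
  fix s s' assume s: "s \<in> sections LTE" "s' \<in> sections LTE"
  have "smooth_fun_on M (carrier M) (\<lambda>p. symplectic_form p (s p) (s' p))"
  proof (rule smooth_fun_on_local[OF preM])
    fix p assume "p \<in> carrier M"
    then obtain U \<psi> where t: "(U, \<psi>) \<in> trivs E" "p \<in> over U" by (rule carrierM_triv)
    have o: "openin (atlas_topology M) (over U)" by (rule openin_over_triv[OF t(1)])
    have "smooth_fun_on M (over U) (\<lambda>p. inner (snd (adapted \<psi> p (s' p))) (fst (adapted \<psi> p (s p)))
        - inner (snd (adapted \<psi> p (s p))) (fst (adapted \<psi> p (s' p))))"
      by (intro smooth_fun_on_diff smooth_fun_on_inner smooth_fun_on_fst smooth_fun_on_snd section_smooth s t preM o)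
    then have "smooth_fun_on M (over U) (\<lambda>p. symplectic_form p (s p) (s' p))"
    proof (rule smooth_fun_on_cong[OF preM o, THEN iffD1, rotated])
      fix r assume r: "r \<in> over U"
      then have rM: "r \<in> carrier M" using over_triv_carrier[OF t(1)] by blast
      note sr = section_in[OF s(1) rM] section_in[OF s(2) rM]
      show "inner (snd (adapted \<psi> r (s' r))) (fst (adapted \<psi> r (s r)))
          - inner (snd (adapted \<psi> r (s r))) (fst (adapted \<psi> r (s' r))) = symplectic_form r (s r) (s' r)"
        using K_dtriv_inner[OF t(1) r sr(2) fst_in[OF sr(1)]] K_dtriv_inner[OF t(1) r sr(1) fst_in[OF sr(2)]]
        by (simp add: symplectic_form_def adapted_def)
    qed
    then show "\<exists>W'. openin (atlas_topology M) W' \<and> p \<in> W' \<and>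
        smooth_fun_on M W' (\<lambda>p. symplectic_form p (s p) (s' p))"
      using o t(2) by blast
  qed
  then show "(\<lambda>p. symplectic_form p (s p) (s' p)) \<in> C_inf M" by (simp add: C_inf_def)
qed

text \<open>In adapted coordinates this is the standard form on a space paired with its dual, and
  every pair of coordinates belongs to some vector of the fibre.\<close>

lemma nondegenerate_symplectic_form: "nondegenerate LTE symplectic_form"
  unfolding nondegenerate_def base_LTE
proof (intro ballI impI)
  fix p v assume p: "p \<in> carrier M" and v: "v \<in> fiber LTE p"
    and zero: "\<forall>w\<in>fiber LTE p. symplectic_form p v w = 0"
  obtain U \<psi> where t: "(U, \<psi>) \<in> trivs E" "p \<in> over U" using p by (rule carrierM_triv)
  let ?z = "adapted \<psi> p v"
  \<comment> \<open>Testing against the vector with adapted coordinates \<open>(a, b)\<close>. The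
    choices \<open>(0, fst ?z)\<close> and \<open>(snd ?z, 0)\<close> then force both components of
    \<open>?z\<close> to vanish.\<close>
  have *: "inner b (fst ?z) - inner (snd ?z) a = 0" for a b
  proof -
    let ?w = "inv_into (fiber LTE p) (adapted \<psi> p) (a, b)"
    have w: "?w \<in> fiber LTE p" "adapted \<psi> p ?w = (a, b)" by (rule adapted_inv_in[OF t] adapted_inv_right[OF t])+
    have "\<psi> (fst p) (fst ?w) = a" using w(2) by (simp add: adapted_def)
    then show ?thesis
      using zero w K_dtriv_inner[OF t w(1) fst_in[OF v]] K_dtriv_inner[OF t v fst_in[OF w(1)]]
      by (simp add: symplectic_form_def) (simp add: adapted_def)
  qed
  have "inner (fst ?z) (fst ?z) = 0" "inner (snd ?z) (snd ?z) = 0"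
    using *[of "fst ?z" 0] *[of 0 "snd ?z"] by simp_all
  then have "?z = 0" by (simp add: prod_eq_iff)
  moreover have sub: "subspace (fiber LTE p)"
    by (rule vector_bundle_subspace[OF vector_bundle_LTE, unfolded base_LTE, OF p])
  moreover have "adapted \<psi> p 0 = 0"
    by (rule linear_on_zero[OF adapted_linear_on[OF t] v])
  ultimately show "v = 0" using adapted_inj[OF t v subspace_0[OF sub]] by simp
qed

lemma exact_symplectic_LTE: "exact_symplectic_algebroid LTE bracket vanchor vanchor"
  unfolding exact_symplectic_algebroid_def base_LTE
proof (intro conjI bexI exI ballI)
  show "algebroid LTE bracket vanchor vanchor" by (rule algebroid_LTE)
  show "tensor02 LTE symplectic_form" by (rule tensor02_symplectic_form)
  show "symplectic_form p (s p) (s' p) = - d_lr bracket vanchor vanchor liouville s s' p"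
    if "s \<in> sections LTE" "s' \<in> sections LTE" "p \<in> carrier M" for s s' p
    using that by (rule symplectic_form_eq_d_lr)
  show "skew_symmetric LTE symplectic_form" by (simp add: skew_symmetric_def symplectic_form_def)
  show "nondegenerate LTE symplectic_form" by (rule nondegenerate_symplectic_form)
  show "liouville \<in> sections (dual_bundle LTE)" by (rule liouville_section)
qed

end

theorem theorem4p2:
  fixes E :: "('q, 'm::fin_dim_inner, 'v::real_vector, 'k::fin_dim_inner) vbundle"
    and B :: "('q \<Rightarrow> 'v) \<Rightarrow> ('q \<Rightarrow> 'v) \<Rightarrow> 'q \<Rightarrow> 'v"
    and \<rho>l \<rho>r :: "'q \<Rightarrow> 'v \<Rightarrow> ('q \<Rightarrow> real) \<Rightarrow> real"
  assumes "algebroid E B \<rho>l \<rho>r"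
  shows "\<exists>B' \<rho>l' \<rho>r'. exact_symplectic_algebroid (left_tangent E \<rho>l) B' \<rho>l' \<rho>r'"
proof -
  interpret anchored_bundle E \<rho>l
    using assms by unfold_locales (simp_all add: algebroid_def)
  obtain K where "vertical_projection K" using vertical_projection_exists by blast
  then interpret split_anchored_bundle E \<rho>l K by unfold_locales
  show ?thesis using exact_symplectic_LTE by blast
qed

end
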